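(* Let $\mathcal{H}_4$ be the foliation on $\mathbb{P}^2$, with homogeneous coordinates $(x:y:z)$, defined by $$(2xy^2-2xyz+xz^2-4y^3+y^2z)\,\mathrm{d}x+x(4y^2-3yz-2xy+2xz)\,\mathrm{d}y+x(2y^2-xz)\,\mathrm{d}z=0.$$ It is a foliation of degree two, and it is a birational model for Santos's foliation $\mathcal{F}_4$ (that is, $\mathcal{H}_4$ and $\mathcal{F}_4$ are birationally equivalent). The foliation $\mathcal{H}_4$ is tangent to the nodal cubic $2y^3-2xy^2+2xyz-xz^2=0$, which gives rise to the link of $\mathcal{F}_4$, to the inflectional line $x=0$ of this cubic, and to the smooth conic $y^2+4xy-2xz-x^2=0$. Moreover, $\mathcal{H}_4$ is the only degree-two foliation on $\mathbb{P}^2$ simultaneously tangent to this cubic, this conic and this line.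
   Context: All foliations are singular holomorphic foliations by curves with isolated singularities on complex surfaces. A foliation of degree $d$ on $\mathbb{P}^2$ is given by a homogeneous $1$-form $A\,\mathrm{d}x+B\,\mathrm{d}y+C\,\mathrm{d}z$ on $\mathbb{C}^3$ with $A,B,C$ homogeneous of degree $d+1$ without common factor and $xA+yB+zC=0$, up to multiplication by a nonzero constant. A foliation is tangent to a curve if the curve is invariant by the foliation. Two foliated surfaces are birationally equivalent if there is a birational map between the surfaces taking one foliation to the other. Santos's foliation $\mathcal{F}_4$: let $\mathcal{E}_4$ be the foliation on $\mathbb{P}^1\times\mathbb{P}^1$ given in the affine chart $(X,Y)$ by $Y\,\mathrm{d}X-\mathrm{i}X\,\mathrm{d}Y=0$, $\mathrm{i}=\sqrt{-1}$. It is preserved by the order-four automorphism $T_4(X,Y)=(Y,1/X)$, which cyclically permutes the four invariant lines of the cycle $\Delta_4$ formed by $\mathbb{P}^1\times\{0\}$, $\mathbb{P}^1\times\{\infty\}$, $\{0\}\times\mathbb{P}^1$, $\{\infty\}\times\mathbb{P}^1$. Let $M_4$ be the minimal desingularization of $(\mathbb{P}^1\times\mathbb{P}^1)/\langle T_4\rangle$ (a rational surface). $\mathcal{F}_4$ is the foliation on $M_4$ induced by $\mathcal{E}_4$. A link for a foliation on a smooth projective surface is an invariant rational curve $C$ with exactly one node, with $C^2>0$, such that the node is the unique singularity of the foliation along $C$ and is reduced and non-degenerate (non-zero eigenvalues $\lambda_1,\lambda_2$ with $\lambda_2/\lambda_1\notin\mathbb{Q}^+$). The image of $\Delta_4$ in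 $M_4$ is a link for $\mathcal{F}_4$, with $C^2=2$. That the cubic "gives rise to the link" means that, under the birational equivalence between $\mathcal{H}_4$ and $\mathcal{F}_4$, the strict transform of the cubic is this link. *)

theory Defs
  imports "HOL-Analysis.Analysis" "HOL-Library.Function_Algebras"
begin

section \<open>Projective varieties\<close>

text \<open>
  A point of a complex projective space is given by its homogeneous coordinate vectors. Vectors are
  functions on the natural numbers, and \<open>proj n\<close> collects the homogeneous coordinate vectors of the
  points of \<open>n\<close>-dimensional projective space. A subset of projective space is always represented
  by its punctured affine cone, that is, by the set of all homogeneous coordinate vectors of
  its points. In this way projective spaces of all dimensions live in a single type.
\<close>

type_synonym vec = "nat \<Rightarrow> complex"

definition smul :: "complex \<Rightarrow> vec \<Rightarrow> vec" where
  "smul c v = (\<lambda>i. c * v i)"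

definition proj :: "nat \<Rightarrow> vec set" where
  "proj n = {v. v \<noteq> 0 \<and> (\<forall>i>n. v i = 0)}"

inductive polyfun :: "(vec \<Rightarrow> complex) \<Rightarrow> bool" where
  const: "polyfun (\<lambda>v. c)"
| coord: "polyfun (\<lambda>v. v i)"
| add: "polyfun f \<Longrightarrow> polyfun g \<Longrightarrow> polyfun (\<lambda>v. f v + g v)"
| mult: "polyfun f \<Longrightarrow> polyfun g \<Longrightarrow> polyfun (\<lambda>v. f v * g v)"

text \<open>Homogeneous polynomials of degree \<open>d\<close>, as polynomial functions; the zero polynomial is
  included in every degree.\<close>

definition form :: "nat \<Rightarrow> (vec \<Rightarrow> complex) \<Rightarrow> bool" where
  "form d f \<longleftrightarrow> polyfun f \<and> (\<forall>c v. f (smul c v) = c ^ d * f v)"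

definition proj_closed :: "vec set \<Rightarrow> bool" where
  "proj_closed X \<longleftrightarrow>
     (\<exists>n E. (\<forall>f\<in>E. \<exists>d. form d f) \<and> X = {v \<in> proj n. \<forall>f\<in>E. f v = 0})"

definition proj_variety :: "vec set \<Rightarrow> bool" where
  "proj_variety X \<longleftrightarrow> proj_closed X \<and> X \<noteq> {} \<and>
     (\<forall>A B. proj_closed A \<longrightarrow> proj_closed B \<longrightarrow> X \<subseteq> A \<union> B \<longrightarrow> X \<subseteq> A \<or> X \<subseteq> B)"

definition zclosure :: "vec set \<Rightarrow> vec set" where
  "zclosure S = \<Inter>{A. proj_closed A \<and> S \<subseteq> A}"

text \<open>The \<open>k\<close>-th derivative of \<open>f\<close> at \<open>v\<close> along the line with direction \<open>w\<close>.\<close>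

definition dird :: "nat \<Rightarrow> (vec \<Rightarrow> complex) \<Rightarrow> vec \<Rightarrow> vec \<Rightarrow> complex" where
  "dird k f v w = (deriv ^^ k) (\<lambda>t. f (v + smul t w)) 0"

text \<open>Zariski tangent space of the affine cone over \<open>X\<close>; its dimension exceeds
  the one of the projective tangent space by one. Since all but finitely many coordinates vanish
  on a projective variety, they vanish on the tangent vectors as well.\<close>

definition tangent :: "vec set \<Rightarrow> vec \<Rightarrow> vec set" where
  "tangent X v = {w. \<forall>d f. form d f \<longrightarrow> (\<forall>u\<in>X. f u = 0) \<longrightarrow> dird 1 f v w = 0}"

definition cdim :: "vec set \<Rightarrow> nat" where
  "cdim S = vector_space.dim smul S"

definition smooth_surface :: "vec set \<Rightarrow> bool" where
  "smooth_surface X \<longleftrightarrow> proj_variety X \<and> (\<forall>v\<in>X. cdim (tangent X v) = 3)"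

section \<open>Rational maps\<close>

text \<open>A rational map is given by a tuple of homogeneous polynomials of a common degree.
  Tuples that are proportional on \<open>X\<close> represent the same rational map. Both notions require
  that the tuples do not vanish identically on \<open>X\<close>.\<close>

definition rat_map :: "vec set \<Rightarrow> vec set \<Rightarrow> (vec \<Rightarrow> vec) \<Rightarrow> bool" where
  "rat_map X Y \<phi> \<longleftrightarrow> (\<exists>d. \<forall>i. form d (\<lambda>v. \<phi> v i)) \<and> (\<exists>v\<in>X. \<phi> v \<noteq> 0) \<and>
     (\<forall>v\<in>X. \<phi> v \<noteq> 0 \<longrightarrow> \<phi> v \<in> Y)"

definition same_map :: "vec set \<Rightarrow> (vec \<Rightarrow> vec) \<Rightarrow> (vec \<Rightarrow> vec) \<Rightarrow> bool" where
  "same_map X \<phi> \<psi> \<longleftrightarrow> (\<exists>v\<in>X. \<phi> v \<noteq> 0) \<and> (\<exists>v\<in>X. \<psi> v \<noteq> 0) \<and>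
     (\<forall>v\<in>X. \<forall>i j. \<phi> v i * \<psi> v j = \<phi> v j * \<psi> v i)"

text \<open>The graph of a rational map over its domain of definition: at each point,
  any representing tuple that does not vanish there may be used.\<close>

definition rgraph :: "vec set \<Rightarrow> vec set \<Rightarrow> (vec \<Rightarrow> vec) \<Rightarrow> (vec \<times> vec) set" where
  "rgraph X Y \<phi> = {(v, w). v \<in> X \<and>
     (\<exists>\<psi> c. rat_map X Y \<psi> \<and> same_map X \<phi> \<psi> \<and> \<psi> v \<noteq> 0 \<and> c \<noteq> 0 \<and> w = smul c (\<psi> v))}"

definition morphism :: "vec set \<Rightarrow> vec set \<Rightarrow> (vec \<Rightarrow> vec) \<Rightarrow> bool" where
  "morphism X Y \<phi> \<longleftrightarrow> rat_map X Y \<phi> \<and> X \<subseteq> Domain (rgraph X Y \<phi>)"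

definition birational :: "vec set \<Rightarrow> vec set \<Rightarrow> (vec \<Rightarrow> vec) \<Rightarrow> bool" where
  "birational X Y \<phi> \<longleftrightarrow> rat_map X Y \<phi> \<and>
     (\<exists>\<psi>. rat_map Y X \<psi> \<and> same_map X (\<psi> \<circ> \<phi>) id \<and> same_map Y (\<phi> \<circ> \<psi>) id)"

text \<open>Strict transform of a curve \<open>C\<close>: Zariski closure of the image of the part of \<open>C\<close> lying in
  the domain of definition.\<close>

definition strict_transform :: "vec set \<Rightarrow> vec set \<Rightarrow> (vec \<Rightarrow> vec) \<Rightarrow> vec set \<Rightarrow> vec set" where
  "strict_transform X Y \<phi> C = zclosure (rgraph X Y \<phi> `` C)"

section \<open>Quotients and minimal desingularizations\<close>

text \<open>Quotient of \<open>X\<close> by the cyclic group generated by an automorphism \<open>T\<close> of finite order: the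
  fibres are the orbits, and invariant morphisms factor through \<open>q\<close>. The last condition is what
  makes \<open>Q\<close> the quotient variety and not only a bijective image of it.\<close>

definition cyclic_quotient :: "vec set \<Rightarrow> (vec \<Rightarrow> vec) \<Rightarrow> vec set \<Rightarrow> (vec \<Rightarrow> vec) \<Rightarrow> bool" where
  "cyclic_quotient X T Q q \<longleftrightarrow> proj_variety Q \<and> morphism X Q q \<and> same_map X (q \<circ> T) q \<and>
     Q \<subseteq> Range (rgraph X Q q) \<and>
     (\<forall>v w u. (v, u) \<in> rgraph X Q q \<longrightarrow> (w, u) \<in> rgraph X Q q \<longrightarrow>
        (\<exists>k c. c \<noteq> 0 \<and> w = smul c ((T ^^ k) v))) \<and>
     (\<forall>Y f. proj_variety Y \<longrightarrow> morphism X Y f \<longrightarrow> same_map X (f \<circ> T) f \<longrightarrow>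
        (\<exists>g. morphism Q Y g \<and> same_map X (g \<circ> q) f))"

definition desingularization :: "vec set \<Rightarrow> vec set \<Rightarrow> (vec \<Rightarrow> vec) \<Rightarrow> bool" where
  "desingularization Q M \<pi> \<longleftrightarrow> smooth_surface M \<and> morphism M Q \<pi> \<and> birational M Q \<pi>"

definition minimal_desingularization :: "vec set \<Rightarrow> vec set \<Rightarrow> (vec \<Rightarrow> vec) \<Rightarrow> bool" where
  "minimal_desingularization Q M \<pi> \<longleftrightarrow> desingularization Q M \<pi> \<and>
     (\<forall>M' \<pi>'. desingularization Q M' \<pi>' \<longrightarrow>
        (\<exists>h. morphism M' M h \<and> same_map M' (\<pi> \<circ> h) \<pi>'))"

section \<open>Foliations\<close>

text \<open>
  A foliation on a smooth projective surface \<open>X\<close> is represented by the field that maps a point of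
  the affine cone to the kernel, in the tangent space of the cone, of a local defining \<open>1\<close>-form.
  Locally, the \<open>1\<close>-form may be taken with homogeneous polynomial coefficients \<open>\<omega> v i\<close> (the
  coefficient of the \<open>i\<close>-th coordinate differential) and annihilating the radial direction. At a
  nonsingular point the kernel is two-dimensional and contains the radial direction; at a
  singular point it is the whole tangent space. The singularities are required to be isolated.
\<close>

definition pairing :: "vec \<Rightarrow> vec \<Rightarrow> complex" where
  "pairing a w = (\<Sum>i | w i \<noteq> 0. a i * w i)"

definition foliation_on :: "vec set \<Rightarrow> (vec \<Rightarrow> vec set) \<Rightarrow> bool" where
  "foliation_on X F \<longleftrightarrow>
     (\<forall>v\<in>X. \<exists>g e \<omega> d. form e g \<and> g v \<noteq> 0 \<and> (\<forall>i. form d (\<lambda>u. \<omega> u i)) \<and>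
        (\<forall>u\<in>X. g u \<noteq> 0 \<longrightarrow> pairing (\<omega> u) u = 0 \<and>
           F u = {w \<in> tangent X u. pairing (\<omega> u) w = 0})) \<and>
     (\<exists>S. finite S \<and> (\<forall>u\<in>X. F u = tangent X u \<longrightarrow> (\<exists>s\<in>S. \<exists>c. u = smul c s)))"

text \<open>The pull-back of \<open>G\<close> under a rational map \<open>\<phi>\<close> that is generically a local isomorphism is \<open>F\<close>. As the
  singularities are isolated, it suffices to compare both on a nonempty Zariski open subset. For
  birational \<open>\<phi>\<close> this says that \<open>\<phi>\<close> takes \<open>F\<close> to \<open>G\<close>.\<close>

definition pulls_back :: "vec set \<Rightarrow> (vec \<Rightarrow> vec) \<Rightarrow> (vec \<Rightarrow> vec set) \<Rightarrow> (vec \<Rightarrow> vec set) \<Rightarrow> bool" where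
  "pulls_back X \<phi> G F \<longleftrightarrow>
     (\<exists>g e. form e g \<and> (\<exists>v\<in>X. g v \<noteq> 0) \<and>
        (\<forall>v\<in>X. g v \<noteq> 0 \<longrightarrow> \<phi> v \<noteq> 0 \<and>
           (\<forall>w\<in>tangent X v. w \<in> F v \<longleftrightarrow> (\<lambda>i. dird 1 (\<lambda>u. \<phi> u i) v w) \<in> G (\<phi> v))))"

text \<open>The curve \<open>Z\<close> is invariant: at each of its smooth points its tangent line is contained in the
  kernel of the foliation.\<close>

definition tangent_to :: "(vec \<Rightarrow> vec set) \<Rightarrow> vec set \<Rightarrow> bool" where
  "tangent_to F Z \<longleftrightarrow> (\<forall>v\<in>Z. cdim (tangent Z v) = 2 \<longrightarrow> tangent Z v \<subseteq> F v)"

section \<open>Santos's foliation\<close>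

text \<open>The Segre image of the point \<open>((a0 : a1), (b0 : b1))\<close>. The affine chart is
  \<open>X = a1 / a0\<close>, \<open>Y = b1 / b0\<close>.\<close>

definition segre :: "complex \<Rightarrow> complex \<Rightarrow> complex \<Rightarrow> complex \<Rightarrow> vec" where
  "segre a0 a1 b0 b1 = (\<lambda>i. 0)(0 := a0 * b0, 1 := a1 * b0, 2 := a0 * b1, 3 := a1 * b1)"

definition P1P1 :: "vec set" where
  "P1P1 = {segre a0 a1 b0 b1 | a0 a1 b0 b1. (a0, a1) \<noteq> (0, 0) \<and> (b0, b1) \<noteq> (0, 0)}"

definition Delta4 :: "vec set" where
  "Delta4 = {segre a0 a1 b0 b1 | a0 a1 b0 b1. (a0, a1) \<noteq> (0, 0) \<and> (b0, b1) \<noteq> (0, 0) \<and>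
     (a0 = 0 \<or> a1 = 0 \<or> b0 = 0 \<or> b1 = 0)}"

definition T4 :: "vec \<Rightarrow> vec" where
  "T4 w = (\<lambda>i. 0)(0 := w 1, 1 := w 3, 2 := w 0, 3 := w 2)"

lemma T4_segre: "T4 (segre a0 a1 b0 b1) = segre b0 b1 a1 a0"
  by (auto simp: T4_def segre_def fun_eq_iff)

lemma T4_chart: "X \<noteq> 0 \<Longrightarrow> T4 (segre 1 X 1 Y) = smul X (segre 1 Y 1 (1 / X))"
  by (auto simp: T4_def segre_def smul_def fun_eq_iff)

lemma P1P1I: "w = segre a0 a1 b0 b1 \<Longrightarrow> a0 \<noteq> 0 \<or> a1 \<noteq> 0 \<Longrightarrow> b0 \<noteq> 0 \<or> b1 \<noteq> 0 \<Longrightarrow> w \<in> P1P1"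
  unfolding P1P1_def by blast

lemma P1P1_quadric: "P1P1 = {w \<in> proj 3. w 0 * w 3 = w 1 * w 2}"
proof -
  have "w \<in> P1P1" if w: "w \<in> proj 3" "w 0 * w 3 = w 1 * w 2" for w
  proof -
    have z: "w i = 0" if "i \<noteq> 0" "i \<noteq> 1" "i \<noteq> 2" "i \<noteq> 3" for i
      using w(1) that by (simp add: proj_def)
    have "\<exists>i. w i \<noteq> 0"
      using w(1) by (auto simp: proj_def fun_eq_iff)
    then consider "w 0 \<noteq> 0" | "w 1 \<noteq> 0" | "w 2 \<noteq> 0" | "w 3 \<noteq> 0"
      using z by metis
    then show ?thesis
    proof cases
      case 1
      then have "w = segre (w 0) (w 1) 1 (w 2 / w 0)"
        using w z by (auto simp: segre_def fun_eq_iff field_simps)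
      then show ?thesis using 1 by (metis P1P1I zero_neq_one)
    next
      case 2
      then have "w = segre (w 0) (w 1) 1 (w 3 / w 1)"
        using w z by (auto simp: segre_def fun_eq_iff field_simps)
      then show ?thesis using 2 by (metis P1P1I zero_neq_one)
    next
      case 3
      then have "w = segre (w 2) (w 3) (w 0 / w 2) 1"
        using w z by (auto simp: segre_def fun_eq_iff field_simps)
      then show ?thesis using 3 by (metis P1P1I zero_neq_one)
    next
      case 4
      then have "w = segre (w 2) (w 3) (w 1 / w 3) 1"
        using w z by (auto simp: segre_def fun_eq_iff field_simps)
      then show ?thesis using 4 by (metis P1P1I zero_neq_one)
    qed
  qed
  moreover have "segre a0 a1 b0 b1 \<noteq> 0" if "(a0, a1) \<noteq> (0, 0)" "(b0, b1) \<noteq> (0, 0)" for a0 a1 b0 b1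
  proof
    assume "segre a0 a1 b0 b1 = 0"
    then have "segre a0 a1 b0 b1 i = 0" for i by simp
    from this[of 0] this[of 1] this[of 2] this[of 3] that show False
      by (auto simp: segre_def)
  qed
  ultimately show ?thesis
    by (auto simp: P1P1_def proj_def segre_def)
qed

text \<open>The foliation on the quadric given by \<open>Y dX - i X dY = 0\<close> in the affine chart. The vector
  \<open>(0, a, b, a Y + X b)\<close> is the image of \<open>(a, b)\<close> under the derivative of the chart
  \<open>(X, Y) \<mapsto> (1, X, Y, X Y)\<close>.\<close>

definition is_E4 :: "(vec \<Rightarrow> vec set) \<Rightarrow> bool" where
  "is_E4 E \<longleftrightarrow> foliation_on P1P1 E \<and>
     (\<forall>X Y a b. (\<lambda>i. 0)(1 := a, 2 := b, 3 := a * Y + X * b) \<in> E (segre 1 X 1 Y)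
        \<longleftrightarrow> Y * a - \<i> * X * b = 0)"

text \<open>\<open>M\<close> is the minimal desingularization of the quotient of the quadric by \<open>T4\<close>, \<open>F\<close> is the
  foliation induced on \<open>M\<close>, and \<open>L\<close> is the link, that is, the image of the cycle of four lines
  under the rational map \<open>\<rho>\<close> from the quadric to \<open>M\<close> that lifts the quotient map.\<close>

definition santos_F4 :: "vec set \<Rightarrow> (vec \<Rightarrow> vec set) \<Rightarrow> vec set \<Rightarrow> bool" where
  "santos_F4 M F L \<longleftrightarrow>
     (\<exists>Q q \<pi> \<rho> E. cyclic_quotient P1P1 T4 Q q \<and> minimal_desingularization Q M \<pi> \<and>
        rat_map P1P1 M \<rho> \<and> same_map P1P1 (\<pi> \<circ> \<rho>) q \<and>
        is_E4 E \<and> foliation_on M F \<and> pulls_back P1P1 \<rho> F E \<and>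
        L = strict_transform P1P1 M \<rho> Delta4)"

section \<open>Plane curves and foliations of the projective plane\<close>

type_synonym fun3 = "complex \<Rightarrow> complex \<Rightarrow> complex \<Rightarrow> complex"

definition on3 :: "fun3 \<Rightarrow> vec \<Rightarrow> complex" where
  "on3 G v = G (v 0) (v 1) (v 2)"

definition curve :: "fun3 \<Rightarrow> vec set" where
  "curve G = {v \<in> proj 2. on3 G v = 0}"

definition sing_pt :: "fun3 \<Rightarrow> vec \<Rightarrow> bool" where
  "sing_pt G v \<longleftrightarrow> v \<in> curve G \<and> (\<forall>w. dird 1 (on3 G) v w = 0)"

text \<open>An ordinary double point: the quadratic part is a product of two linear forms defining
  different lines.\<close>

definition node :: "fun3 \<Rightarrow> vec \<Rightarrow> bool" where
  "node G v \<longleftrightarrow> sing_pt G v \<and>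
     (\<exists>a b. (\<forall>r s. (\<forall>i\<le>2. r * a i + s * b i = 0) \<longrightarrow> r = 0 \<and> s = 0) \<and>
        (\<forall>w. dird 2 (on3 G) v w = (\<Sum>i\<le>2. a i * w i) * (\<Sum>i\<le>2. b i * w i)))"

definition nodal_cubic :: "fun3 \<Rightarrow> bool" where
  "nodal_cubic G \<longleftrightarrow> form 3 (on3 G) \<and> proj_variety (curve G) \<and>
     (\<exists>v. node G v \<and> (\<forall>u. sing_pt G u \<longrightarrow> (\<exists>c. u = smul c v)))"

definition smooth_conic :: "fun3 \<Rightarrow> bool" where
  "smooth_conic G \<longleftrightarrow> form 2 (on3 G) \<and> (\<forall>v. \<not> sing_pt G v)"

text \<open>The line \<open>l = 0\<close> meets the curve \<open>G = 0\<close> with multiplicity at least three at a smooth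
  point of the curve.\<close>

definition inflectional_line :: "fun3 \<Rightarrow> fun3 \<Rightarrow> bool" where
  "inflectional_line G l \<longleftrightarrow> form 1 (on3 l) \<and> curve l \<noteq> proj 2 \<and> \<not> curve l \<subseteq> curve G \<and>
     (\<exists>v \<in> curve l \<inter> curve G. \<not> sing_pt G v \<and>
        (\<forall>w. on3 l w = 0 \<longrightarrow> (\<forall>k<3. dird k (on3 G) v w = 0)))"

definition plane_foliation :: "nat \<Rightarrow> fun3 \<Rightarrow> fun3 \<Rightarrow> fun3 \<Rightarrow> bool" where
  "plane_foliation d A B C \<longleftrightarrow>
     form (d + 1) (on3 A) \<and> form (d + 1) (on3 B) \<and> form (d + 1) (on3 C) \<and>
     (\<forall>x y z. x * A x y z + y * B x y z + z * C x y z = 0) \<and>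
     (\<forall>g A' B' C'. polyfun (on3 g) \<longrightarrow> polyfun (on3 A') \<longrightarrow> polyfun (on3 B') \<longrightarrow> polyfun (on3 C') \<longrightarrow>
        (\<forall>x y z. A x y z = g x y z * A' x y z \<and> B x y z = g x y z * B' x y z \<and>
           C x y z = g x y z * C' x y z) \<longrightarrow>
        (\<exists>c. \<forall>x y z. g x y z = c))"

definition plane_field :: "fun3 \<Rightarrow> fun3 \<Rightarrow> fun3 \<Rightarrow> vec \<Rightarrow> vec set" where
  "plane_field A B C v =
     {w. (\<forall>i>2. w i = 0) \<and> on3 A v * w 0 + on3 B v * w 1 + on3 C v * w 2 = 0}"

definition H4A :: fun3 where
  "H4A x y z = 2*x*y^2 - 2*x*y*z + x*z^2 - 4*y^3 + y^2*z"

definition H4B :: fun3 where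
  "H4B x y z = x * (4*y^2 - 3*y*z - 2*x*y + 2*x*z)"

definition H4C :: fun3 where
  "H4C x y z = x * (2*y^2 - x*z)"

definition H4_cubic :: fun3 where
  "H4_cubic x y z = 2*y^3 - 2*x*y^2 + 2*x*y*z - x*z^2"

definition H4_line :: fun3 where
  "H4_line x y z = x"

definition H4_conic :: fun3 where
  "H4_conic x y z = y^2 + 4*x*y - 2*x*z - x^2"

end

theory Submission
  imports Defs "HOL-Computational_Algebra.Fundamental_Theorem_Algebra"
begin

text \<open>
  The automorphism \<open>T4\<close> of the quadric is diagonal in the eigencoordinates \<open>ev1\<close>, \<open>evm\<close>,
  \<open>evi\<close>, \<open>evmi\<close>, in which the quadric becomes \<open>evi\<^sup>2 + evmi\<^sup>2 = 2 evm ev1\<close>. Hence \<open>p = evi / evm\<close>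
  and \<open>q = evmi / evm\<close> are coordinates of an affine plane in the quadric on which \<open>T4\<close> acts by
  \<open>(p, q) \<mapsto> (-i p, i q)\<close>. Its invariant rational functions are generated by
  \<open>u = p q\<close> and \<open>s = p\<^sup>4\<close>, and the map to the plane \<open>(1 : 1 - u : 2 - 3 u + (s + u\<^sup>2) / 2)\<close> is birational
  on the quotient, with inverse \<open>u = (x - y) / x\<close>, \<open>s = - conic / x\<^sup>2\<close>. It pulls back the form of \<open>H\<^sub>4\<close> to
  \<open>p\<^sup>5 ((p\<^sup>2 - q\<^sup>2) dp + 2 (p q - 1) dq)\<close> up to a constant, which is \<open>Y dX - i X dY\<close> up to a factor,
  and it maps each line of the cycle onto the nodal cubic.

  A birational map \<open>\<phi>\<close> from the plane to \<open>M\<close> is found by averaging: the map \<open>\<rho>\<close> from the quadric to \<open>M\<close>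
  is invariant up to proportionality, so after multiplying it with the conjugates of one linear
  combination of its components it is given by invariants, that is, by polynomials in \<open>u\<close> and \<open>s\<close>.
  Its inverse comes from the universal property of the quotient, applied to the closure of the image
  of a base point free system of invariants. If \<open>\<rho>\<close> is first divided by the linear factors
  vanishing on the cycle, then \<open>\<phi>\<close> is defined at the general point of the cubic, and
  the strict transforms agree.
\<close>

section \<open>Polynomial functions\<close>

text \<open>\<open>M\<close> and the quotient are known only through their defining properties, and
  a rational map is a tuple of forms that may vanish at special points. Identities are therefore
  proved where some form is nonzero and extended by the identity theorem, for which the coordinate
  rings must be integral domains. The constants in \<open>2 - 3 u + (s + u^2) / 2\<close> are the
  ones for which the conic takes the value \<open>- s\<close> at \<open>x = 1\<close>. The plane
  minus the line and the conic is then exactly the quotient of the part \<open>p \<noteq> 0\<close>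
  of the affine plane. There \<open>q = u / p\<close>, so invariants are polynomials in
  \<open>u\<close>, \<open>s\<close> and \<open>1 / s\<close>; this is the origin of the powers of
  \<open>p ^ 4\<close> that accompany every descent to the plane. The delicate point is the cubic. A
  strict transform sees a map only through representatives that do not vanish along the curve, while
  both the given tuple \<open>\<rho>\<close> and the averaging may carry factors vanishing there.
  Besides the division by linear factors, the linear combination used for averaging must therefore
  be nonzero on each of the four lines, because its conjugates along one line are its values along
  the others.\<close>

lemma polyfun_uminus: "polyfun f \<Longrightarrow> polyfun (\<lambda>v. - f v)"
  using polyfun.mult[OF polyfun.const[of "-1"], of f] by simp

lemma polyfun_diff: "polyfun f \<Longrightarrow> polyfun g \<Longrightarrow> polyfun (\<lambda>v. f v - g v)"
  using polyfun.add[OF _ polyfun_uminus, of f g] by simp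

lemma polyfun_power: "polyfun f \<Longrightarrow> polyfun (\<lambda>v. f v ^ n)"
  by (induction n) (auto intro: polyfun.intros)

lemma polyfun_sum: "(\<And>i. i \<in> A \<Longrightarrow> polyfun (f i)) \<Longrightarrow> polyfun (\<lambda>v. \<Sum>i\<in>A. f i v)"
  by (induction A rule: infinite_finite_induct) (auto intro: polyfun.intros)

lemma polyfun_divide: "polyfun f \<Longrightarrow> polyfun (\<lambda>v. f v / c)"
  using polyfun.mult[OF polyfun.const[of "inverse c"], of f] by (simp add: field_simps)

lemmas polyfun_rules = polyfun.intros polyfun_uminus polyfun_diff polyfun_power polyfun_sum
  polyfun_divide

lemma polyfun_compose:
  assumes "polyfun f" "\<And>i. polyfun (\<lambda>v. \<phi> v i)"
  shows "polyfun (\<lambda>v. f (\<phi> v))"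
  using assms(1) by induction (auto intro: polyfun.intros assms(2))

lemma polyfun_on_line:
  assumes "polyfun f"
  shows "\<exists>P. \<forall>t. f (\<lambda>i. a i + t * b i) = poly P t"
  using assms
proof induction
  case (const c)
  have "\<forall>t. c = poly [:c:] t" by simp
  then show ?case by blast
next
  case (coord i)
  have "\<forall>t. a i + t * b i = poly [:a i, b i:] t" by simp
  then show ?case by blast
next
  case (add f g)
  then obtain P Q where "\<forall>t. f (\<lambda>i. a i + t * b i) = poly P t"
    "\<forall>t. g (\<lambda>i. a i + t * b i) = poly Q t" by blast
  then show ?case by (intro exI[of _ "P + Q"]) simp
next
  case (mult f g)
  then obtain P Q where "\<forall>t. f (\<lambda>i. a i + t * b i) = poly P t"
    "\<forall>t. g (\<lambda>i. a i + t * b i) = poly Q t" by blast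
  then show ?case by (intro exI[of _ "P * Q"]) simp
qed

text \<open>On the line joining the two points both functions are nonzero polynomials in one
  variable, and their product has a non-root. The irreducibility of the quadric, the plane and the
  cubic reduces to this.\<close>

lemma polyfun_mult_nonzero:
  assumes "polyfun f" "polyfun g" "f v \<noteq> 0" "g w \<noteq> 0"
  shows "\<exists>u. f u * g u \<noteq> 0"
proof -
  define \<gamma> where "\<gamma> t = (\<lambda>i. v i + t * (w i - v i))" for t :: complex
  obtain P Q where P: "\<And>t. f (\<gamma> t) = poly P t" and Q: "\<And>t. g (\<gamma> t) = poly Q t"
    unfolding \<gamma>_def using polyfun_on_line[OF assms(1), of v "\<lambda>i. w i - v i"]
      polyfun_on_line[OF assms(2), of v "\<lambda>i. w i - v i"] by blast
  have "\<gamma> 0 = v" "\<gamma> 1 = w" by (auto simp: \<gamma>_def)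
  then have "P \<noteq> 0" "Q \<noteq> 0" using P[of 0] Q[of 1] assms(3,4) by auto
  then have "P * Q \<noteq> 0" by simp
  then obtain t where "poly (P * Q) t \<noteq> 0" by (meson poly_all_0_iff_0)
  then have "f (\<gamma> t) * g (\<gamma> t) \<noteq> 0" by (simp add: P Q)
  then show ?thesis by blast
qed

text \<open>\<open>dird\<close> is defined through \<open>deriv\<close>, which by itself gives
  neither differentiability nor linearity. A differential with both properties is built along the
  inductive definition of \<open>polyfun\<close> and identified with \<open>dird 1\<close>
  afterwards.\<close>

lemma polyfun_differential:
  assumes "polyfun f"
  shows "\<exists>L. (\<forall>v a b w w'. L v (smul a w + smul b w') = a * L v w + b * L v w') \<and>
    (\<forall>\<gamma> \<gamma>' t. (\<forall>i. ((\<lambda>t. \<gamma> t i) has_field_derivative \<gamma>' i) (at t)) \<longrightarrow>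
      ((\<lambda>t. f (\<gamma> t)) has_field_derivative L (\<gamma> t) \<gamma>') (at t))"
    (is "\<exists>L. ?P L f")
  using assms
proof induction
  case (const c)
  show ?case by (rule exI[of _ "\<lambda>v w. 0"]) simp
next
  case (coord i)
  show ?case by (rule exI[of _ "\<lambda>v w. w i"]) (simp add: smul_def)
next
  case (add f g)
  then obtain L K where LK: "?P L f" "?P K g" by blast
  note lin = LK(1)[THEN conjunct1, rule_format] LK(2)[THEN conjunct1, rule_format]
  note der = LK[THEN conjunct2, THEN spec, THEN spec, THEN spec, THEN mp]
  show ?case
    by (rule exI[of _ "\<lambda>v w. L v w + K v w"], intro conjI allI impI DERIV_add, unfold lin)
      (algebra, (erule der)+)
next
  case (mult f g)
  then obtain L K where LK: "?P L f" "?P K g" by blast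
  note lin = LK(1)[THEN conjunct1, rule_format] LK(2)[THEN conjunct1, rule_format]
  note der = LK[THEN conjunct2, THEN spec, THEN spec, THEN spec, THEN mp]
  show ?case
    by (rule exI[of _ "\<lambda>v w. L v w * g v + K v w * f v"], intro conjI allI impI DERIV_mult, unfold lin)
      (algebra, (erule der)+)
qed

lemma polyfun_dird:
  assumes "polyfun f"
  shows dird_chain: "(\<And>i. ((\<lambda>t. \<gamma> t i) has_field_derivative \<gamma>' i) (at t)) \<Longrightarrow>
      ((\<lambda>t. f (\<gamma> t)) has_field_derivative dird 1 f (\<gamma> t) \<gamma>') (at t)"
    and dird_linear: "dird 1 f v (smul a w + smul b w') = a * dird 1 f v w + b * dird 1 f v w'"
proof -
  obtain L where lin: "\<And>v a b w w'. L v (smul a w + smul b w') = a * L v w + b * L v w'"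
    and L: "\<And>\<gamma> \<gamma>' t. (\<And>i. ((\<lambda>t. \<gamma> t i) has_field_derivative \<gamma>' i) (at t)) \<Longrightarrow>
      ((\<lambda>t. f (\<gamma> t)) has_field_derivative L (\<gamma> t) \<gamma>') (at t)"
    using polyfun_differential[OF assms] by blast
  have *: "dird 1 f v w = L v w" for v w
  proof -
    have "((\<lambda>t. f (v + smul t w)) has_field_derivative L (v + smul 0 w) w) (at 0)"
      by (rule L) (auto simp: smul_def intro!: derivative_eq_intros)
    moreover have "v + smul 0 w = v" by (auto simp: smul_def fun_eq_iff)
    ultimately show ?thesis by (simp add: dird_def DERIV_imp_deriv)
  qed
  show "(\<And>i. ((\<lambda>t. \<gamma> t i) has_field_derivative \<gamma>' i) (at t)) \<Longrightarrow>
      ((\<lambda>t. f (\<gamma> t)) has_field_derivative dird 1 f (\<gamma> t) \<gamma>') (at t)"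
    unfolding * by (rule L)
  show "dird 1 f v (smul a w + smul b w') = a * dird 1 f v w + b * dird 1 f v w'"
    unfolding * by (rule lin)
qed

lemma dird_coord: "dird 1 (\<lambda>v. v i) v w = w i"
proof -
  have "((\<lambda>t. (v + smul t w) i) has_field_derivative w i) (at 0)"
    by (auto simp: smul_def intro!: derivative_eq_intros)
  then show ?thesis by (simp add: dird_def DERIV_imp_deriv)
qed

section \<open>Forms\<close>

lemma smul_apply [simp]: "smul c v i = c * v i"
  by (simp add: smul_def)

lemma smul_simps [simp]: "smul a (smul b v) = smul (a * b) v" "smul 1 v = v" "smul 0 v = 0"
  "smul c 0 = 0"
  by (auto simp: fun_eq_iff)

lemma smul_eq_0_iff [simp]: "smul c v = 0 \<longleftrightarrow> c = 0 \<or> v = 0"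
  by (auto simp: fun_eq_iff)

lemma form_polyfun: "form d f \<Longrightarrow> polyfun f"
  by (simp add: form_def)

lemma form_smul: "form d f \<Longrightarrow> f (smul c v) = c ^ d * f v"
  by (simp add: form_def)

lemma form_0: "form d (\<lambda>v. 0)"
  by (auto simp: form_def intro: polyfun.const)

lemma form_coord: "form 1 (\<lambda>v. v i)" "form (Suc 0) (\<lambda>v. v i)"
  by (auto simp: form_def intro: polyfun.coord)

lemma form_add: "form d f \<Longrightarrow> form d g \<Longrightarrow> form d (\<lambda>v. f v + g v)"
  by (auto simp: form_def distrib_left intro: polyfun.add)

lemma form_diff: "form d f \<Longrightarrow> form d g \<Longrightarrow> form d (\<lambda>v. f v - g v)"
  by (auto simp: form_def right_diff_distrib intro: polyfun_diff)

lemma form_mult: "form d f \<Longrightarrow> form e g \<Longrightarrow> form (d + e) (\<lambda>v. f v * g v)"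
  by (auto simp: form_def power_add intro: polyfun.mult)

lemma form_power: "form d f \<Longrightarrow> form (d * n) (\<lambda>v. f v ^ n)"
  by (auto simp: form_def power_mult power_mult_distrib intro: polyfun_power)

lemma form_scale: "form d f \<Longrightarrow> form d (\<lambda>v. c * f v)"
  by (auto simp: form_def intro: polyfun.intros)

lemma form_compose:
  assumes "form d f" "\<And>i. form e (\<lambda>v. \<phi> v i)"
  shows "form (e * d) (\<lambda>v. f (\<phi> v))"
proof -
  have "\<phi> (smul c v) = smul (c ^ e) (\<phi> v)" for c v
    using assms(2) by (auto simp: fun_eq_iff form_def)
  moreover have "polyfun (\<lambda>v. f (\<phi> v))"
    by (rule polyfun_compose) (use assms in \<open>simp_all add: form_def\<close>)
  ultimately show ?thesis
    using assms(1) by (simp add: form_def power_mult)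
qed

lemma tuple_smul:
  assumes "\<And>i. form e (\<lambda>v. \<phi> v i)"
  shows "\<phi> (smul c v) = smul (c ^ e) (\<phi> v)"
  using assms by (auto simp: fun_eq_iff form_def)

text \<open>Euler's identity, from \<open>v + t v = (1 + t) v\<close>.\<close>

lemma dird_form_radial:
  assumes "form d f"
  shows "dird 1 f v v = of_nat d * f v"
proof -
  have "v + smul t v = smul (1 + t) v" for t by (auto simp: fun_eq_iff algebra_simps)
  then have "f (v + smul t v) = (1 + t) ^ d * f v" for t by (simp add: form_smul[OF assms])
  moreover have "((\<lambda>t. (1 + t) ^ d * f v) has_field_derivative of_nat d * f v) (at 0)"
    by (auto intro!: derivative_eq_intros)
  ultimately show ?thesis by (simp add: dird_def DERIV_imp_deriv)
qed

text \<open>Partial derivatives of a form have degree one less; the factor \<open>c ^ d / c\<close>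
  stays correct at \<open>d = 0\<close>, where \<open>d - 1\<close> would truncate.\<close>

lemma dird_form_smul:
  assumes "form d f" "c \<noteq> 0"
  shows "dird 1 f (smul c v) w = c ^ d / c * dird 1 f v w"
proof -
  have "((\<lambda>t. f (smul c (v + smul (t / c) w))) has_field_derivative c ^ d * (1 / c * dird 1 f v w)) (at 0)"
  proof -
    have eq: "smul (1 / c) w + smul 0 0 = smul (1 / c) w" by simp
    have "((\<lambda>t. f (v + smul (t / c) w)) has_field_derivative dird 1 f (v + smul (0 / c) w) (smul (1 / c) w)) (at 0)"
      by (rule dird_chain[OF form_polyfun[OF assms(1)]])
        (use assms(2) in \<open>auto intro!: derivative_eq_intros\<close>)
    also have "dird 1 f (v + smul (0 / c) w) (smul (1 / c) w) = 1 / c * dird 1 f v w"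
      using dird_linear[OF form_polyfun[OF assms(1)], of v "1 / c" w 0 0] by (simp add: add_ac)
    finally show ?thesis
      unfolding form_smul[OF assms(1)] by (rule DERIV_cmult)
  qed
  moreover have "smul c (v + smul (t / c) w) = smul c v + smul t w" for t
    using assms(2) by (auto simp: fun_eq_iff algebra_simps)
  ultimately show ?thesis by (simp add: dird_def DERIV_imp_deriv)
qed

section \<open>Polynomials in two variables\<close>

definition bipoly :: "(complex \<Rightarrow> complex \<Rightarrow> complex) \<Rightarrow> bool" where
  "bipoly F \<longleftrightarrow> polyfun (\<lambda>v. F (v 0) (v 1))"

lemma bipoly_basic:
  "bipoly (\<lambda>p q. c)" "bipoly (\<lambda>p q. p)" "bipoly (\<lambda>p q. q)"
  "bipoly F \<Longrightarrow> bipoly G \<Longrightarrow> bipoly (\<lambda>p q. F p q + G p q)"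
  "bipoly F \<Longrightarrow> bipoly G \<Longrightarrow> bipoly (\<lambda>p q. F p q * G p q)"
  "bipoly F \<Longrightarrow> bipoly (\<lambda>p q. - F p q)"
  "bipoly F \<Longrightarrow> bipoly G \<Longrightarrow> bipoly (\<lambda>p q. F p q - G p q)"
  "bipoly F \<Longrightarrow> bipoly (\<lambda>p q. F p q ^ n)"
  "bipoly F \<Longrightarrow> bipoly (\<lambda>p q. F p q / c)"
  unfolding bipoly_def by (fact polyfun_rules)+

lemma bipoly_sum: "(\<And>i. i \<in> A \<Longrightarrow> bipoly (F i)) \<Longrightarrow> bipoly (\<lambda>p q. \<Sum>i\<in>A. F i p q)"
  unfolding bipoly_def by (rule polyfun_sum)

lemmas bipoly_rules = bipoly_basic bipoly_sum

lemma polyfun_bipoly: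
  assumes "bipoly F" "polyfun a" "polyfun b"
  shows "polyfun (\<lambda>v. F (a v) (b v))"
proof -
  define \<phi> :: "vec \<Rightarrow> vec" where "\<phi> v = (\<lambda>i. if i = 0 then a v else if i = 1 then b v else 0)" for v
  have "polyfun (\<lambda>v. \<phi> v i)" for i
    using assms(2,3) by (cases "i = 0"; cases "i = 1") (auto simp: \<phi>_def intro: polyfun.const)
  from polyfun_compose[OF assms(1)[unfolded bipoly_def], of \<phi>, OF this] show ?thesis
    by (simp add: \<phi>_def)
qed

lemma bipoly_bipoly:
  "bipoly F \<Longrightarrow> bipoly a \<Longrightarrow> bipoly b \<Longrightarrow> bipoly (\<lambda>p q. F (a p q) (b p q))"
  unfolding bipoly_def[of "\<lambda>p q. F (a p q) (b p q)"]
  by (rule polyfun_bipoly) (auto simp: bipoly_def)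

lemma bipoly_polyfun:
  "polyfun f \<Longrightarrow> (\<And>i. bipoly (\<lambda>p q. \<gamma> p q i)) \<Longrightarrow> bipoly (\<lambda>p q. f (\<gamma> p q))"
  unfolding bipoly_def by (rule polyfun_compose)

text \<open>This is the induction for \<open>polyfun\<close>, evaluated at vectors padded with
  zeros: all coordinates beyond the first two fall under the constant case.\<close>

lemma bipoly_induct [consumes 1, case_names const fst snd add mult]:
  assumes "bipoly F" "\<And>c. P (\<lambda>p q. c)" "P (\<lambda>p q. p)" "P (\<lambda>p q. q)"
    "\<And>F G. bipoly F \<Longrightarrow> bipoly G \<Longrightarrow> P F \<Longrightarrow> P G \<Longrightarrow> P (\<lambda>p q. F p q + G p q)"
    "\<And>F G. bipoly F \<Longrightarrow> bipoly G \<Longrightarrow> P F \<Longrightarrow> P G \<Longrightarrow> P (\<lambda>p q. F p q * G p q)"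
  shows "P F"
proof -
  define pt :: "complex \<Rightarrow> complex \<Rightarrow> vec"
    where "pt p q = (\<lambda>i. if i = 0 then p else if i = 1 then q else 0)" for p q
  have pt: "bipoly (\<lambda>p q. pt p q i) \<and> P (\<lambda>p q. pt p q i)" for i
  proof -
    have "(\<lambda>p q. pt p q i) \<in> {\<lambda>p q. p, \<lambda>p q. q, \<lambda>p q. 0}"
      by (cases "i = 0"; cases "i = 1"; simp add: pt_def)
    then show ?thesis
    proof (elim insertE emptyE)
      assume e: "(\<lambda>p q. pt p q i) = (\<lambda>p q. p)"
      show ?thesis unfolding e by (intro conjI bipoly_basic assms)
    next
      assume e: "(\<lambda>p q. pt p q i) = (\<lambda>p q. q)"
      show ?thesis unfolding e by (intro conjI bipoly_basic assms)
    next
      assume e: "(\<lambda>p q. pt p q i) = (\<lambda>p q. 0)"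
      show ?thesis unfolding e by (intro conjI bipoly_basic assms)
    qed
  qed
  have "P (\<lambda>p q. f (pt p q))" if "polyfun f" for f
    using that
  proof induction
    case (const c)
    show ?case by (rule assms(2))
  next
    case (coord i)
    show ?case using pt by blast
  next
    case (add f g)
    then show ?case using assms(5) bipoly_polyfun pt by presburger
  next
    case (mult f g)
    then show ?case using assms(6) bipoly_polyfun pt by presburger
  qed
  note * = this[OF assms(1)[unfolded bipoly_def]]
  have "F (pt p q 0) (pt p q 1) = F p q" for p q by (simp add: pt_def)
  with * show ?thesis by (simp only:)
qed

lemma bipoly_on_line:
  assumes "bipoly F"
  shows "\<exists>P. \<forall>t. F (a + t * b) (c + t * d) = poly P t"
  using polyfun_on_line[OF assms[unfolded bipoly_def], of "\<lambda>i. if i = 0 then a else c"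
      "\<lambda>i. if i = 0 then b else d"] by simp

text \<open>Truth on a dense open subset of the affine plane, witnessed by one polynomial;
  \<open>P\<close> itself need not be an algebraic condition.\<close>

definition genp :: "(complex \<Rightarrow> complex \<Rightarrow> bool) \<Rightarrow> bool" where
  "genp P \<longleftrightarrow> (\<exists>N. bipoly N \<and> (\<exists>p q. N p q \<noteq> 0) \<and> (\<forall>p q. N p q \<noteq> 0 \<longrightarrow> P p q))"

lemma genp_conj:
  assumes "genp P" "genp Q"
  shows "genp (\<lambda>p q. P p q \<and> Q p q)"
proof -
  obtain N p q where N: "bipoly N" "N p q \<noteq> 0" "\<forall>p q. N p q \<noteq> 0 \<longrightarrow> P p q"
    using assms(1) unfolding genp_def by blast
  obtain N' p' q' where N': "bipoly N'" "N' p' q' \<noteq> 0" "\<forall>p q. N' p q \<noteq> 0 \<longrightarrow> Q p q"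
    using assms(2) unfolding genp_def by blast
  define f :: "vec \<Rightarrow> complex" where "f = (\<lambda>u. N (u 0) (u 1))"
  define g :: "vec \<Rightarrow> complex" where "g = (\<lambda>u. N' (u 0) (u 1))"
  have "polyfun f" "polyfun g" using N(1) N'(1) by (simp_all add: f_def g_def bipoly_def)
  moreover have "f (\<lambda>i. if i = 0 then p else q) \<noteq> 0" "g (\<lambda>i. if i = 0 then p' else q') \<noteq> 0"
    using N(2) N'(2) by (simp_all add: f_def g_def)
  ultimately have "\<exists>u. f u * g u \<noteq> 0" by (rule polyfun_mult_nonzero)
  then obtain u where "f u * g u \<noteq> 0" by blast
  then have "N (u 0) (u 1) * N' (u 0) (u 1) \<noteq> 0" by (simp add: f_def g_def)
  moreover have "bipoly (\<lambda>p q. N p q * N' p q)" using N(1) N'(1) by (rule bipoly_basic)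
  ultimately show ?thesis
    unfolding genp_def using N(3) N'(3)
    by (intro exI[of _ "\<lambda>p q. N p q * N' p q"] conjI) auto
qed

lemma genp_mono: "genp P \<Longrightarrow> (\<And>p q. P p q \<Longrightarrow> Q p q) \<Longrightarrow> genp Q"
  unfolding genp_def by meson

lemma genp_ex: "genp P \<Longrightarrow> \<exists>p q. P p q"
  unfolding genp_def by meson

lemma genp_bipoly: "bipoly N \<Longrightarrow> N p q \<noteq> 0 \<Longrightarrow> genp (\<lambda>p q. N p q \<noteq> 0)"
  unfolding genp_def by meson

text \<open>Identity theorem: the open set where \<open>F\<close> is nonzero would otherwise meet
  the one where it vanishes.\<close>

lemma genp_vanish:
  assumes "genp (\<lambda>p q. F p q = 0)" "bipoly F"
  shows "F p q = 0"
proof (rule ccontr)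
  assume "F p q \<noteq> 0"
  from genp_conj[OF assms(1) genp_bipoly[OF assms(2) this]] show False
    using genp_ex by fastforce
qed

lemma genp_tuple:
  assumes "\<And>i. bipoly (\<lambda>p q. R p q i)" "R p q \<noteq> (0::vec)"
  shows "genp (\<lambda>p q. R p q \<noteq> 0)"
proof -
  obtain i where "R p q i \<noteq> 0" using assms(2) by (auto simp: fun_eq_iff)
  from genp_bipoly[OF assms(1) this] show ?thesis
    by (rule genp_mono) auto
qed

section \<open>Parallel vectors\<close>

text \<open>Proportionality is stated by vanishing minors because these are forms, so that it passes
  from an open set to all of a variety. The zero vector is parallel to every vector; transitivity
  therefore needs a nonzero middle term.\<close>

definition parallel :: "vec \<Rightarrow> vec \<Rightarrow> bool" where
  "parallel a b \<longleftrightarrow> (\<forall>i j. a i * b j = a j * b i)"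

lemma parallelE:
  assumes "parallel a b" "a \<noteq> 0"
  obtains c where "b = smul c a"
proof -
  obtain j where j: "a j \<noteq> 0" using assms(2) by (auto simp: fun_eq_iff)
  have "b i = b j / a j * a i" for i
  proof -
    have "a i * b j = a j * b i" using assms(1) by (simp add: parallel_def)
    then show ?thesis using j by (simp add: field_simps)
  qed
  then have "b = smul (b j / a j) a" unfolding fun_eq_iff smul_apply by blast
  then show thesis by (rule that)
qed

lemma parallel_sym: "parallel a b \<Longrightarrow> parallel b a"
  unfolding parallel_def by (metis mult.commute)

lemma parallel_smul: "parallel a b \<Longrightarrow> parallel (smul c a) (smul d b)"
  unfolding parallel_def by (simp add: mult_ac)

lemma parallel_refl: "parallel (smul c a) (smul d a)"
  unfolding parallel_def by simp

lemma parallel_trans: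
  assumes "parallel a b" "parallel b c" "b \<noteq> 0"
  shows "parallel a c"
  using assms by (metis parallelE parallel_sym parallel_refl)

lemma parallelE2:
  assumes "parallel a b" "a \<noteq> 0" "b \<noteq> 0"
  obtains c where "c \<noteq> 0" "b = smul c a"
  using parallelE[OF assms(1,2)] assms(3) by (metis smul_simps(3))

lemma same_map_parallel:
  "same_map X \<phi> \<psi> \<longleftrightarrow> (\<exists>v\<in>X. \<phi> v \<noteq> 0) \<and> (\<exists>v\<in>X. \<psi> v \<noteq> 0) \<and> (\<forall>v\<in>X. parallel (\<phi> v) (\<psi> v))"
  unfolding same_map_def parallel_def by blast

section \<open>Irreducibility\<close>

text \<open>The homogeneous coordinate ring of \<open>X\<close> is an integral domain.\<close>

definition form_domain :: "vec set \<Rightarrow> bool" where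
  "form_domain X \<longleftrightarrow> (\<forall>d e f g. form d f \<longrightarrow> form e g \<longrightarrow> (\<forall>v\<in>X. f v * g v = 0) \<longrightarrow>
     (\<forall>v\<in>X. f v = 0) \<or> (\<forall>v\<in>X. g v = 0))"

definition generic :: "vec set \<Rightarrow> (vec \<Rightarrow> bool) \<Rightarrow> bool" where
  "generic X P \<longleftrightarrow> (\<exists>e N. form e N \<and> (\<exists>v\<in>X. N v \<noteq> 0) \<and> (\<forall>v\<in>X. N v \<noteq> 0 \<longrightarrow> P v))"

lemma generic_conj:
  assumes "form_domain X" "generic X P" "generic X Q"
  shows "generic X (\<lambda>v. P v \<and> Q v)"
proof -
  obtain e N where N: "form e N" "\<exists>v\<in>X. N v \<noteq> 0" "\<forall>v\<in>X. N v \<noteq> 0 \<longrightarrow> P v"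
    using assms(2) unfolding generic_def by blast
  obtain e' N' where N': "form e' N'" "\<exists>v\<in>X. N' v \<noteq> 0" "\<forall>v\<in>X. N' v \<noteq> 0 \<longrightarrow> Q v"
    using assms(3) unfolding generic_def by blast
  have "\<exists>v\<in>X. N v * N' v \<noteq> 0"
    using assms(1) N(1,2) N'(1,2) unfolding form_domain_def by blast
  then show ?thesis
    unfolding generic_def using form_mult[OF N(1) N'(1)] N(3) N'(3)
    by (intro exI[of _ "e + e'"] exI[of _ "\<lambda>v. N v * N' v"]) auto
qed

lemma generic_mono: "generic X P \<Longrightarrow> (\<And>v. v \<in> X \<Longrightarrow> P v \<Longrightarrow> Q v) \<Longrightarrow> generic X Q"
  unfolding generic_def by meson

lemma generic_ex: "generic X P \<Longrightarrow> \<exists>v\<in>X. P v"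
  unfolding generic_def by meson

lemma generic_form: "form e N \<Longrightarrow> v \<in> X \<Longrightarrow> N v \<noteq> 0 \<Longrightarrow> generic X (\<lambda>v. N v \<noteq> 0)"
  unfolding generic_def by meson

lemma generic_tuple:
  assumes "\<And>i. form e (\<lambda>v. \<phi> v i)" "v \<in> X" "\<phi> v \<noteq> 0"
  shows "generic X (\<lambda>v. \<phi> v \<noteq> 0)"
proof -
  obtain i where "\<phi> v i \<noteq> 0" using assms(3) by (auto simp: fun_eq_iff)
  from generic_form[OF assms(1) assms(2) this] show ?thesis
    by (rule generic_mono) auto
qed

lemma generic_vanish:
  assumes "form_domain X" "generic X (\<lambda>v. f v = 0)" "form d f" "v \<in> X"
  shows "f v = 0"
proof (rule ccontr)
  assume "f v \<noteq> 0"
  from generic_conj[OF assms(1,2) generic_form[OF assms(3,4) this]] show False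
    using generic_ex by fastforce
qed

text \<open>The minors of two tuples of forms are again forms, hence subject to the identity
  theorem. Equality of rational maps is reduced to open sets in this way.\<close>

lemma generic_parallel:
  assumes X: "form_domain X" and gen: "generic X (\<lambda>v. parallel (\<phi> v) (\<psi> v))"
    and forms: "\<And>i. form d (\<lambda>v. \<phi> v i)" "\<And>i. form e (\<lambda>v. \<psi> v i)" and v: "v \<in> X"
  shows "parallel (\<phi> v) (\<psi> v)"
proof -
  have "\<phi> v i * \<psi> v j - \<phi> v j * \<psi> v i = 0" for i j
  proof (rule generic_vanish[OF X _ _ v])
    show "generic X (\<lambda>v. \<phi> v i * \<psi> v j - \<phi> v j * \<psi> v i = 0)"
      using gen by (rule generic_mono) (auto simp: parallel_def)
    show "form (d + e) (\<lambda>v. \<phi> v i * \<psi> v j - \<phi> v j * \<psi> v i)"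
      by (intro form_diff form_mult forms)
  qed
  then show ?thesis by (simp add: parallel_def)
qed

text \<open>Pulled back along the parametrization, a vanishing product of forms becomes a vanishing
  product of polynomial functions on an affine space. \<open>N\<close> discards parameters whose
  image is not a point of \<open>X\<close>, such as those sent to the zero vector.\<close>

lemma form_domainI:
  assumes \<gamma>: "\<And>i. polyfun (\<lambda>v. \<gamma> v i)" and N: "polyfun N" "N v0 \<noteq> 0" "\<And>v. N v \<noteq> 0 \<Longrightarrow> \<gamma> v \<in> X"
    and X: "\<And>x. x \<in> X \<Longrightarrow> \<exists>c v. x = smul c (\<gamma> v)"
  shows "form_domain X"
  unfolding form_domain_def
proof (intro allI impI)
  fix d e f g assume f: "form d f" and g: "form e g" and fg: "\<forall>v\<in>X. f v * g v = 0"
  have pf: "polyfun (\<lambda>v. f (\<gamma> v))" "polyfun (\<lambda>v. g (\<gamma> v))"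
    using f g \<gamma> by (simp_all add: form_def polyfun_compose)
  show "(\<forall>v\<in>X. f v = 0) \<or> (\<forall>v\<in>X. g v = 0)"
  proof (rule ccontr)
    assume "\<not> ?thesis"
    then obtain a b c1 c2 where ab: "f (smul c1 (\<gamma> a)) \<noteq> 0" "g (smul c2 (\<gamma> b)) \<noteq> 0"
      using X by metis
    then have "f (\<gamma> a) \<noteq> 0" "g (\<gamma> b) \<noteq> 0"
      using f g by (auto simp: form_smul)
    from polyfun_mult_nonzero[OF pf this] obtain u where "f (\<gamma> u) * g (\<gamma> u) \<noteq> 0" ..
    from polyfun_mult_nonzero[OF polyfun.mult[OF pf] N(1) this N(2)]
    obtain u where "f (\<gamma> u) * g (\<gamma> u) * N u \<noteq> 0" ..
    then show False using fg N(3) by auto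
  qed
qed

text \<open>The ambient condition \<open>v i = 0\<close> for \<open>i > n\<close> is itself given by
  linear forms. Once these are adjoined, only forms and \<open>v \<noteq> 0\<close> remain, and
  closed sets in different ambient spaces are treated alike.\<close>

lemma proj_closed_forms:
  assumes "proj_closed A"
  obtains E n where "\<And>f. f \<in> E \<Longrightarrow> \<exists>d. form d f" "\<And>v. v \<in> A \<longleftrightarrow> v \<noteq> 0 \<and> (\<forall>f\<in>E. f v = 0)"
    "A \<subseteq> proj n"
proof -
  obtain n E where E: "\<forall>f\<in>E. \<exists>d. form d f" "A = {v \<in> proj n. \<forall>f\<in>E. f v = 0}"
    using assms unfolding proj_closed_def by blast
  show thesis
  proof (rule that[of "E \<union> (\<lambda>i v. v i) ` {n<..}" n])
    show "\<exists>d. form d f" if "f \<in> E \<union> (\<lambda>i v. v i) ` {n<..}" for f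
      using that E(1) form_coord(1) by blast
    show "v \<in> A \<longleftrightarrow> v \<noteq> 0 \<and> (\<forall>f\<in>E \<union> (\<lambda>i v. v i) ` {n<..}. f v = 0)" for v
      by (auto simp: E(2) proj_def)
  qed (auto simp: E(2))
qed

lemma proj_variety_form_domain:
  assumes "proj_variety X"
  shows "form_domain X"
  unfolding form_domain_def
proof (intro allI impI)
  fix d e f g assume f: "form d f" and g: "form e g" and fg: "\<forall>v\<in>X. f v * g v = 0"
  obtain n E where E: "\<forall>f\<in>E. \<exists>d. form d f" "X = {v \<in> proj n. \<forall>f\<in>E. f v = 0}"
    using assms unfolding proj_variety_def proj_closed_def by blast
  have cl: "proj_closed {v \<in> X. h v = 0}" if "form m h" for m h
    unfolding proj_closed_def
    by (rule exI[of _ n], rule exI[of _ "insert h E"]) (use E that in auto)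
  have "X \<subseteq> {v \<in> X. f v = 0} \<union> {v \<in> X. g v = 0}" using fg by auto
  then have "X \<subseteq> {v \<in> X. f v = 0} \<or> X \<subseteq> {v \<in> X. g v = 0}"
    using assms cl[OF f] cl[OF g] unfolding proj_variety_def by blast
  then show "(\<forall>v\<in>X. f v = 0) \<or> (\<forall>v\<in>X. g v = 0)" by blast
qed

text \<open>A point outside a closed set is separated from it by a single form. If \<open>X\<close>
  were covered by two closed sets without lying in either, two separating forms would have product
  zero on \<open>X\<close>.\<close>

lemma proj_varietyI:
  assumes "proj_closed X" "X \<noteq> {}" "form_domain X"
  shows "proj_variety X"
  unfolding proj_variety_def
proof (intro conjI assms allI impI)
  fix A B assume A: "proj_closed A" and B: "proj_closed B" and X: "X \<subseteq> A \<union> B"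
  have X0: "v \<noteq> 0" if "v \<in> X" for v using assms(1) that by (auto simp: proj_closed_def proj_def)
  have sep: "\<exists>d f. form d f \<and> (\<forall>u\<in>C. f u = 0) \<and> f v \<noteq> 0" if "proj_closed C" "v \<in> X" "v \<notin> C" for C v
    using proj_closed_forms[OF that(1)] X0[OF that(2)] that(3) by metis
  show "X \<subseteq> A \<or> X \<subseteq> B"
  proof (rule ccontr)
    assume "\<not> ?thesis"
    then obtain a b where ab: "a \<in> X" "a \<notin> A" "b \<in> X" "b \<notin> B" by blast
    obtain d f where f: "form d f" "\<forall>u\<in>A. f u = 0" "f a \<noteq> 0" using sep[OF A] ab by blast
    obtain e g where g: "form e g" "\<forall>u\<in>B. g u = 0" "g b \<noteq> 0" using sep[OF B] ab by blast
    have "\<forall>v\<in>X. f v * g v = 0" using X f(2) g(2) by auto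
    then have "(\<forall>v\<in>X. f v = 0) \<or> (\<forall>v\<in>X. g v = 0)"
      using assms(3) f(1) g(1) unfolding form_domain_def by blast
    then show False using ab f(3) g(3) by blast
  qed
qed

section \<open>Eigencoordinates on the quadric\<close>

text \<open>Serves both ambient spaces: points of the plane have last entry zero.\<close>

definition vec4 :: "complex \<Rightarrow> complex \<Rightarrow> complex \<Rightarrow> complex \<Rightarrow> vec" where
  "vec4 a b c d = (\<lambda>i. 0)(0 := a, 1 := b, 2 := c, 3 := d)"

lemma vec4_simps [simp]: "vec4 a b c d 0 = a" "vec4 a b c d 1 = b" "vec4 a b c d (Suc 0) = b"
  "vec4 a b c d 2 = c" "vec4 a b c d 3 = d" "i > 3 \<Longrightarrow> vec4 a b c d i = 0"
  by (auto simp: vec4_def)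

lemma vec4_cases: "(i::nat) = 0 \<or> i = 1 \<or> i = 2 \<or> i = 3 \<or> i > 3"
  by arith

lemma polyfun_vec4:
  "polyfun a \<Longrightarrow> polyfun b \<Longrightarrow> polyfun c \<Longrightarrow> polyfun d \<Longrightarrow>
    polyfun (\<lambda>v. vec4 (a v) (b v) (c v) (d v) i)"
  using vec4_cases[of i] polyfun.const[of 0] by auto

lemma form_vec4:
  "form n a \<Longrightarrow> form n b \<Longrightarrow> form n c \<Longrightarrow> form n d \<Longrightarrow>
    form n (\<lambda>v. vec4 (a v) (b v) (c v) (d v) i)"
  using vec4_cases[of i] form_0[of n] by auto

lemma i_times_i: "\<i> * \<i> = - 1"
  by simp

lemma vec4_eq_iff: "vec4 a b c d = w \<longleftrightarrow> w 0 = a \<and> w 1 = b \<and> w 2 = c \<and> w 3 = d \<and> (\<forall>i>3. w i = 0)"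
proof
  assume *: "w 0 = a \<and> w 1 = b \<and> w 2 = c \<and> w 3 = d \<and> (\<forall>i>3. w i = 0)"
  show "vec4 a b c d = w"
  proof
    fix i show "vec4 a b c d i = w i" using vec4_cases[of i] * by auto
  qed
qed auto

lemma smul_vec4: "smul x (vec4 a b c d) = vec4 (x * a) (x * b) (x * c) (x * d)"
  by (rule sym) (simp add: vec4_eq_iff)

lemma vec4_eq_0_iff [simp]: "vec4 a b c d = 0 \<longleftrightarrow> a = 0 \<and> b = 0 \<and> c = 0 \<and> d = 0"
  by (auto simp: vec4_eq_iff)

lemma vec4_proj2: "vec4 a b c 0 \<in> proj 2 \<longleftrightarrow> (a, b, c) \<noteq> (0, 0, 0)"
proof -
  have "vec4 a b c 0 i = 0" if "i > 2" for i using vec4_cases[of i] that by auto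
  then show ?thesis by (auto simp: proj_def)
qed

lemma segre_vec4: "segre a0 a1 b0 b1 = vec4 (a0 * b0) (a1 * b0) (a0 * b1) (a1 * b1)"
  by (simp add: segre_def vec4_def)

lemma T4_vec4: "T4 w = vec4 (w 1) (w 3) (w 0) (w 2)"
  by (simp add: T4_def vec4_def)

text \<open>The suffixes of the four names stand for the eigenvalues 1, -1, i and -i under
  composition with \<open>T4\<close>.\<close>

definition ev1 :: "vec \<Rightarrow> complex" where "ev1 w = w 0 + w 1 + w 2 + w 3"
definition evm :: "vec \<Rightarrow> complex" where "evm w = w 0 - w 1 - w 2 + w 3"
definition evi :: "vec \<Rightarrow> complex" where "evi w = w 3 - w 0 + \<i> * (w 1 - w 2)"
definition evmi :: "vec \<Rightarrow> complex" where "evmi w = w 3 - w 0 - \<i> * (w 1 - w 2)"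

lemma ev_T4: "ev1 (T4 w) = ev1 w" "evm (T4 w) = - evm w" "evi (T4 w) = \<i> * evi w"
  "evmi (T4 w) = - (\<i> * evmi w)"
  by (simp_all add: T4_vec4 ev1_def evm_def evi_def evmi_def algebra_simps)

lemma form_ev: "form 1 ev1" "form 1 evm" "form 1 evi" "form 1 evmi"
  unfolding ev1_def evm_def evi_def evmi_def
  by (intro form_add form_diff form_scale form_coord)+

text \<open>Inverse stereographic projection of the quadric from the fixed point
  \<open>(1, 1)\<close> of \<open>T4\<close>; the origin corresponds to the other fixed point
  \<open>(-1, -1)\<close>. The scaling \<open>evm = 8\<close> makes all entries integral in
  \<open>p\<close> and \<open>q\<close>.\<close>

definition chart :: "complex \<Rightarrow> complex \<Rightarrow> vec" where
  "chart p q = vec4 ((p - 1)^2 + (q - 1)^2) ((p - \<i>)^2 + (q + \<i>)^2)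
     ((p + \<i>)^2 + (q - \<i>)^2) ((p + 1)^2 + (q + 1)^2)"

lemma bipoly_chart: "bipoly (\<lambda>p q. chart p q i)"
  using vec4_cases[of i]
  by (elim disjE) (simp_all add: chart_def, (intro bipoly_rules)+)

lemma ev_chart: "ev1 (chart p q) = 4 * (p^2 + q^2)" "evm (chart p q) = 8"
  "evi (chart p q) = 8 * p" "evmi (chart p q) = 8 * q"
  by (simp_all add: ev1_def evm_def evi_def evmi_def chart_def power2_eq_square algebra_simps)

lemma T4_chart_rot: "T4 (chart p q) = smul (-1) (chart (- \<i> * p) (\<i> * q))"
  by (simp add: T4_vec4 chart_def smul_vec4) (simp add: vec4_eq_iff power2_eq_square algebra_simps)

lemma P1P1_vec4: "vec4 a b c d \<in> P1P1 \<longleftrightarrow> (a, b, c, d) \<noteq> (0, 0, 0, 0) \<and> a * d = b * c"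
  by (auto simp: P1P1_quadric proj_def)

lemma P1P1_eta: "w \<in> P1P1 \<Longrightarrow> w = vec4 (w 0) (w 1) (w 2) (w 3)"
  by (rule sym) (auto simp: P1P1_quadric proj_def vec4_eq_iff)

lemma chart_P1P1: "chart p q \<in> P1P1"
proof -
  have "evm (chart p q) \<noteq> 0" by (simp add: ev_chart)
  then have "chart p q \<noteq> 0" by (auto simp: evm_def)
  then show ?thesis
    by (auto simp: chart_def P1P1_vec4 power2_eq_square algebra_simps)
qed

lemma T4_P1P1:
  assumes "w \<in> P1P1"
  shows "T4 w \<in> P1P1"
proof -
  have "vec4 (w 0) (w 1) (w 2) (w 3) \<in> P1P1" using P1P1_eta[OF assms] assms by simp
  then show ?thesis by (auto simp: T4_vec4 P1P1_vec4 mult.commute)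
qed

lemma chart_inverse:
  assumes "w \<in> P1P1" "evm w \<noteq> 0"
  shows "w = smul (evm w / 8) (chart (evi w / evm w) (evmi w / evm w))"
proof -
  define m p q where "m = evm w" and "p = evi w / m" and "q = evmi w / m"
  have m: "m \<noteq> 0" using assms by (simp add: m_def)
  have quad: "w 0 * w 3 = w 1 * w 2" using assms by (simp add: P1P1_quadric)
  have e: "evi w = p * m" "evmi w = q * m" using m by (simp_all add: p_def q_def)
  have "evi w ^ 2 + evmi w ^ 2 = 2 * (evm w * ev1 w)"
    using quad by (simp add: ev1_def evm_def evi_def evmi_def power2_eq_square algebra_simps)
  then have "m * (2 * ev1 w) = m * (m * (p^2 + q^2))"
    by (simp add: e m_def[symmetric] power2_eq_square algebra_simps)
  then have e1: "2 * ev1 w = m * (p^2 + q^2)" using m by simp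
  have "8 * w 0 = 2 * ev1 w + 2 * evm w - 2 * evi w - 2 * evmi w"
    "8 * w 3 = 2 * ev1 w + 2 * evm w + 2 * evi w + 2 * evmi w"
    "8 * w 1 = 2 * ev1 w - 2 * evm w - 2 * \<i> * evi w + 2 * \<i> * evmi w"
    "8 * w 2 = 2 * ev1 w - 2 * evm w + 2 * \<i> * evi w - 2 * \<i> * evmi w"
    by (simp_all add: ev1_def evm_def evi_def evmi_def algebra_simps)
  then have "8 * w 0 = m * ((p - 1)^2 + (q - 1)^2)" "8 * w 3 = m * ((p + 1)^2 + (q + 1)^2)"
    "8 * w 1 = m * ((p - \<i>)^2 + (q + \<i>)^2)" "8 * w 2 = m * ((p + \<i>)^2 + (q - \<i>)^2)"
    unfolding e1 e m_def[symmetric] by (simp_all add: power2_eq_square algebra_simps)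
  then have "vec4 (w 0) (w 1) (w 2) (w 3) = smul (m / 8) (chart p q)"
    by (simp add: chart_def smul_vec4) (simp add: vec4_eq_iff field_simps)
  then show ?thesis using P1P1_eta[OF assms(1)] by (simp add: p_def q_def m_def)
qed

lemma form_domain_P1P1: "form_domain P1P1"
proof (rule form_domainI)
  show "polyfun (\<lambda>v. segre (v 0) (v 1) (v 2) (v 3) i)" for i
    unfolding segre_vec4 by (intro polyfun_vec4 polyfun_rules)
  show "polyfun (\<lambda>v. v 0 * v 2)" by (intro polyfun_rules)
  show "vec4 1 1 1 1 0 * vec4 1 1 1 1 2 \<noteq> 0" by simp
  show "segre (v 0) (v 1) (v 2) (v 3) \<in> P1P1" if "v 0 * v 2 \<noteq> 0" for v :: vec
    by (rule P1P1I[OF refl]) (use that in auto)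
  show "\<exists>c (v::vec). x = smul c (segre (v 0) (v 1) (v 2) (v 3))" if x: "x \<in> P1P1" for x
  proof -
    obtain a0 a1 b0 b1 where "x = segre a0 a1 b0 b1" using x unfolding P1P1_def by blast
    then have "x = smul 1 (segre (vec4 a0 a1 b0 b1 0) (vec4 a0 a1 b0 b1 1) (vec4 a0 a1 b0 b1 2)
        (vec4 a0 a1 b0 b1 3))" by simp
    then show ?thesis by blast
  qed
qed

lemma form_domain_plane: "form_domain (proj 2)"
proof (rule form_domainI)
  show "polyfun (\<lambda>v. vec4 (v 0) (v 1) (v 2) 0 i)" for i
    by (intro polyfun_vec4 polyfun_rules)
  show "polyfun (\<lambda>v. v 0)" by (intro polyfun_rules)
  show "vec4 1 1 1 1 0 \<noteq> 0" by simp
  show "vec4 (v 0) (v 1) (v 2) 0 \<in> proj 2" if "v 0 \<noteq> 0" for v :: vec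
    using that by (simp add: vec4_proj2)
  show "\<exists>c (v::vec). x = smul c (vec4 (v 0) (v 1) (v 2) 0)" if "x \<in> proj 2" for x
  proof -
    have "vec4 (x 0) (x 1) (x 2) 0 = x" using that by (simp add: proj_def vec4_eq_iff)
    then have "x = smul 1 (vec4 (x 0) (x 1) (x 2) 0)" by simp
    then show ?thesis by blast
  qed
qed

lemma generic_chart: "generic P1P1 (\<lambda>w. \<exists>p q c. c \<noteq> 0 \<and> w = smul c (chart p q))"
proof -
  have "evm (chart 0 0) \<noteq> 0" by (simp add: ev_chart)
  from generic_form[OF form_ev(2) chart_P1P1 this] show ?thesis
  proof (rule generic_mono)
    fix w assume w: "w \<in> P1P1" "evm w \<noteq> 0"
    from chart_inverse[OF this] show "\<exists>p q c. c \<noteq> 0 \<and> w = smul c (chart p q)"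
      using w(2) by (metis divide_eq_0_iff zero_neq_numeral)
  qed
qed

lemma P1P1_vanish:
  assumes "genp (\<lambda>p q. f (chart p q) = 0)" "form d f" "w \<in> P1P1"
  shows "f w = 0"
proof (rule generic_vanish[OF form_domain_P1P1 _ assms(2,3)])
  have "f (chart p q) = 0" for p q
    by (rule genp_vanish[OF assms(1)])
      (rule bipoly_polyfun[OF form_polyfun[OF assms(2)] bipoly_chart])
  then show "generic P1P1 (\<lambda>w. f w = 0)"
    by (intro generic_mono[OF generic_chart]) (auto simp: form_smul[OF assms(2)])
qed

text \<open>A form that is not identically zero on the quadric cannot vanish on the whole chart,
  because the chart is dense.\<close>

lemma generic_genp:
  assumes "generic P1P1 P"
  shows "genp (\<lambda>p q. P (chart p q))"
proof -
  obtain e N w where N: "form e N" "w \<in> P1P1" "N w \<noteq> 0" "\<forall>v\<in>P1P1. N v \<noteq> 0 \<longrightarrow> P v"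
    using assms unfolding generic_def by blast
  have b: "bipoly (\<lambda>p q. N (chart p q))"
    by (rule bipoly_polyfun[OF form_polyfun[OF N(1)] bipoly_chart])
  have "\<exists>p q. N (chart p q) \<noteq> 0"
  proof (rule ccontr)
    assume "\<not> ?thesis"
    then have "genp (\<lambda>p q. N (chart p q) = 0)"
      using genp_bipoly[OF bipoly_basic(1)[of 1]] by (auto elim!: genp_mono)
    from P1P1_vanish[OF this N(1,2)] N(3) show False by simp
  qed
  then show ?thesis
    unfolding genp_def using b N(4) chart_P1P1 by blast
qed

section \<open>The quotient map to the plane\<close>

text \<open>The map of the overview, multiplied by \<open>evm ^ 3\<close>. On the quadric
  \<open>ev1 / evm = (p^2 + q^2) / 2\<close>, so \<open>ev1 * evi ^ 2\<close> stands for
  \<open>(s + u^2) / 2\<close>; the quartic invariant \<open>s\<close> thus enters in degree three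
  instead of four.\<close>

definition to_plane :: "vec \<Rightarrow> vec" where
  "to_plane w = vec4 (evm w ^ 3) (evm w ^ 3 - evm w * (evi w * evmi w))
     (2 * evm w ^ 3 - 3 * (evm w * (evi w * evmi w)) + ev1 w * evi w ^ 2) 0"

lemma form_to_plane: "form 3 (\<lambda>w. to_plane w i)"
proof -
  have 1: "form 3 (\<lambda>w. evm w ^ 3)" using form_power[OF form_ev(2), of 3] by simp
  have 2: "form 3 (\<lambda>w. evm w * (evi w * evmi w))"
    using form_mult[OF form_ev(2) form_mult[OF form_ev(3,4)]] by (simp add: numeral_eq_Suc)
  have 3: "form 3 (\<lambda>w. ev1 w * evi w ^ 2)"
    using form_mult[OF form_ev(1) form_power[OF form_ev(3), of 2]]
    by (simp add: numeral_eq_Suc)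
  show ?thesis
    unfolding to_plane_def by (intro form_vec4 form_add form_diff form_scale form_0 1 2 3)
qed

lemma to_plane_T4: "to_plane (T4 w) = smul (-1) (to_plane w)"
proof -
  have "- evm w * (\<i> * evi w * - (\<i> * evmi w)) = - (evm w * (evi w * evmi w))"
    "ev1 w * (\<i> * evi w) ^ 2 = - (ev1 w * evi w ^ 2)"
    using i_times_i by algebra+
  moreover have "(- evm w) ^ 3 = - (evm w ^ 3)" by simp
  ultimately show ?thesis unfolding to_plane_def ev_T4 smul_vec4 by simp
qed

lemma to_plane_chart: "to_plane (chart p q) =
    smul 512 (vec4 1 (1 - p * q) (2 - 3 * (p * q) + (p ^ 4 + (p * q)^2) / 2) 0)"
  by (simp add: to_plane_def ev_chart smul_vec4)
    (simp add: vec4_eq_iff power2_eq_square power4_eq_xxxx algebra_simps)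

text \<open>All large degrees \<open>m\<close> are provided at once, because summands, and later the
  components of a tuple, have to be brought to a common degree.\<close>

lemma homogenize:
  assumes H: "bipoly H" and f: "form 1 l" "form d f" "form e g"
  shows "\<exists>m0. \<forall>m\<ge>m0. \<exists>G. form m G \<and>
    (\<forall>w. l w \<noteq> 0 \<longrightarrow> G w = l w ^ m * H (f w / l w ^ d) (g w / l w ^ e))"
    (is "\<exists>m0. \<forall>m\<ge>m0. \<exists>G. ?P m G H")
  using H
proof (induction rule: bipoly_induct)
  case (const c)
  have "?P m (\<lambda>w. c * l w ^ m) (\<lambda>p q. c)" for m
    using form_scale[OF form_power[OF f(1), of m]] by (simp add: mult.commute)
  then show ?case by blast
next
  case fst
  have "?P m (\<lambda>w. l w ^ (m - d) * f w) (\<lambda>p q. p)" if "m \<ge> d" for m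
    using form_mult[OF form_power[OF f(1), of "m - d"] f(2)] that by (simp add: power_diff)
  then show ?case by blast
next
  case snd
  have "?P m (\<lambda>w. l w ^ (m - e) * g w) (\<lambda>p q. q)" if "m \<ge> e" for m
    using form_mult[OF form_power[OF f(1), of "m - e"] f(3)] that by (simp add: power_diff)
  then show ?case by blast
next
  case (add F1 F2)
  then obtain m1 m2 where m: "\<And>m. m \<ge> m1 \<Longrightarrow> \<exists>G. ?P m G F1" "\<And>m. m \<ge> m2 \<Longrightarrow> \<exists>G. ?P m G F2"
    by blast
  have "\<exists>G. ?P m G (\<lambda>p q. F1 p q + F2 p q)" if "m \<ge> max m1 m2" for m
  proof -
    have "m \<ge> m1" "m \<ge> m2" using that by simp_all
    with m obtain G1 G2 where "?P m G1 F1" "?P m G2 F2" by presburger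
    then have "?P m (\<lambda>w. G1 w + G2 w) (\<lambda>p q. F1 p q + F2 p q)"
      by (auto simp: distrib_left intro: form_add)
    then show ?thesis by blast
  qed
  then show ?case by blast
next
  case (mult F1 F2)
  then obtain m1 m2 where m: "\<And>m. m \<ge> m1 \<Longrightarrow> \<exists>G. ?P m G F1" "\<And>m. m \<ge> m2 \<Longrightarrow> \<exists>G. ?P m G F2"
    by blast
  have "\<exists>G. ?P m G (\<lambda>p q. F1 p q * F2 p q)" if "m \<ge> m1 + m2" for m
  proof -
    define n where "n = m - m1"
    have n: "m = m1 + n" "n \<ge> m2" using that by (simp_all add: n_def)
    obtain G1 where G1: "?P m1 G1 F1" using m(1)[OF order.refl] by blast
    obtain G2 where G2: "?P n G2 F2" using m(2)[OF n(2)] by blast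
    have "?P m (\<lambda>w. G1 w * G2 w) (\<lambda>p q. F1 p q * F2 p q)"
    proof (intro conjI allI impI)
      show "form m (\<lambda>w. G1 w * G2 w)" using form_mult[of m1 G1 n G2] G1 G2 n(1) by simp
      fix w assume "l w \<noteq> 0"
      then show "G1 w * G2 w = l w ^ m * (F1 (f w / l w ^ d) (g w / l w ^ e) * F2 (f w / l w ^ d) (g w / l w ^ e))"
        using G1 G2 by (simp add: n(1) power_add)
    qed
    then show ?thesis by blast
  qed
  then show ?case by blast
qed

text \<open>The bound \<open>n\<close> leaves finitely many nonzero components, so one degree
  suffices for all of them.\<close>

lemma homogenize_tuple:
  assumes H: "\<And>i. bipoly (\<lambda>p q. H p q i)" "\<And>p q i. i > n \<Longrightarrow> H p q i = (0::complex)"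
    and f: "form 1 l" "form d f" "form e g"
  shows "\<exists>m G. (\<forall>i. form m (\<lambda>w. G w i)) \<and>
    (\<forall>w. l w \<noteq> 0 \<longrightarrow> G w = smul (l w ^ m) (H (f w / l w ^ d) (g w / l w ^ e)))"
proof -
  define Hom where "Hom m i G \<longleftrightarrow> form m G \<and>
    (\<forall>w. l w \<noteq> 0 \<longrightarrow> G w = l w ^ m * H (f w / l w ^ d) (g w / l w ^ e) i)" for m i and G :: "vec \<Rightarrow> complex"
  have "\<exists>m0. \<forall>m\<ge>m0. \<exists>G. Hom m i G" for i
    unfolding Hom_def by (rule homogenize[OF H(1) f])
  then obtain m0 where m0: "\<And>i m. m \<ge> m0 i \<Longrightarrow> \<exists>G. Hom m i G" by metis
  define m where "m = Max (m0 ` {..n})"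
  have "\<exists>G. Hom m i G" for i
  proof (cases "i \<le> n")
    case True
    then show ?thesis by (intro m0) (simp add: m_def)
  next
    case False
    then have "Hom m i (\<lambda>w. 0)" by (simp add: Hom_def form_0 H(2))
    then show ?thesis by blast
  qed
  then obtain G where "\<And>i. Hom m i (G i)" by metis
  then show ?thesis
    by (intro exI[of _ m] exI[of _ "\<lambda>w i. G i w"]) (simp add: Hom_def fun_eq_iff)
qed

section \<open>Invariants of the plane rotation\<close>

text \<open>Away from \<open>p = 0\<close>, \<open>q = u p^3 / s\<close>, so the polynomial ring is
  generated by \<open>1, p, p^2, p^3\<close> over the invariants once \<open>s\<close> is inverted;
  \<open>k\<close> counts the denominators. The four summands are the eigencomponents of the
  rotation.\<close>

lemma quartic_decomposition:
  assumes "bipoly N"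
  shows "\<exists>k A B C D. bipoly A \<and> bipoly B \<and> bipoly C \<and> bipoly D \<and>
    (\<forall>p q. (p ^ 4) ^ k * N p q = A (p * q) (p ^ 4) + p * B (p * q) (p ^ 4) +
       p ^ 2 * C (p * q) (p ^ 4) + p ^ 3 * D (p * q) (p ^ 4))"
    (is "\<exists>k A B C D. ?P N k A B C D")
  using assms
proof (induction rule: bipoly_induct)
  case (const c)
  show ?case
    by (rule exI[of _ 0], rule exI[of _ "\<lambda>u s. c"], (rule exI[of _ "\<lambda>u s. 0"])+)
      (simp add: bipoly_rules)
next
  case fst
  show ?case
    by (rule exI[of _ 0], rule exI[of _ "\<lambda>u s. 0"], rule exI[of _ "\<lambda>u s. 1"], (rule exI[of _ "\<lambda>u s. 0"])+)
      (simp add: bipoly_rules)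
next
  case snd
  show ?case
    by (rule exI[of _ 1], rule exI[of _ "\<lambda>u s. 0"], rule exI[of _ "\<lambda>u s. 0"],
        rule exI[of _ "\<lambda>u s. 0"], rule exI[of _ "\<lambda>u s. u"]) (simp add: bipoly_rules power_numeral_reduce mult_ac)
next
  case (add F G)
  then obtain k A B C D where F: "?P F k A B C D" by blast
  from add obtain k' A' B' C' D' where G: "?P G k' A' B' C' D'" by blast
  have "(p ^ 4) ^ (k + k') * (F p q + G p q) = (p ^ 4) ^ k' * ((p ^ 4) ^ k * F p q) +
      (p ^ 4) ^ k * ((p ^ 4) ^ k' * G p q)" for p q
    by (simp add: power_add algebra_simps)
  then have "?P (\<lambda>p q. F p q + G p q) (k + k') (\<lambda>u s. s ^ k' * A u s + s ^ k * A' u s)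
      (\<lambda>u s. s ^ k' * B u s + s ^ k * B' u s) (\<lambda>u s. s ^ k' * C u s + s ^ k * C' u s)
      (\<lambda>u s. s ^ k' * D u s + s ^ k * D' u s)"
    using F G by (simp add: bipoly_rules) (simp add: algebra_simps)
  then show ?case by blast
next
  case (mult F G)
  then obtain k A B C D where F: "?P F k A B C D" by blast
  from mult obtain k' A' B' C' D' where G: "?P G k' A' B' C' D'" by blast
  have "(p ^ 4) ^ (k + k') * (F p q * G p q) = ((p ^ 4) ^ k * F p q) * ((p ^ 4) ^ k' * G p q)" for p q
    by (simp add: power_add)
  then have "?P (\<lambda>p q. F p q * G p q) (k + k')
      (\<lambda>u s. A u s * A' u s + s * (B u s * D' u s + C u s * C' u s + D u s * B' u s))
      (\<lambda>u s. A u s * B' u s + B u s * A' u s + s * (C u s * D' u s + D u s * C' u s))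
      (\<lambda>u s. A u s * C' u s + B u s * B' u s + C u s * A' u s + s * (D u s * D' u s))
      (\<lambda>u s. A u s * D' u s + B u s * C' u s + C u s * B' u s + D u s * A' u s)"
    using F G by (simp add: bipoly_rules) (simp add: power_numeral_reduce algebra_simps)
  then show ?case by blast
qed

text \<open>The rotation multiplies the components with \<open>B\<close>, \<open>C\<close> and
  \<open>D\<close> by -i, -1 and i, so averaging an invariant polynomial over the group leaves only
  \<open>A\<close>. Every exponent \<open>j \<ge> k\<close> is allowed so that several polynomials
  can share one.\<close>

lemma rotation_invariant:
  assumes N: "bipoly N" and inv: "\<And>p q. N (- \<i> * p) (\<i> * q) = N p q"
  shows "\<exists>k. \<forall>j\<ge>k. \<exists>H. bipoly H \<and> (\<forall>p q. (p ^ 4) ^ j * N p q = H (p * q) (p ^ 4))"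
proof -
  obtain k A B C D where A: "bipoly A" and *: "\<And>p q. (p ^ 4) ^ k * N p q = A (p * q) (p ^ 4) +
      p * B (p * q) (p ^ 4) + p ^ 2 * C (p * q) (p ^ 4) + p ^ 3 * D (p * q) (p ^ 4)"
    using quartic_decomposition[OF N] by blast
  have "(p ^ 4) ^ k * N p q = A (p * q) (p ^ 4)" for p q
  proof -
    have e: "(- \<i> * p) ^ 4 = p ^ 4" "(- p) ^ 4 = p ^ 4" "(\<i> * p) ^ 4 = p ^ 4"
      by (simp_all add: power4_eq_xxxx algebra_simps)
    have n: "N (- p) (- q) = N p q" "N (\<i> * p) (- \<i> * q) = N p q"
      using inv[of "- \<i> * p" "\<i> * q"] inv[of p q] inv[of "\<i> * p" "- \<i> * q"]
      by (simp_all flip: mult.assoc)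
    have u: "- \<i> * p * (\<i> * q) = p * q" "- p * - q = p * q" "\<i> * p * (- \<i> * q) = p * q"
      by (simp_all add: algebra_simps)
    \<comment> \<open>The sum of the four equations is \<open>4 x = 4 a\<close>, as the fourth roots
      of unity and their powers cancel.\<close>
    have avg: "x = a" if "x = a + b + c + d" "x = a + - \<i> * b + - c + \<i> * d"
      "x = a + - b + c + - d" "x = a + \<i> * b + - c + - \<i> * d" for x a b c d :: complex
      using that i_times_i by algebra
    have pw: "- \<i> * p * b = - \<i> * (p * b)" "(- \<i> * p)\<^sup>2 * b = - (p\<^sup>2 * b)"
      "(- \<i> * p) ^ 3 * b = \<i> * (p ^ 3 * b)" "- p * b = - (p * b)" "(- p)\<^sup>2 * b = p\<^sup>2 * b"
      "(- p) ^ 3 * b = - (p ^ 3 * b)" "\<i> * p * b = \<i> * (p * b)" "(\<i> * p)\<^sup>2 * b = - (p\<^sup>2 * b)"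
      "(\<i> * p) ^ 3 * b = - \<i> * (p ^ 3 * b)" for b
      by (simp_all add: power_mult_distrib power3_eq_cube[of \<i>])
    note E = *[of "- \<i> * p" "\<i> * q", unfolded e u inv n, unfolded pw]
      *[of "- p" "- q", unfolded e u inv n, unfolded pw]
      *[of "\<i> * p" "- \<i> * q", unfolded e u inv n, unfolded pw]
    show ?thesis by (rule avg[OF * E])
  qed
  then have "(p ^ 4) ^ j * N p q = (p ^ 4) ^ (j - k) * A (p * q) (p ^ 4)" if "j \<ge> k" for j p q
    using that by (metis le_add_diff_inverse2 power_add mult.assoc)
  then have "\<exists>H. bipoly H \<and> (\<forall>p q. (p ^ 4) ^ j * N p q = H (p * q) (p ^ 4))" if "j \<ge> k" for j
    using A that by (intro exI[of _ "\<lambda>u s. s ^ (j - k) * A u s"]) (simp add: bipoly_rules)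
  then show ?thesis by blast
qed

text \<open>The polynomials in \<open>u\<close> and \<open>s\<close> are homogenized by
  \<open>x\<close> after inserting the inverse formulas for \<open>u\<close> and \<open>s\<close>.
  The factor \<open>p ^ (4 * k)\<close> comes from the denominators \<open>s\<close>, and 512 is the
  first entry of \<open>to_plane (chart p q)\<close>.\<close>

lemma invariant_descends:
  assumes N: "\<And>i. bipoly (\<lambda>p q. N p q i)" "\<And>p q. N (- \<i> * p) (\<i> * q) = N p q"
    "\<And>p q i. i > n \<Longrightarrow> N p q i = 0"
  shows "\<exists>\<phi> m k. (\<forall>i. form m (\<lambda>v. \<phi> v i)) \<and>
    (\<forall>p q. \<phi> (to_plane (chart p q)) = smul (512 ^ m * p ^ (4 * k)) (N p q))"
proof -
  have "\<forall>i. \<exists>k. \<forall>j\<ge>k. \<exists>H. bipoly H \<and> (\<forall>p q. (p ^ 4) ^ j * N p q i = H (p * q) (p ^ 4))"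
    using rotation_invariant[OF N(1)] N(2) by simp
  then obtain K where K: "\<And>i j. j \<ge> K i \<Longrightarrow>
      \<exists>H. bipoly H \<and> (\<forall>p q. (p ^ 4) ^ j * N p q i = H (p * q) (p ^ 4))" by metis
  define k where "k = Max (K ` {..n})"
  have "k \<ge> K i" if "i \<le> n" for i using that by (simp add: k_def)
  then have "\<exists>H. bipoly H \<and> (\<forall>p q. (p ^ 4) ^ k * N p q i = H (p * q) (p ^ 4)) \<and>
      (i > n \<longrightarrow> (\<forall>p q. H p q = 0))" for i
  proof (cases "i \<le> n")
    case False
    then show ?thesis by (intro exI[of _ "\<lambda>u s. 0"]) (simp add: N(3) bipoly_rules)
  qed (use K[of i k] in auto)
  then obtain H where H: "\<And>i. bipoly (H i)" "\<And>i p q. (p ^ 4) ^ k * N p q i = H i (p * q) (p ^ 4)"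
    "\<And>i p q. i > n \<Longrightarrow> H i p q = 0" by metis
  have c: "form 2 (\<lambda>v. - on3 H4_conic v)"
    unfolding on3_def H4_conic_def form_def
    by (auto intro!: polyfun_rules simp: power2_eq_square algebra_simps)
  obtain m \<phi> where \<phi>: "\<forall>i. form m (\<lambda>w. \<phi> w i)" "\<And>w::vec. w 0 \<noteq> 0 \<Longrightarrow>
      \<phi> w = smul (w 0 ^ m) (\<lambda>i. H i ((w 0 - w 1) / w 0 ^ 1) (- on3 H4_conic w / w 0 ^ 2))"
    using homogenize_tuple[of "\<lambda>p q i. H i p q" n, OF H(1,3) form_coord(1)[of 0]
        form_diff[OF form_coord(1)[of 0] form_coord(1)[of 1]] c] by blast
  have "\<phi> (to_plane (chart p q)) = smul (512 ^ m * p ^ (4 * k)) (N p q)" for p q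
  proof
    fix i
    define u where "u = p * q"
    have "on3 H4_conic (to_plane (chart p q)) = - (512^2 * p ^ 4)"
      unfolding on3_def H4_conic_def to_plane_chart u_def[symmetric]
      by (simp add: power2_eq_square algebra_simps)
    then have "\<phi> (to_plane (chart p q)) i = 512 ^ m * H i (p * q) (p ^ 4)"
      using \<phi>(2)[of "to_plane (chart p q)"]
      by (simp add: to_plane_chart algebra_simps diff_divide_distrib)
    then show "\<phi> (to_plane (chart p q)) i = smul (512 ^ m * p ^ (4 * k)) (N p q) i"
      by (simp add: H(2)[symmetric] power_mult)
  qed
  then show ?thesis using \<phi>(1) by blast
qed

lemma complex_fourth_root: "\<exists>p::complex. p ^ 4 = z"
proof
  have "x ^ 4 = (x ^ 2) ^ 2" for x :: complex by (simp add: power2_eq_square power4_eq_xxxx)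
  from this[of "csqrt (csqrt z)"] show "csqrt (csqrt z) ^ 4 = z" by (simp only: power2_csqrt)
qed

text \<open>A nonvanishing condition on the chart is turned into one on the plane by taking its norm.\<close>

lemma generic_planeI:
  assumes "genp P" and PQ: "\<And>p q c. c \<noteq> 0 \<Longrightarrow> p \<noteq> 0 \<Longrightarrow> P p q \<Longrightarrow>
    smul c (to_plane (chart p q)) \<in> proj 2 \<Longrightarrow> Q (smul c (to_plane (chart p q)))"
  shows "generic (proj 2) Q"
proof -
  obtain b p0 q0 where b: "bipoly b" "b p0 q0 \<noteq> 0" and P: "\<And>p q. b p q \<noteq> 0 \<Longrightarrow> P p q"
    using assms(1) unfolding genp_def by blast
  define N where "N p q = b p q * b (- \<i> * p) (\<i> * q) * b (- p) (- q) * b (\<i> * p) (- \<i> * q)" for p q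
  have b': "bipoly (\<lambda>p q. b (- \<i> * p) (\<i> * q))" "bipoly (\<lambda>p q. b (- p) (- q))"
    "bipoly (\<lambda>p q. b (\<i> * p) (- \<i> * q))"
    by (intro bipoly_bipoly[OF b(1)] bipoly_rules)+
  have N: "bipoly N" unfolding N_def by (intro bipoly_basic(5) b(1) b')
  have inv: "N (- \<i> * p) (\<i> * q) = N p q" for p q
    by (simp add: N_def mult_ac)
  \<comment> \<open>The norm is placed in the first entry of a vector, since descent is formulated
    for tuples.\<close>
  have "bipoly (\<lambda>p q. vec4 (N p q) 0 0 0 i)" for i
    using vec4_cases[of i] N bipoly_basic(1)[of 0] by auto
  moreover have "vec4 (N (- \<i> * p) (\<i> * q)) 0 0 0 = vec4 (N p q) 0 0 0" for p q by (simp only: inv)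
  moreover have "vec4 (N p q) 0 0 0 i = 0" if "i > 3" for p q i using that by simp
  ultimately obtain \<phi> m k where \<phi>: "\<And>i. form m (\<lambda>v. \<phi> v i)"
    "\<And>p q. \<phi> (to_plane (chart p q)) = smul (512 ^ m * p ^ (4 * k)) (vec4 (N p q) 0 0 0)"
    using invariant_descends[of "\<lambda>p q. vec4 (N p q) 0 0 0" 3] by blast
  have \<phi>0: "\<phi> (to_plane (chart p q)) 0 = 512 ^ m * p ^ (4 * k) * N p q" for p q
    by (simp add: \<phi>(2))
  have "genp (\<lambda>p q. N p q \<noteq> 0)"
  proof -
    have "genp (\<lambda>p q. b (- \<i> * p) (\<i> * q) \<noteq> 0)"
      by (rule genp_bipoly[OF b'(1), of "\<i> * p0" "- \<i> * q0"]) (use b(2) in simp)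
    moreover have "genp (\<lambda>p q. b (- p) (- q) \<noteq> 0)"
      by (rule genp_bipoly[OF b'(2), of "- p0" "- q0"]) (use b(2) in simp)
    moreover have "genp (\<lambda>p q. b (\<i> * p) (- \<i> * q) \<noteq> 0)"
      by (rule genp_bipoly[OF b'(3), of "- \<i> * p0" "\<i> * q0"]) (use b(2) in simp)
    ultimately have "genp (\<lambda>p q. b p q \<noteq> 0 \<and> b (- \<i> * p) (\<i> * q) \<noteq> 0 \<and> b (- p) (- q) \<noteq> 0 \<and>
        b (\<i> * p) (- \<i> * q) \<noteq> 0)"
      by (intro genp_conj genp_bipoly[OF b])
    then show ?thesis by (rule genp_mono) (simp add: N_def)
  qed
  then have "genp (\<lambda>p q. N p q \<noteq> 0 \<and> p \<noteq> 0)"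
    by (rule genp_conj[OF _ genp_bipoly[OF bipoly_basic(2), of 1]]) simp
  then obtain p1 q1 where pq1: "N p1 q1 \<noteq> 0" "p1 \<noteq> 0" using genp_ex by blast
  have in_plane: "to_plane (chart p q) \<in> proj 2" for p q
    by (simp add: to_plane_chart smul_vec4 vec4_proj2)
  have c: "form 2 (\<lambda>v. on3 H4_conic v)"
    unfolding on3_def H4_conic_def form_def
    by (auto intro!: polyfun_rules simp: power2_eq_square algebra_simps)
  have "generic (proj 2) (\<lambda>v. v 0 \<noteq> 0 \<and> on3 H4_conic v \<noteq> 0 \<and> \<phi> v 0 \<noteq> 0)"
  proof (intro generic_conj form_domain_plane)
    show "generic (proj 2) (\<lambda>v. v 0 \<noteq> 0)"
      by (rule generic_form[OF form_coord(1), of "vec4 1 0 0 0"]) (simp_all add: vec4_proj2)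
    show "generic (proj 2) (\<lambda>v. on3 H4_conic v \<noteq> 0)"
      by (rule generic_form[OF c, of "vec4 1 0 0 0"]) (simp_all add: vec4_proj2 on3_def H4_conic_def)
    show "generic (proj 2) (\<lambda>v. \<phi> v 0 \<noteq> 0)"
      by (rule generic_form[OF \<phi>(1) in_plane[of p1 q1]]) (use pq1 in \<open>simp add: \<phi>0\<close>)
  qed
  then show ?thesis
  proof (rule generic_mono)
    fix v assume v: "v \<in> proj 2" and nz: "v 0 \<noteq> 0 \<and> on3 H4_conic v \<noteq> 0 \<and> \<phi> v 0 \<noteq> 0"
    \<comment> \<open>Off the line and the conic every point of the plane is reached:
      \<open>p\<close> is a fourth root of the value of \<open>s\<close>, which is nonzero, and then
      \<open>q = u / p\<close>.\<close>
    obtain p where p: "p ^ 4 = - on3 H4_conic v / v 0 ^ 2" using complex_fourth_root by blast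
    have p0: "p \<noteq> 0" using p nz by auto
    define q where "q = (1 - v 1 / v 0) / p"
    have pq: "p * q = 1 - v 1 / v 0" using p0 by (simp add: q_def)
    have "v 2 / v 0 = 2 - 3 * (p * q) + (p ^ 4 + (p * q)^2) / 2"
      unfolding p pq using nz
      by (simp add: on3_def H4_conic_def field_simps power2_eq_square)
    then have e: "v 2 = v 0 * (2 - 3 * (p * q) + (p ^ 4 + (p * q)^2) / 2)"
      using nz by (simp add: field_simps)
    have e1: "v 1 = v 0 * (1 - p * q)" using nz by (simp add: pq)
    have "vec4 (v 0 * 1) (v 0 * (1 - p * q)) (v 0 * (2 - 3 * (p * q) + (p ^ 4 + (p * q)^2) / 2)) (v 0 * 0) = v"
      using v unfolding vec4_eq_iff e[symmetric] e1[symmetric] by (simp add: proj_def)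
    moreover have "smul (v 0 / 512) (to_plane (chart p q)) = smul (v 0)
        (vec4 1 (1 - p * q) (2 - 3 * (p * q) + (p ^ 4 + (p * q)^2) / 2) 0)"
      by (simp only: to_plane_chart smul_simps(1)) simp
    ultimately have vc: "v = smul (v 0 / 512) (to_plane (chart p q))"
      unfolding smul_vec4 by simp
    have "\<phi> v 0 = (v 0 / 512) ^ m * \<phi> (to_plane (chart p q)) 0"
      by (subst vc) (rule form_smul[OF \<phi>(1)])
    then have "N p q \<noteq> 0" using nz by (auto simp: \<phi>0)
    then have "P p q" using P by (auto simp: N_def)
    then show "Q v" using PQ[of "v 0 / 512" p q] p0 nz v unfolding vc[symmetric] by simp
  qed
qed

section \<open>Clearing common linear factors\<close>

text \<open>Factor theorem: the linear polynomial is monic in \<open>p\<close>, so division leaves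
  the remainder \<open>F (- (a * q + b)) q\<close>, which is zero by assumption.\<close>

lemma bipoly_divide_line:
  assumes F: "bipoly F" and "\<And>p q. p + a * q + b = 0 \<Longrightarrow> F p q = 0"
  shows "\<exists>G. bipoly G \<and> (\<forall>p q. F p q = (p + a * q + b) * G p q)"
proof -
  have r: "bipoly (\<lambda>p q. F (- (a * q + b)) q)" if "bipoly F" for F
    by (intro bipoly_bipoly[OF that] bipoly_rules)
  have "\<exists>G. bipoly G \<and> (\<forall>p q. F p q = F (- (a * q + b)) q + (p + a * q + b) * G p q)"
    using F
  proof (induction rule: bipoly_induct)
    case (const c)
    show ?case by (rule exI[of _ "\<lambda>p q. 0"]) (simp add: bipoly_rules)
  next
    case fst
    show ?case by (rule exI[of _ "\<lambda>p q. 1"]) (simp add: bipoly_rules)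
  next
    case snd
    show ?case by (rule exI[of _ "\<lambda>p q. 0"]) (simp add: bipoly_rules)
  next
    case (add F1 F2)
    then obtain G1 G2 where G: "bipoly G1" "\<forall>p q. F1 p q = F1 (- (a * q + b)) q + (p + a * q + b) * G1 p q"
      "bipoly G2" "\<forall>p q. F2 p q = F2 (- (a * q + b)) q + (p + a * q + b) * G2 p q" by blast
    have "F1 p q + F2 p q = F1 (- (a * q + b)) q + F2 (- (a * q + b)) q + (p + a * q + b) * (G1 p q + G2 p q)" for p q
      using G(2)[rule_format, of p q] G(4)[rule_format, of p q] by algebra
    moreover have "bipoly (\<lambda>p q. G1 p q + G2 p q)" using G(1,3) by (rule bipoly_basic)
    ultimately show ?case by blast
  next
    case (mult F1 F2)
    then obtain G1 G2 where G: "bipoly G1" "\<forall>p q. F1 p q = F1 (- (a * q + b)) q + (p + a * q + b) * G1 p q"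
      "bipoly G2" "\<forall>p q. F2 p q = F2 (- (a * q + b)) q + (p + a * q + b) * G2 p q" by blast
    have "F1 p q * F2 p q = F1 (- (a * q + b)) q * F2 (- (a * q + b)) q +
        (p + a * q + b) * (G1 p q * F2 p q + F1 (- (a * q + b)) q * G2 p q)" for p q
      using G(2)[rule_format, of p q] G(4)[rule_format, of p q] by algebra
    moreover have "bipoly (\<lambda>p q. G1 p q * F2 p q + F1 (- (a * q + b)) q * G2 p q)"
      by (intro bipoly_basic G mult r)
    ultimately show ?case by blast
  qed
  moreover have "F (- (a * q + b)) q = 0" for q by (rule assms(2)) simp
  ultimately show ?thesis by auto
qed

text \<open>If the tuple vanishes along one of the lines, the linear factor divides all components
  simultaneously. Each division lowers the degree in \<open>p\<close> of a fixed component
  restricted to a line \<open>q = q0\<close> on which it is not zero, so the process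
  terminates.\<close>

lemma clear_lines:
  assumes "\<And>i. bipoly (\<lambda>p q. R p q i)" "R p0 q0 \<noteq> (0::vec)"
  shows "\<exists>R' D. (\<forall>i. bipoly (\<lambda>p q. R' p q i)) \<and> bipoly D \<and> (\<forall>p q. R p q = smul (D p q) (R' p q)) \<and>
    (\<forall>(a, b)\<in>L. \<exists>p q. p + a * q + b = 0 \<and> R' p q \<noteq> (0::vec))"
proof -
  obtain i0 where i0: "R p0 q0 i0 \<noteq> 0" using assms(2) by (auto simp: fun_eq_iff)
  obtain P where P: "\<forall>t. R t q0 i0 = poly P t"
    using bipoly_on_line[OF assms(1)[of i0], of 0 1 q0 0] by auto
  have P0: "P \<noteq> 0" using i0 P by auto
  show ?thesis
    using assms(1) P P0
  proof (induction "degree P" arbitrary: R P rule: less_induct)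
    case less
    show ?case
    proof (cases "\<forall>(a, b)\<in>L. \<exists>p q. p + a * q + b = 0 \<and> R p q \<noteq> 0")
      case True
      then show ?thesis
        by (intro exI[of _ R] exI[of _ "\<lambda>p q. 1"]) (simp add: less.prems(1) bipoly_rules)
    next
      case False
      then obtain a b where ab: "\<And>p q. p + a * q + b = 0 \<Longrightarrow> R p q = 0" by blast
      have "\<forall>i. \<exists>G. bipoly G \<and> (\<forall>p q. R p q i = (p + a * q + b) * G p q)"
        using bipoly_divide_line[OF less.prems(1)] ab by (metis zero_fun_apply)
      then obtain G where G: "\<And>i. bipoly (G i)" "\<And>i p q. R p q i = (p + a * q + b) * G i p q" by metis
      obtain P' where P': "\<forall>t. G i0 t q0 = poly P' t"
        using bipoly_on_line[OF G(1)[of i0], of 0 1 q0 0] by auto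
      have "poly P t = poly ([:a * q0 + b, 1:] * P') t" for t
        using less.prems(2) P' G(2)[of t q0 i0] by (simp add: algebra_simps)
      then have PP: "P = [:a * q0 + b, 1:] * P'" by (simp add: poly_eq_poly_eq_iff[symmetric] fun_eq_iff)
      then have P'0: "P' \<noteq> 0" using less.prems(3) by auto
      then have "degree P' < degree P" unfolding PP by (subst degree_mult_eq) auto
      from less.hyps[OF this, of "\<lambda>p q i. G i p q"] G(1) P' P'0
      obtain R' D where R': "\<forall>i. bipoly (\<lambda>p q. R' p q i)" "bipoly D"
        "\<forall>p q. (\<lambda>i. G i p q) = smul (D p q) (R' p q)"
        "\<forall>(a, b)\<in>L. \<exists>p q. p + a * q + b = 0 \<and> R' p q \<noteq> 0" by auto
      have "R p q = smul ((p + a * q + b) * D p q) (R' p q)" for p q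
      proof
        fix i
        have "G i p q = D p q * R' p q i" using fun_cong[OF R'(3)[rule_format, of p q], of i] by simp
        then show "R p q i = smul ((p + a * q + b) * D p q) (R' p q) i" by (simp add: G(2))
      qed
      moreover have "bipoly (\<lambda>p q. (p + a * q + b) * D p q)"
        by (intro bipoly_rules R'(2))
      ultimately show ?thesis using R'(1,4) by blast
    qed
  qed
qed

text \<open>Functionals of the form \<open>(1, t, t^2, ...)\<close> are enough: on each vector they
  give a nonzero polynomial in \<open>t\<close>, and finitely many such polynomials have a common
  non-root.\<close>

lemma separating_functional:
  assumes "finite S" "\<And>r. r \<in> S \<Longrightarrow> r \<noteq> (0::vec)" "\<And>r i. r \<in> S \<Longrightarrow> i > n \<Longrightarrow> r i = 0"
  shows "\<exists>l. \<forall>r\<in>S. (\<Sum>i\<le>n. l i * r i) \<noteq> 0"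
proof -
  define P where "P r = (\<Sum>i\<le>n. monom (r i) i)" for r :: vec
  have "P r \<noteq> 0" if r: "r \<in> S" for r
  proof -
    obtain i where i: "r i \<noteq> 0" using assms(2)[OF r] by (auto simp: fun_eq_iff)
    then have "i \<le> n" using assms(3)[OF r] not_le by blast
    then have "coeff (P r) i = r i" by (simp add: P_def coeff_sum)
    then show ?thesis using i by auto
  qed
  then have "(\<Prod>r\<in>S. P r) \<noteq> 0" using assms(1) by simp
  then obtain t where "poly (\<Prod>r\<in>S. P r) t \<noteq> 0" by (meson poly_all_0_iff_0)
  then have "\<forall>r\<in>S. poly (P r) t \<noteq> 0" using assms(1) by (simp add: poly_prod)
  then show ?thesis
    by (intro exI[of _ "\<lambda>i. t ^ i"]) (simp add: P_def poly_sum poly_monom mult.commute)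
qed

text \<open>The four lines of the cycle, as \<open>p + a q + b = 0\<close> in the chart.\<close>

definition cycle_lines :: "(complex \<times> complex) set" where
  "cycle_lines = {(- \<i>, - (1 - \<i>)), (- \<i>, 1 - \<i>), (\<i>, - (1 + \<i>)), (\<i>, 1 + \<i>)}"

text \<open>\<open>R\<close> is rotation invariant only up to a factor, and a linear combination
  \<open>\<Lambda>\<close> of its components changes by the same factor. Hence
  \<open>R / \<Lambda>\<close> is invariant, and so is its product with the norm of
  \<open>\<Lambda>\<close>, which is \<open>R\<close> times the other three conjugates.
  \<open>\<Lambda>\<close> is chosen nonzero at one point of each line of the cycle.\<close>

lemma plane_lift:
  assumes R: "\<And>i. bipoly (\<lambda>p q. R p q i)" "\<And>p q i. i > n \<Longrightarrow> R p q i = (0::complex)"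
    and inv: "\<And>p q. parallel (R (- \<i> * p) (\<i> * q)) (R p q)"
    and lines: "\<forall>(a, b)\<in>cycle_lines. \<exists>p q. p + a * q + b = 0 \<and> R p q \<noteq> 0"
  shows "\<exists>\<phi> m S p0 q0. (\<forall>i. form m (\<lambda>v. \<phi> v i)) \<and> bipoly S \<and>
    (\<forall>p q. \<phi> (to_plane (chart p q)) = smul (S p q) (R p q)) \<and>
    p0 - \<i> * q0 = 1 - \<i> \<and> S p0 q0 \<noteq> 0 \<and> R p0 q0 \<noteq> 0"
proof -
  have "\<exists>p q. p + a * q + b = 0 \<and> R p q \<noteq> 0" if "(a, b) \<in> cycle_lines" for a b
    using lines that by blast
  note * = this[unfolded cycle_lines_def]
  obtain p0 q0 p1 q1 p2 q2 p3 q3 where pt: "p0 + - \<i> * q0 + - (1 - \<i>) = 0" "R p0 q0 \<noteq> 0"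
    "p1 + \<i> * q1 + (1 + \<i>) = 0" "R p1 q1 \<noteq> 0" "p2 + - \<i> * q2 + (1 - \<i>) = 0" "R p2 q2 \<noteq> 0"
    "p3 + \<i> * q3 + - (1 + \<i>) = 0" "R p3 q3 \<noteq> 0"
    using *[of "- \<i>" "- (1 - \<i>)"] *[of "\<i>" "1 + \<i>"] *[of "- \<i>" "1 - \<i>"] *[of "\<i>" "- (1 + \<i>)"] by blast
  have "\<exists>l. \<forall>r\<in>{R p0 q0, R p1 q1, R p2 q2, R p3 q3}. (\<Sum>i\<le>n. l i * r i) \<noteq> 0"
    by (rule separating_functional) (use pt R(2) in auto)
  then obtain l where l: "\<forall>r\<in>{R p0 q0, R p1 q1, R p2 q2, R p3 q3}. (\<Sum>i\<le>n. l i * r i) \<noteq> 0" by blast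
  define \<Lambda> where "\<Lambda> p q = (\<Sum>i\<le>n. l i * R p q i)" for p q
  have \<Lambda>: "bipoly \<Lambda>" unfolding \<Lambda>_def by (intro bipoly_rules R(1))
  have \<Lambda>': "bipoly (\<lambda>p q. \<Lambda> (- \<i> * p) (\<i> * q))" "bipoly (\<lambda>p q. \<Lambda> (- p) (- q))"
    "bipoly (\<lambda>p q. \<Lambda> (\<i> * p) (- \<i> * q))"
    by (intro bipoly_bipoly[OF \<Lambda>] bipoly_rules)+
  define M where "M p q = \<Lambda> (- \<i> * p) (\<i> * q) * \<Lambda> (- p) (- q) * \<Lambda> (\<i> * p) (- \<i> * q)" for p q
  have M: "bipoly M" unfolding M_def by (intro bipoly_basic(5) \<Lambda>')
  have cross: "R (- \<i> * p) (\<i> * q) i * \<Lambda> p q = \<Lambda> (- \<i> * p) (\<i> * q) * R p q i" for p q i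
  proof -
    have e: "R (- \<i> * p) (\<i> * q) i * R p q j = R (- \<i> * p) (\<i> * q) j * R p q i" for j
      using inv[of p q] unfolding parallel_def by blast
    have "R (- \<i> * p) (\<i> * q) i * \<Lambda> p q = (\<Sum>j\<le>n. l j * (R (- \<i> * p) (\<i> * q) i * R p q j))"
      by (simp add: \<Lambda>_def sum_distrib_left mult_ac)
    also have "\<dots> = \<Lambda> (- \<i> * p) (\<i> * q) * R p q i"
      unfolding e by (simp add: \<Lambda>_def sum_distrib_left sum_distrib_right mult_ac)
    finally show ?thesis .
  qed
  define N where "N p q = smul (M p q) (R p q)" for p q
  have "N (- \<i> * p) (\<i> * q) = N p q" for p q
  proof
    fix i
    have "M (- \<i> * p) (\<i> * q) = \<Lambda> (- p) (- q) * \<Lambda> (\<i> * p) (- \<i> * q) * \<Lambda> p q"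
      by (simp add: M_def)
    then have "N (- \<i> * p) (\<i> * q) i = \<Lambda> (- p) (- q) * \<Lambda> (\<i> * p) (- \<i> * q) * (R (- \<i> * p) (\<i> * q) i * \<Lambda> p q)"
      by (simp add: N_def)
    then show "N (- \<i> * p) (\<i> * q) i = N p q i"
      unfolding cross by (simp add: N_def M_def)
  qed
  moreover have "bipoly (\<lambda>p q. N p q i)" for i
    unfolding N_def smul_apply by (intro bipoly_basic(5) M R(1))
  moreover have "N p q i = 0" if "i > n" for p q i
    using R(2) that by (simp add: N_def)
  ultimately obtain \<phi> m k where \<phi>: "\<forall>i. form m (\<lambda>v. \<phi> v i)"
    "\<And>p q. \<phi> (to_plane (chart p q)) = smul (512 ^ m * p ^ (4 * k)) (N p q)"
    using invariant_descends[of N n] by blast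
  define S where "S p q = 512 ^ m * p ^ (4 * k) * M p q" for p q
  have S: "bipoly S" unfolding S_def by (intro bipoly_basic M)
  have "\<phi> (to_plane (chart p q)) = smul (S p q) (R p q)" for p q
    by (simp add: \<phi>(2) N_def S_def)
  moreover
  \<comment> \<open>\<open>(f t, t)\<close> runs through the line \<open>p - i q = 1 - i\<close>.
    The rotation permutes the lines of the cycle, so the conjugates of \<open>\<Lambda>\<close> here
    are its values on the other three lines, and the four chosen points show that none vanishes
    identically.\<close>
  define f where "f t = 1 - \<i> + \<i> * t" for t :: complex
  have f: "bipoly (\<lambda>t x. f t)" unfolding f_def by (intro bipoly_rules)
  have fb: "bipoly (\<lambda>t x. F (f t) t)" if "bipoly F" for F
    by (intro bipoly_bipoly[OF that] f bipoly_rules)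
  have "genp (\<lambda>t x. f t \<noteq> 0 \<and> \<Lambda> (f t) t \<noteq> 0 \<and> \<Lambda> (- \<i> * f t) (\<i> * t) \<noteq> 0 \<and> \<Lambda> (- f t) (- t) \<noteq> 0 \<and>
      \<Lambda> (\<i> * f t) (- \<i> * t) \<noteq> 0)"
  proof (intro genp_conj)
    show "genp (\<lambda>t x. f t \<noteq> 0)" by (rule genp_bipoly[OF f, of 1]) (simp add: f_def)
    have e0: "f q0 = p0" using pt(1) unfolding f_def by algebra
    show "genp (\<lambda>t x. \<Lambda> (f t) t \<noteq> 0)"
      by (rule genp_bipoly[OF fb[OF \<Lambda>], of q0]) (use l in \<open>simp add: e0 \<Lambda>_def\<close>)
    have e1: "- \<i> * f (- \<i> * q1) = p1" "\<i> * (- \<i> * q1) = q1" using pt(3) i_times_i unfolding f_def by algebra+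
    show "genp (\<lambda>t x. \<Lambda> (- \<i> * f t) (\<i> * t) \<noteq> 0)"
    proof (rule genp_bipoly[OF fb[OF \<Lambda>'(1)], of "- \<i> * q1"])
      show "\<Lambda> (- \<i> * f (- \<i> * q1)) (\<i> * (- \<i> * q1)) \<noteq> 0" unfolding e1 using l by (simp add: \<Lambda>_def)
    qed
    have e2: "- f (- q2) = p2" using pt(5) unfolding f_def by algebra
    show "genp (\<lambda>t x. \<Lambda> (- f t) (- t) \<noteq> 0)"
    proof (rule genp_bipoly[OF fb[OF \<Lambda>'(2)], of "- q2"])
      show "\<Lambda> (- f (- q2)) (- (- q2)) \<noteq> 0" unfolding e2 minus_minus using l by (simp add: \<Lambda>_def)
    qed
    have e3: "\<i> * f (\<i> * q3) = p3" "- \<i> * (\<i> * q3) = q3" using pt(7) i_times_i unfolding f_def by algebra+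
    show "genp (\<lambda>t x. \<Lambda> (\<i> * f t) (- \<i> * t) \<noteq> 0)"
    proof (rule genp_bipoly[OF fb[OF \<Lambda>'(3)], of "\<i> * q3"])
      show "\<Lambda> (\<i> * f (\<i> * q3)) (- \<i> * (\<i> * q3)) \<noteq> 0" unfolding e3 using l by (simp add: \<Lambda>_def)
    qed
  qed
  then obtain t where t: "f t \<noteq> 0" "\<Lambda> (f t) t \<noteq> 0" "\<Lambda> (- \<i> * f t) (\<i> * t) \<noteq> 0" "\<Lambda> (- f t) (- t) \<noteq> 0"
    "\<Lambda> (\<i> * f t) (- \<i> * t) \<noteq> 0" using genp_ex by blast
  have "S (f t) t \<noteq> 0" using t by (simp add: S_def M_def)
  moreover have "R (f t) t \<noteq> 0" using t(2) by (auto simp: \<Lambda>_def)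
  moreover have "f t - \<i> * t = 1 - \<i>" by (simp add: f_def)
  ultimately show ?thesis using \<phi>(1) S by blast
qed

section \<open>Tangent spaces and foliations\<close>

lemma tangent_smul:
  assumes "c \<noteq> 0"
  shows "tangent X (smul c u) = tangent X u"
proof -
  have "dird 1 f (smul c u) w = 0 \<longleftrightarrow> dird 1 f u w = 0" if "form d f" for d f w
    using dird_form_smul[OF that assms, of u w] assms by simp
  then show ?thesis unfolding tangent_def by blast
qed

lemma tangent_shift:
  assumes "u \<in> X" "b \<noteq> 0"
  shows "smul a u + smul b y \<in> tangent X u \<longleftrightarrow> y \<in> tangent X u"
proof -
  have "dird 1 f u (smul a u + smul b y) = b * dird 1 f u y" if "form d f" "\<forall>u\<in>X. f u = 0" for d f
    using dird_linear[OF form_polyfun[OF that(1)], of u a u b y] dird_form_radial[OF that(1), of u]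
      that(2) assms(1) by simp
  then show ?thesis unfolding tangent_def using assms(2) by auto
qed

lemma tangent_support:
  assumes "X \<subseteq> proj n" "w \<in> tangent X u" "i > n"
  shows "w i = 0"
proof -
  have "\<forall>v\<in>X. v i = 0" using assms(1,3) by (auto simp: proj_def)
  then have "dird 1 (\<lambda>v. v i) u w = 0" using assms(2) form_coord(1)[of i] unfolding tangent_def by blast
  then show ?thesis unfolding dird_coord .
qed

lemma pairing_sum:
  assumes "\<And>i. i > n \<Longrightarrow> w i = 0"
  shows "pairing a w = (\<Sum>i\<le>n. a i * w i)"
  unfolding pairing_def
proof (rule sum.mono_neutral_left)
  show "{i. w i \<noteq> 0} \<subseteq> {..n}" using assms not_le by auto
qed auto

text \<open>A direction at a projective point determines a vector of the cone only up to rescaling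
  and radial vectors. The radial part is annihilated by both the tangent conditions and the local
  form, and homogeneity of the form absorbs the change of representative.\<close>

lemma foliation_shift:
  assumes F: "foliation_on X F" and X: "X \<subseteq> proj n" "u \<in> X" "smul c u \<in> X" and c: "c \<noteq> 0" and b: "b \<noteq> 0"
  shows "smul a u + smul b y \<in> F (smul c u) \<longleftrightarrow> y \<in> F u"
proof -
  obtain g e \<omega> d where g: "form e g" "g u \<noteq> 0" and \<omega>: "\<And>i. form d (\<lambda>v. \<omega> v i)"
    and Fu: "\<And>v. v \<in> X \<Longrightarrow> g v \<noteq> 0 \<Longrightarrow> pairing (\<omega> v) v = 0 \<and> F v = {w \<in> tangent X v. pairing (\<omega> v) w = 0}"
  proof -
    have "\<exists>g e \<omega> d. form e g \<and> g u \<noteq> 0 \<and> (\<forall>i. form d (\<lambda>u. \<omega> u i)) \<and>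
        (\<forall>u\<in>X. g u \<noteq> 0 \<longrightarrow> pairing (\<omega> u) u = 0 \<and> F u = {w \<in> tangent X u. pairing (\<omega> u) w = 0})"
      by (rule bspec[OF conjunct1[OF F[unfolded foliation_on_def]] X(2)])
    then obtain g e \<omega> d where *: "form e g" "g u \<noteq> 0" "\<forall>i. form d (\<lambda>u. \<omega> u i)"
      "\<forall>u\<in>X. g u \<noteq> 0 \<longrightarrow> pairing (\<omega> u) u = 0 \<and> F u = {w \<in> tangent X u. pairing (\<omega> u) w = 0}"
      by (elim exE conjE) rule
    show ?thesis by (rule that[of e g d \<omega>]) (use * in simp_all)
  qed
  have gc: "g (smul c u) \<noteq> 0" using g c by (simp add: form_smul)
  have uu: "pairing (\<omega> u) u = 0" and 1: "F u = {w \<in> tangent X u. pairing (\<omega> u) w = 0}"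
    using Fu[OF X(2) g(2)] by auto
  have 2: "F (smul c u) = {w \<in> tangent X u. pairing (smul (c ^ d) (\<omega> u)) w = 0}"
    using Fu[OF X(3) gc] by (simp add: tangent_smul[OF c] tuple_smul[of d \<omega>, OF \<omega>])
  have un: "\<And>i. i > n \<Longrightarrow> u i = 0" using X by (auto simp: proj_def)
  have "pairing (smul (c ^ d) (\<omega> u)) (smul a u + smul b y) = 0 \<longleftrightarrow> pairing (\<omega> u) y = 0"
    if "y \<in> tangent X u"
  proof -
    have yn: "\<And>i. i > n \<Longrightarrow> y i = 0" using tangent_support[OF X(1) that] .
    then have "\<And>i. i > n \<Longrightarrow> (smul a u + smul b y) i = 0" using un by simp
    then have "pairing (smul (c ^ d) (\<omega> u)) (smul a u + smul b y) =
        c ^ d * (a * (\<Sum>i\<le>n. \<omega> u i * u i) + b * (\<Sum>i\<le>n. \<omega> u i * y i))"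
      by (subst pairing_sum[where n = n])
        (simp_all add: algebra_simps sum.distrib sum_distrib_left)
    also have "(\<Sum>i\<le>n. \<omega> u i * u i) = 0" using uu pairing_sum[OF un] by simp
    also have "(\<Sum>i\<le>n. \<omega> u i * y i) = pairing (\<omega> u) y" using pairing_sum[OF yn] by simp
    finally have e: "pairing (smul (c ^ d) (\<omega> u)) (smul a u + smul b y) = c ^ d * (b * pairing (\<omega> u) y)"
      by (simp only: mult_zero_right add_0_left)
    show ?thesis unfolding e using b c by simp
  qed
  then show ?thesis
    unfolding 1 2 using tangent_shift[OF X(2) b, of a y] by blast
qed

section \<open>Comparing the quotient surface with the plane\<close>

lemma rat_mapE:
  assumes "rat_map X Y \<phi>"
  obtains d where "\<And>i. form d (\<lambda>v. \<phi> v i)"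
  using assms unfolding rat_map_def by blast

text \<open>The equations of \<open>Y\<close> composed with \<open>\<phi>\<close> are forms on
  \<open>X\<close>, so it is enough that they vanish on an open set.\<close>

lemma rat_map_generic:
  assumes X: "form_domain X" and Y: "proj_closed Y" and \<phi>: "\<And>i. form m (\<lambda>v. \<phi> v i)"
    and nz: "v0 \<in> X" "\<phi> v0 \<noteq> 0" and gen: "generic X (\<lambda>v. \<exists>a y. y \<in> Y \<and> \<phi> v = smul a y)"
  shows "rat_map X Y \<phi>"
  unfolding rat_map_def
proof (intro conjI ballI impI)
  show "\<exists>d. \<forall>i. form d (\<lambda>v. \<phi> v i)" using \<phi> by blast
  show "\<exists>v\<in>X. \<phi> v \<noteq> 0" using nz by blast
  fix v assume v: "v \<in> X" "\<phi> v \<noteq> 0"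
  obtain C k where C: "\<And>f. f \<in> C \<Longrightarrow> \<exists>d. form d f" "\<And>v. v \<in> Y \<longleftrightarrow> v \<noteq> 0 \<and> (\<forall>f\<in>C. f v = 0)"
    using proj_closed_forms[OF Y] by metis
  have "f (\<phi> v) = 0" if f: "f \<in> C" for f
  proof -
    obtain d where d: "form d f" using C(1)[OF f] by blast
    have "generic X (\<lambda>v. f (\<phi> v) = 0)"
      using gen by (rule generic_mono) (use C(2) f in \<open>auto simp: form_smul[OF d]\<close>)
    then show ?thesis by (rule generic_vanish[OF X _ form_compose[OF d \<phi>] v(1)])
  qed
  then show "\<phi> v \<in> Y" using C(2) v(2) by blast
qed

lemma form_domainD:
  "form_domain X \<Longrightarrow> form d f \<Longrightarrow> form e g \<Longrightarrow> \<forall>v\<in>X. f v * g v = 0 \<Longrightarrow>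
    (\<forall>v\<in>X. f v = 0) \<or> (\<forall>v\<in>X. g v = 0)"
  unfolding form_domain_def by blast

lemma rgraphI:
  "v \<in> X \<Longrightarrow> rat_map X Y \<psi> \<Longrightarrow> same_map X \<phi> \<psi> \<Longrightarrow> \<psi> v \<noteq> 0 \<Longrightarrow> (v, \<psi> v) \<in> rgraph X Y \<phi>"
  unfolding rgraph_def mem_Collect_eq prod.case
  by (rule conjI, assumption, rule exI[of _ \<psi>], rule exI[of _ 1]) simp

lemma T4_order: "w \<in> P1P1 \<Longrightarrow> T4 (T4 (T4 (T4 w))) = w"
  using P1P1_eta[of w] by (simp add: T4_vec4)

lemma form_T4: "form d f \<Longrightarrow> form d (\<lambda>w. f (T4 w))"
  using form_compose[of d f 1 T4] by (simp add: T4_vec4 form_vec4 form_coord)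

lemma generic_T4:
  assumes "generic P1P1 P"
  shows "generic P1P1 (\<lambda>u. P (T4 u))"
proof -
  obtain e N w where N: "form e N" "w \<in> P1P1" "N w \<noteq> 0" "\<forall>v\<in>P1P1. N v \<noteq> 0 \<longrightarrow> P v"
    using assms unfolding generic_def by blast
  have "N (T4 (T4 (T4 (T4 w)))) \<noteq> 0" using N(2,3) by (simp add: T4_order)
  from generic_form[OF form_T4[OF N(1)] _ this] N(2) have "generic P1P1 (\<lambda>u. N (T4 u) \<noteq> 0)"
    by (simp add: T4_P1P1)
  then show ?thesis by (rule generic_mono) (use N(4) T4_P1P1 in blast)
qed

text \<open>The part of \<open>santos_F4\<close> that concerns maps, with \<open>\<sigma>\<close> a
  rational inverse of the desingularization \<open>\<pi>\<close> and with all degrees fixed.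
  Irreducibility enters through integral coordinate rings.\<close>

locale santos_model =
  fixes M Q :: "vec set" and q \<pi> \<sigma> \<rho> :: "vec \<Rightarrow> vec" and dq dp ds dr n :: nat
  assumes M: "form_domain M" "M \<subseteq> proj n" "proj_closed M"
    and Q: "form_domain Q"
    and forms: "\<And>i. form dq (\<lambda>v. q v i)" "\<And>i. form dp (\<lambda>v. \<pi> v i)"
      "\<And>i. form ds (\<lambda>v. \<sigma> v i)" "\<And>i. form dr (\<lambda>v. \<rho> v i)"
    and rats: "rat_map P1P1 Q q" "rat_map M Q \<pi>" "rat_map Q M \<sigma>" "rat_map P1P1 M \<rho>"
    and q_T4: "same_map P1P1 (q \<circ> T4) q"
    and q_onto: "Q \<subseteq> Range (rgraph P1P1 Q q)"
    and q_univ: "\<And>Y f. proj_variety Y \<Longrightarrow> morphism P1P1 Y f \<Longrightarrow> same_map P1P1 (f \<circ> T4) f \<Longrightarrow>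
      \<exists>g. morphism Q Y g \<and> same_map P1P1 (g \<circ> q) f"
    and \<sigma>\<pi>: "same_map M (\<sigma> \<circ> \<pi>) id"
    and \<pi>\<rho>: "same_map P1P1 (\<pi> \<circ> \<rho>) q"
begin

lemmas smuls = tuple_smul[of dq q, OF forms(1)] tuple_smul[of dp \<pi>, OF forms(2)]
  tuple_smul[of ds \<sigma>, OF forms(3)] tuple_smul[of dr \<rho>, OF forms(4)]

lemma rho_M: "u \<in> P1P1 \<Longrightarrow> \<rho> u \<noteq> 0 \<Longrightarrow> \<rho> u \<in> M"
  using rats(4) unfolding rat_map_def by blast

lemma generic_q: "generic P1P1 (\<lambda>u. q u \<noteq> 0)"
  using rats(1) generic_tuple[of dq q, OF forms(1)] unfolding rat_map_def by blast

lemma generic_rho: "generic P1P1 (\<lambda>u. \<rho> u \<noteq> 0)"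
  using rats(4) generic_tuple[of dr \<rho>, OF forms(4)] unfolding rat_map_def by blast

lemma generic_pi_rho: "generic P1P1 (\<lambda>u. \<pi> (\<rho> u) \<noteq> 0)"
proof -
  obtain u where "u \<in> P1P1" "\<pi> (\<rho> u) \<noteq> 0" using \<pi>\<rho> unfolding same_map_def by auto
  then show ?thesis
    by (rule generic_tuple[of "dr * dp" "\<lambda>u. \<pi> (\<rho> u)", rotated]) (rule form_compose[OF forms(2,4)])
qed

lemma q_pi_rho:
  assumes "u \<in> P1P1" "q u \<noteq> 0" "\<pi> (\<rho> u) \<noteq> 0"
  obtains c where "c \<noteq> 0" "q u = smul c (\<pi> (\<rho> u))"
proof -
  have "parallel (\<pi> (\<rho> u)) (q u)" using \<pi>\<rho> assms(1) unfolding same_map_parallel by simp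
  then show thesis by (rule parallelE2[OF _ assms(3,2)]) (rule that)
qed

lemma onto_Q:
  assumes "x \<in> Q"
  obtains u c \<psi> where "u \<in> P1P1" "c \<noteq> 0" "x = smul c (\<psi> u)" "\<psi> u \<noteq> 0" "rat_map P1P1 Q \<psi>"
    "\<And>v. v \<in> P1P1 \<Longrightarrow> parallel (q v) (\<psi> v)"
  using q_onto assms unfolding rgraph_def same_map_parallel by blast

text \<open>A priori the image of \<open>q\<close> might lie where \<open>\<sigma>\<close> vanishes.
  Surjectivity excludes this: a point with \<open>\<sigma> x \<noteq> 0\<close> is the value of some
  representative of \<open>q\<close>, and representatives agree up to scalars on an open
  set.\<close>

lemma generic_sigma_q: "generic P1P1 (\<lambda>u. \<sigma> (q u) \<noteq> 0)"
proof -
  obtain x where x: "x \<in> Q" "\<sigma> x \<noteq> 0" using rats(3) unfolding rat_map_def by blast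
  obtain u c \<psi> where u: "u \<in> P1P1" "c \<noteq> 0" "x = smul c (\<psi> u)" "\<psi> u \<noteq> 0" "rat_map P1P1 Q \<psi>"
    "\<And>v. v \<in> P1P1 \<Longrightarrow> parallel (q v) (\<psi> v)" using onto_Q[OF x(1)] by blast
  obtain d where d: "\<And>i. form d (\<lambda>v. \<psi> v i)" using rat_mapE[OF u(5)] by blast
  have "\<sigma> (\<psi> u) \<noteq> 0" using x(2) unfolding u(3) smuls by simp
  then have "generic P1P1 (\<lambda>u. \<sigma> (\<psi> u) \<noteq> 0)"
    by (rule generic_tuple[of "d * ds" "\<lambda>u. \<sigma> (\<psi> u)", rotated, OF u(1)]) (rule form_compose[OF forms(3) d])
  then have "generic P1P1 (\<lambda>u. (\<sigma> (\<psi> u) \<noteq> 0 \<and> \<psi> u \<noteq> 0) \<and> q u \<noteq> 0)"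
    by (intro generic_conj form_domain_P1P1 generic_q generic_tuple[of d \<psi>, OF d u(1,4)])
  then show ?thesis
  proof (rule generic_mono)
    fix v assume v: "v \<in> P1P1" "(\<sigma> (\<psi> v) \<noteq> 0 \<and> \<psi> v \<noteq> 0) \<and> q v \<noteq> 0"
    then obtain c where "\<psi> v = smul c (q v)" using u(6) by (meson parallelE)
    then show "\<sigma> (q v) \<noteq> 0" using v(2) by (auto simp: smuls)
  qed
qed

definition good :: "vec \<Rightarrow> bool" where
  "good u \<longleftrightarrow> q u \<noteq> 0 \<and> \<rho> u \<noteq> 0 \<and> \<pi> (\<rho> u) \<noteq> 0 \<and> \<sigma> (q u) \<noteq> 0"

lemma sigma_q_rho:
  assumes u: "u \<in> P1P1" "good u"
  obtains c where "c \<noteq> 0" "\<sigma> (q u) = smul c (\<rho> u)"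
proof -
  note assms = u(1) u(2)[unfolded good_def]
  obtain c where c: "c \<noteq> 0" "q u = smul c (\<pi> (\<rho> u))" using q_pi_rho assms by blast
  have "parallel (\<sigma> (\<pi> (\<rho> u))) (\<rho> u)"
    using \<sigma>\<pi> rho_M assms unfolding same_map_parallel by simp
  from parallel_smul[OF this, of "c ^ ds" 1] have "parallel (\<sigma> (q u)) (\<rho> u)"
    by (simp add: c(2) smuls)
  from parallel_sym[OF this] show thesis by (rule parallelE2) (use assms that in auto)
qed

lemma generic_good: "generic P1P1 good"
  unfolding good_def[abs_def] by (intro generic_conj form_domain_P1P1 generic_q generic_rho generic_pi_rho generic_sigma_q)

text \<open>As a rational map \<open>\<rho>\<close> equals \<open>\<sigma> \<circ> q\<close>,
  because \<open>\<sigma>\<close> inverts \<open>\<pi>\<close>; it therefore inherits the invariance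
  of \<open>q\<close>.\<close>

lemma rho_T4:
  assumes "u \<in> P1P1"
  shows "parallel (\<rho> (T4 u)) (\<rho> u)"
proof (rule generic_parallel[OF form_domain_P1P1 _ _ forms(4) assms])
  show "form dr (\<lambda>u. \<rho> (T4 u) i)" for i using form_T4[OF forms(4)] .
  show "generic P1P1 (\<lambda>u. parallel (\<rho> (T4 u)) (\<rho> u))"
    using generic_conj[OF form_domain_P1P1 generic_good generic_T4[OF generic_good]]
  proof (rule generic_mono)
    fix u assume u: "u \<in> P1P1" and *: "good u \<and> good (T4 u)"
    obtain a where a: "a \<noteq> 0" "\<sigma> (q u) = smul a (\<rho> u)" using sigma_q_rho u * by blast
    obtain b where b: "b \<noteq> 0" "\<sigma> (q (T4 u)) = smul b (\<rho> (T4 u))"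
      using sigma_q_rho[OF T4_P1P1[OF u]] * by blast
    have "parallel (q (T4 u)) (q u)" using q_T4 u unfolding same_map_parallel by simp
    then obtain c where c: "c \<noteq> 0" "q u = smul c (q (T4 u))" using * unfolding good_def by (meson parallelE2)
    have "smul a (\<rho> u) = smul (c ^ ds) (\<sigma> (q (T4 u)))" using a(2) c(2) by (metis smuls(3))
    also have "\<dots> = smul (c ^ ds * b) (\<rho> (T4 u))" by (simp add: b(2))
    finally have "smul (1 / a) (smul a (\<rho> u)) = smul (1 / a) (smul (c ^ ds * b) (\<rho> (T4 u)))" by simp
    then have "\<rho> u = smul (c ^ ds * b / a) (\<rho> (T4 u))" using a(1) by simp
    then show "parallel (\<rho> (T4 u)) (\<rho> u)" using parallel_refl[of 1] by (metis smul_simps(2))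
  qed
qed

text \<open>A form vanishing on the image of \<open>\<rho>\<close> vanishes on the image of
  \<open>\<sigma>\<close>, because \<open>q\<close> is onto, and almost every point of
  \<open>M\<close> is of the form \<open>\<sigma> (\<pi> m)\<close> up to a scalar. Identities on
  \<open>M\<close> can thus be checked on the quadric.\<close>

lemma rho_dominant:
  assumes h: "form d h" and z: "\<And>u. u \<in> P1P1 \<Longrightarrow> h (\<rho> u) = 0" and m: "m \<in> M"
  shows "h m = 0"
proof -
  have hQ: "h (\<sigma> x) = 0" if "x \<in> Q" for x
  proof -
    obtain u c \<psi> where u: "u \<in> P1P1" "c \<noteq> 0" "x = smul c (\<psi> u)" "\<psi> u \<noteq> 0" "rat_map P1P1 Q \<psi>"
      "\<And>v. v \<in> P1P1 \<Longrightarrow> parallel (q v) (\<psi> v)" using onto_Q[OF \<open>x \<in> Q\<close>] by blast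
    obtain d' where d': "\<And>i. form d' (\<lambda>v. \<psi> v i)" using rat_mapE[OF u(5)] by blast
    have "h (\<sigma> (\<psi> u)) = 0"
    proof (rule generic_vanish[OF form_domain_P1P1 _ form_compose[OF h form_compose[OF forms(3) d']] u(1)])
      show "generic P1P1 (\<lambda>u. h (\<sigma> (\<psi> u)) = 0)"
        using generic_good
      proof (rule generic_mono)
        fix v assume v: "v \<in> P1P1" and *: "good v"
        then obtain a where a: "\<sigma> (q v) = smul a (\<rho> v)" using sigma_q_rho by blast
        obtain c where "\<psi> v = smul c (q v)" using u(6)[OF v] * unfolding good_def by (meson parallelE)
        then have "\<sigma> (\<psi> v) = smul (c ^ ds * a) (\<rho> v)" by (simp add: smuls a)
        then show "h (\<sigma> (\<psi> v)) = 0" by (simp add: form_smul[OF h] z[OF v])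
      qed
    qed
    then show ?thesis by (simp add: u(3) smuls form_smul[OF h])
  qed
  obtain m0 where "m0 \<in> M" "\<sigma> (\<pi> m0) \<noteq> 0" using \<sigma>\<pi> unfolding same_map_def by auto
  then have "generic M (\<lambda>m. \<sigma> (\<pi> m) \<noteq> 0)"
    by (rule generic_tuple[of "dp * ds" "\<lambda>m. \<sigma> (\<pi> m)", rotated]) (rule form_compose[OF forms(3,2)])
  moreover have "generic M (\<lambda>m. \<pi> m \<noteq> 0)"
    using rats(2) generic_tuple[of dp \<pi>, OF forms(2)] unfolding rat_map_def by blast
  ultimately have "generic M (\<lambda>m. \<sigma> (\<pi> m) \<noteq> 0 \<and> \<pi> m \<noteq> 0)" by (rule generic_conj[OF M(1)])
  then have "generic M (\<lambda>m. h m = 0)"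
  proof (rule generic_mono)
    fix m assume m: "m \<in> M" "\<sigma> (\<pi> m) \<noteq> 0 \<and> \<pi> m \<noteq> 0"
    have "\<pi> m \<in> Q" using rats(2) m unfolding rat_map_def by blast
    then have *: "h (\<sigma> (\<pi> m)) = 0" by (rule hQ)
    have "parallel (\<sigma> (\<pi> m)) m" using \<sigma>\<pi> m(1) unfolding same_map_parallel by simp
    then obtain c where "m = smul c (\<sigma> (\<pi> m))" using m(2) by (meson parallelE)
    then show "h m = 0" using * form_smul[OF h] by (metis mult_zero_right)
  qed
  then show ?thesis by (rule generic_vanish[OF M(1) _ h m])
qed

end

section \<open>A projective model of the quotient and the inverse map to the plane\<close>

text \<open>A base point free system of invariants containing a multiple of the map to the plane;
  its image is a model of the quotient to which the universal property applies.\<close>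

definition cover_map :: "vec \<Rightarrow> vec" where
  "cover_map w = (\<lambda>i. if i < 3 then evm w * to_plane w i else if i = 3 then ev1 w ^ 4
     else if i = 4 then evi w ^ 4 else if i = 5 then evmi w ^ 4 else 0)"

definition cover_image :: "vec set" where
  "cover_image = {v \<in> proj 5. \<forall>d f. form d f \<longrightarrow> (\<forall>w\<in>P1P1. f (cover_map w) = 0) \<longrightarrow> f v = 0}"

lemma form_cover_map: "form 4 (\<lambda>w. cover_map w i)"
proof -
  have "form (1 + 3) (\<lambda>w. evm w * to_plane w i)" by (rule form_mult[OF form_ev(2) form_to_plane])
  moreover have "form (1 * 4) (\<lambda>w. ev1 w ^ 4)" "form (1 * 4) (\<lambda>w. evi w ^ 4)" "form (1 * 4) (\<lambda>w. evmi w ^ 4)"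
    by (intro form_power form_ev)+
  ultimately have *: "form 4 (\<lambda>w. evm w * to_plane w i)" "form 4 (\<lambda>w. ev1 w ^ 4)"
    "form 4 (\<lambda>w. evi w ^ 4)" "form 4 (\<lambda>w. evmi w ^ 4)" by simp_all
  consider "i < 3" | "i = 3" | "i = 4" | "i = 5" | "i > 5" by arith
  then show ?thesis by cases (simp_all add: cover_map_def form_0 *)
qed

lemma cover_map_T4: "cover_map (T4 w) = cover_map w"
proof -
  have "(\<i> * x) ^ 4 = x ^ 4" "(- (\<i> * x)) ^ 4 = x ^ 4" for x
    using i_times_i by algebra+
  then show ?thesis by (auto simp: cover_map_def ev_T4 to_plane_T4 fun_eq_iff)
qed

text \<open>Component 0 is \<open>evm ^ 4\<close>; together with the other three fourth powers it
  vanishes only where all eigencoordinates do, that is, at the zero vector.\<close>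

lemma cover_map_nonzero:
  assumes w: "w \<in> P1P1"
  shows "cover_map w \<noteq> 0"
proof
  assume "cover_map w = 0"
  then have *: "cover_map w i = 0" for i by simp
  have "evm w = 0" "ev1 w = 0" "evi w = 0" "evmi w = 0"
    using *[of 0] *[of 3] *[of 4] *[of 5] by (simp_all add: cover_map_def to_plane_def)
  then have "4 * w 0 = 0" "4 * w 1 = 0" "4 * w 2 = 0" "4 * w 3 = 0"
    unfolding ev1_def evm_def evi_def evmi_def using i_times_i by algebra+
  then have "vec4 (w 0) (w 1) (w 2) (w 3) = 0" by simp
  then show False using P1P1_eta[OF w] w by (auto simp: P1P1_quadric proj_def)
qed

lemma cover_map_in_image: "w \<in> P1P1 \<Longrightarrow> cover_map w \<in> cover_image"
  using cover_map_nonzero by (auto simp: cover_image_def proj_def cover_map_def)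

lemma proj_variety_cover_image: "proj_variety cover_image"
proof (rule proj_varietyI)
  show "proj_closed cover_image"
    unfolding proj_closed_def cover_image_def
    by (rule exI[of _ 5], rule exI[of _ "{f. (\<exists>d. form d f) \<and> (\<forall>w\<in>P1P1. f (cover_map w) = 0)}"]) auto
  show "cover_image \<noteq> {}" using cover_map_in_image[OF chart_P1P1] by blast
  show "form_domain cover_image"
    unfolding form_domain_def
  proof (intro allI impI)
    fix d e f g assume f: "form d f" and g: "form e g" and fg: "\<forall>v\<in>cover_image. f v * g v = 0"
    have "\<forall>w\<in>P1P1. f (cover_map w) * g (cover_map w) = 0" using fg cover_map_in_image by blast
    then have "(\<forall>w\<in>P1P1. f (cover_map w) = 0) \<or> (\<forall>w\<in>P1P1. g (cover_map w) = 0)"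
      by (rule form_domainD[OF form_domain_P1P1 form_compose[OF f form_cover_map]
            form_compose[OF g form_cover_map]])
    then show "(\<forall>v\<in>cover_image. f v = 0) \<or> (\<forall>v\<in>cover_image. g v = 0)"
      using f g unfolding cover_image_def by blast
  qed
qed

lemma morphism_cover_map: "morphism P1P1 cover_image cover_map"
proof -
  have r: "rat_map P1P1 cover_image cover_map"
    unfolding rat_map_def
  proof (intro conjI)
    show "\<exists>d. \<forall>i. form d (\<lambda>v. cover_map v i)" using form_cover_map by blast
    show "\<exists>v\<in>P1P1. cover_map v \<noteq> 0" using cover_map_nonzero chart_P1P1 by blast
    show "\<forall>v\<in>P1P1. cover_map v \<noteq> 0 \<longrightarrow> cover_map v \<in> cover_image" using cover_map_in_image by blast
  qed
  have sm: "same_map P1P1 cover_map cover_map"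
    unfolding same_map_def using cover_map_nonzero[OF chart_P1P1[of 0 0]] chart_P1P1 by auto
  have "(v, cover_map v) \<in> rgraph P1P1 cover_image cover_map" if "v \<in> P1P1" for v
    by (rule rgraphI[OF that r sm cover_map_nonzero[OF that]])
  then show ?thesis unfolding morphism_def using r by blast
qed

lemma generic_to_plane: "generic P1P1 (\<lambda>u. to_plane u \<noteq> 0 \<and> evm u \<noteq> 0)"
proof (intro generic_conj form_domain_P1P1)
  show "generic P1P1 (\<lambda>u. to_plane u \<noteq> 0)"
    by (rule generic_tuple[OF form_to_plane chart_P1P1[of 0 0]]) (simp add: to_plane_chart smul_vec4)
  show "generic P1P1 (\<lambda>u. evm u \<noteq> 0)"
    by (rule generic_form[OF form_ev(2) chart_P1P1[of 0 0]]) (simp add: ev_chart)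
qed

text \<open>The universal property factors \<open>cover_map\<close> through \<open>q\<close> by a
  morphism \<open>g\<close>. The first three components of \<open>g \<circ> \<pi>\<close>, evaluated
  at \<open>\<rho> u\<close>, are those of \<open>cover_map u\<close> up to a factor, hence
  proportional to \<open>to_plane u\<close>.\<close>

lemma (in santos_model) plane_inverse:
  "\<exists>\<psi> e. (\<forall>i. form e (\<lambda>v. \<psi> v i)) \<and> (\<forall>v. \<forall>i>2. \<psi> v i = 0) \<and>
    generic P1P1 (\<lambda>u. \<rho> u \<noteq> 0 \<and> to_plane u \<noteq> 0 \<and> (\<exists>c. c \<noteq> 0 \<and> \<psi> (\<rho> u) = smul c (to_plane u)))"
proof -
  have "same_map P1P1 (cover_map \<circ> T4) cover_map"
    unfolding same_map_def using cover_map_nonzero[OF chart_P1P1[of 0 0]] chart_P1P1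
    by (auto simp: cover_map_T4)
  then obtain g where g: "morphism Q cover_image g" "same_map P1P1 (g \<circ> q) cover_map"
    using q_univ[OF proj_variety_cover_image morphism_cover_map] by blast
  obtain dg where dg: "\<And>i. form dg (\<lambda>v. g v i)"
    using g(1) rat_mapE unfolding morphism_def by blast
  define \<psi> where "\<psi> v = (\<lambda>i. if i < 3 then g (\<pi> v) i else 0)" for v
  have "form (dp * dg) (\<lambda>v. \<psi> v i)" for i
    using form_compose[where \<phi> = \<pi>, OF dg forms(2), of i] form_0
    by (cases "i < 3") (simp_all add: \<psi>_def)
  moreover have "\<psi> v i = 0" if "i > 2" for v i using that by (simp add: \<psi>_def)
  moreover have "generic P1P1 (\<lambda>u. g (q u) \<noteq> 0)"
  proof -
    obtain u where "u \<in> P1P1" "g (q u) \<noteq> 0" using g(2) unfolding same_map_def by auto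
    then show ?thesis
      by (rule generic_tuple[of "dq * dg" "\<lambda>u. g (q u)", rotated]) (rule form_compose[OF dg forms(1)])
  qed
  then have "generic P1P1 (\<lambda>u. good u \<and>
      (to_plane u \<noteq> 0 \<and> evm u \<noteq> 0) \<and> g (q u) \<noteq> 0)"
    by (intro generic_conj form_domain_P1P1 generic_good generic_to_plane)
  then have "generic P1P1 (\<lambda>u. \<rho> u \<noteq> 0 \<and> to_plane u \<noteq> 0 \<and> (\<exists>c. c \<noteq> 0 \<and> \<psi> (\<rho> u) = smul c (to_plane u)))"
  proof (rule generic_mono)
    fix u assume u: "u \<in> P1P1" and *: "good u \<and>
      (to_plane u \<noteq> 0 \<and> evm u \<noteq> 0) \<and> g (q u) \<noteq> 0"
    then obtain c where c: "c \<noteq> 0" "q u = smul c (\<pi> (\<rho> u))" using q_pi_rho unfolding good_def by blast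
    have "parallel (cover_map u) (g (q u))"
      using g(2) u parallel_sym unfolding same_map_parallel by simp
    then obtain b where b: "b \<noteq> 0" "g (q u) = smul b (cover_map u)"
      using * cover_map_nonzero[OF u] by (meson parallelE2)
    have "g (q u) = smul (c ^ dg) (g (\<pi> (\<rho> u)))" by (simp add: c(2) tuple_smul[of dg g, OF dg])
    then have "smul (1 / c ^ dg) (smul b (cover_map u)) = smul (1 / c ^ dg) (smul (c ^ dg) (g (\<pi> (\<rho> u))))"
      using b(2) by simp
    then have gp: "g (\<pi> (\<rho> u)) = smul (b / c ^ dg) (cover_map u)" using c(1) by simp
    have "\<psi> (\<rho> u) = smul (b / c ^ dg * evm u) (to_plane u)"
    proof
      fix i show "\<psi> (\<rho> u) i = smul (b / c ^ dg * evm u) (to_plane u) i"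
      proof (cases "i < 3")
        case True
        then show ?thesis by (simp add: \<psi>_def gp cover_map_def)
      next
        case False
        then have "i = 3 \<or> i > 3" by arith
        then show ?thesis by (auto simp: \<psi>_def to_plane_def)
      qed
    qed
    moreover have "b / c ^ dg * evm u \<noteq> 0" using b(1) c(1) * by simp
    ultimately show "\<rho> u \<noteq> 0 \<and> to_plane u \<noteq> 0 \<and> (\<exists>c. c \<noteq> 0 \<and> \<psi> (\<rho> u) = smul c (to_plane u))"
      using * unfolding good_def by blast
  qed
  ultimately show ?thesis by blast
qed

text \<open>Division by \<open>D\<close> preserves invariance up to a factor, since the minors are
  polynomials and \<open>D\<close> is generically nonzero. The point \<open>(p0, q0)\<close> lies on
  a line of the cycle; that neither \<open>S\<close> nor \<open>R\<close> vanishes there makes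
  \<open>\<phi>\<close> defined at the general point of the cubic.\<close>

lemma (in santos_model) plane_parametrization:
  "\<exists>\<phi> m R D S p0 q0. (\<forall>i. form m (\<lambda>v. \<phi> v i)) \<and> (\<forall>i. bipoly (\<lambda>p q. R p q i)) \<and> bipoly D \<and> bipoly S \<and>
    (\<forall>p q. \<rho> (chart p q) = smul (D p q) (R p q)) \<and>
    (\<forall>p q. \<phi> (to_plane (chart p q)) = smul (S p q) (R p q)) \<and>
    p0 - \<i> * q0 = 1 - \<i> \<and> S p0 q0 \<noteq> 0 \<and> R p0 q0 \<noteq> 0 \<and> (\<forall>p q. \<forall>i>n. R p q i = 0) \<and>
    (\<exists>p q. D p q \<noteq> 0)"
proof -
  have b: "bipoly (\<lambda>p q. \<rho> (chart p q) i)" for i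
    by (rule bipoly_polyfun[OF form_polyfun[OF forms(4)] bipoly_chart])
  obtain p1 q1 where "\<rho> (chart p1 q1) \<noteq> 0" using genp_ex[OF generic_genp[OF generic_rho]] by blast
  from clear_lines[of "\<lambda>p q. \<rho> (chart p q)", OF b this, of cycle_lines]
  obtain R D where R: "\<And>i. bipoly (\<lambda>p q. R p q i)" "bipoly D"
    "\<And>p q. \<rho> (chart p q) = smul (D p q) (R p q)"
    "\<forall>(a, b)\<in>cycle_lines. \<exists>p q. p + a * q + b = 0 \<and> R p q \<noteq> 0" by blast
  have "D p1 q1 \<noteq> 0" using R(3)[of p1 q1] \<open>\<rho> (chart p1 q1) \<noteq> 0\<close> by auto
  then have gD: "genp (\<lambda>p q. D p q \<noteq> 0)" by (rule genp_bipoly[OF R(2)])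
  have D': "bipoly (\<lambda>p q. D (- \<i> * p) (\<i> * q))"
    by (intro bipoly_bipoly[OF R(2)] bipoly_rules)
  have gD': "genp (\<lambda>p q. D (- \<i> * p) (\<i> * q) \<noteq> 0)"
    by (rule genp_bipoly[OF D', of "\<i> * p1" "- \<i> * q1"]) (use \<open>D p1 q1 \<noteq> 0\<close> in simp)
  have Rn: "R p q i = 0" if i: "i > n" for p q i
  proof (rule genp_vanish[OF _ R(1)])
    show "genp (\<lambda>p q. R p q i = 0)"
      using gD
    proof (rule genp_mono)
      fix p q assume "D p q \<noteq> 0"
      have "\<rho> (chart p q) i = 0"
        using rho_M[OF chart_P1P1, of p q] M(2) i by (cases "\<rho> (chart p q) = 0") (auto simp: proj_def)
      then show "R p q i = 0" using \<open>D p q \<noteq> 0\<close> by (simp add: R(3))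
    qed
  qed
  have Rr: "bipoly (\<lambda>p q. R (- \<i> * p) (\<i> * q) i)" for i
    by (intro bipoly_bipoly[OF R(1)] bipoly_rules)
  have "R (- \<i> * p) (\<i> * q) i * R p q j - R (- \<i> * p) (\<i> * q) j * R p q i = 0" for p q i j
  proof (rule genp_vanish[where F = "\<lambda>p q. R (- \<i> * p) (\<i> * q) i * R p q j - R (- \<i> * p) (\<i> * q) j * R p q i"])
    show "genp (\<lambda>p q. R (- \<i> * p) (\<i> * q) i * R p q j - R (- \<i> * p) (\<i> * q) j * R p q i = 0)"
      using genp_conj[OF gD gD']
    proof (rule genp_mono)
      fix p q assume *: "D p q \<noteq> 0 \<and> D (- \<i> * p) (\<i> * q) \<noteq> 0"
      have "parallel (\<rho> (T4 (chart p q))) (\<rho> (chart p q))" by (rule rho_T4[OF chart_P1P1])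
      then have "parallel (smul ((- 1) ^ dr * D (- \<i> * p) (\<i> * q)) (R (- \<i> * p) (\<i> * q))) (smul (D p q) (R p q))"
        unfolding T4_chart_rot smuls R(3) smul_simps .
      then have "(- 1) ^ dr * D (- \<i> * p) (\<i> * q) * D p q * (R (- \<i> * p) (\<i> * q) i * R p q j) =
          (- 1) ^ dr * D (- \<i> * p) (\<i> * q) * D p q * (R (- \<i> * p) (\<i> * q) j * R p q i)"
        unfolding parallel_def smul_apply by (elim allE[of _ i] allE[of _ j]) (simp only: mult_ac)
      then show "R (- \<i> * p) (\<i> * q) i * R p q j - R (- \<i> * p) (\<i> * q) j * R p q i = 0" using * by simp
    qed
    show "bipoly (\<lambda>p q. R (- \<i> * p) (\<i> * q) i * R p q j - R (- \<i> * p) (\<i> * q) j * R p q i)"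
      by (intro bipoly_basic(5,7) R(1) Rr)
  qed
  then have "parallel (R (- \<i> * p) (\<i> * q)) (R p q)" for p q by (simp add: parallel_def)
  from plane_lift[OF R(1) Rn this R(4)]
  obtain \<phi> m S p0 q0 where "\<forall>i. form m (\<lambda>v. \<phi> v i)" "bipoly S"
    "\<forall>p q. \<phi> (to_plane (chart p q)) = smul (S p q) (R p q)"
    "p0 - \<i> * q0 = 1 - \<i>" "S p0 q0 \<noteq> 0" "R p0 q0 \<noteq> 0" by blast
  moreover have "\<forall>p q. \<forall>i>n. R p q i = 0" using Rn by blast
  ultimately show ?thesis
    using R(1-3) \<open>D p1 q1 \<noteq> 0\<close>
    by (intro exI[of _ \<phi>] exI[of _ m] exI[of _ R] exI[of _ D] exI[of _ S] exI[of _ p0] exI[of _ q0]) blast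
qed

text \<open>The converse passage, from the chart to the quadric: the polynomial witness is
  homogenized by \<open>evm\<close>.\<close>

lemma generic_P1P1I:
  assumes "genp P" and PQ: "\<And>p q c. c \<noteq> 0 \<Longrightarrow> P p q \<Longrightarrow> smul c (chart p q) \<in> P1P1 \<Longrightarrow> Q (smul c (chart p q))"
  shows "generic P1P1 Q"
proof -
  obtain N p0 q0 where N: "bipoly N" "N p0 q0 \<noteq> 0" and P: "\<And>p q. N p q \<noteq> 0 \<Longrightarrow> P p q"
    using assms(1) unfolding genp_def by blast
  obtain m G where G: "form m G"
    "\<And>w. evm w \<noteq> 0 \<Longrightarrow> G w = evm w ^ m * N (evi w / evm w ^ 1) (evmi w / evm w ^ 1)"
    using homogenize[OF N(1) form_ev(2,3,4)] by blast
  have "G (chart p0 q0) \<noteq> 0" using N(2) by (simp add: G(2) ev_chart)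
  then have "generic P1P1 (\<lambda>u. G u \<noteq> 0)" by (rule generic_form[OF G(1) chart_P1P1])
  moreover have "generic P1P1 (\<lambda>u. evm u \<noteq> 0)"
    by (rule generic_form[OF form_ev(2) chart_P1P1[of 0 0]]) (simp add: ev_chart)
  ultimately have "generic P1P1 (\<lambda>u. G u \<noteq> 0 \<and> evm u \<noteq> 0)" by (rule generic_conj[OF form_domain_P1P1])
  then show ?thesis
  proof (rule generic_mono)
    fix w assume w: "w \<in> P1P1" "G w \<noteq> 0 \<and> evm w \<noteq> 0"
    then have "N (evi w / evm w) (evmi w / evm w) \<noteq> 0" using G(2) by auto
    then have "P (evi w / evm w) (evmi w / evm w)" by (rule P)
    then show "Q w"
      using PQ[of "evm w / 8" "evi w / evm w" "evmi w / evm w"] w chart_inverse[OF w(1)] by simp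
  qed
qed

lemma to_plane_chart_plane: "to_plane (chart p q) \<in> proj 2" "to_plane (chart p q) \<noteq> 0"
  by (simp_all add: to_plane_chart smul_vec4 vec4_proj2)

section \<open>The two foliations in the coordinates of the chart\<close>

definition chart_deriv :: "complex \<Rightarrow> complex \<Rightarrow> complex \<Rightarrow> complex \<Rightarrow> vec" where
  "chart_deriv p q a b = vec4 (2 * (p - 1) * a + 2 * (q - 1) * b) (2 * (p - \<i>) * a + 2 * (q + \<i>) * b)
     (2 * (p + \<i>) * a + 2 * (q - \<i>) * b) (2 * (p + 1) * a + 2 * (q + 1) * b)"

lemma chart_has_derivative:
  "((\<lambda>t. chart (p + t * a) (q + t * b) i) has_field_derivative chart_deriv p q a b i) (at 0)"
  using vec4_cases[of i]
  by (elim disjE) (auto simp: chart_def chart_deriv_def algebra_simps intro!: derivative_eq_intros)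

lemma chart_deriv_tangent: "chart_deriv p q a b \<in> tangent P1P1 (chart p q)"
  unfolding tangent_def
proof (intro CollectI allI impI)
  fix d f assume f: "form d f" "\<forall>u\<in>P1P1. f u = 0"
  have "((\<lambda>t. f (chart (p + t * a) (q + t * b))) has_field_derivative
      dird 1 f (chart (p + 0 * a) (q + 0 * b)) (chart_deriv p q a b)) (at 0)"
    by (rule dird_chain[OF form_polyfun[OF f(1)] chart_has_derivative])
  moreover have "f (chart (p + t * a) (q + t * b)) = 0" for t using f(2) chart_P1P1 by blast
  ultimately have "((\<lambda>t. 0) has_field_derivative dird 1 f (chart p q) (chart_deriv p q a b)) (at 0)" by simp
  then show "dird 1 f (chart p q) (chart_deriv p q a b) = 0"
    using DERIV_const DERIV_unique by blast
qed

text \<open>\<open>is_E4\<close> tests \<open>E\<close> only at vectors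
  \<open>(1, X, Y, X Y)\<close> and on tangent vectors with first entry zero. The velocity of
  \<open>chart\<close> is brought to this shape by splitting off its radial part and dividing by
  \<open>w 0\<close>.\<close>

lemma E4_chart:
  assumes E: "is_E4 E" and w0: "chart p q 0 \<noteq> 0"
  shows "chart_deriv p q a b \<in> E (chart p q) \<longleftrightarrow> (p^2 - q^2) * a + 2 * (p * q - 1) * b = 0"
proof -
  define w d where "w = chart p q" and "d = chart_deriv p q a b"
  define X Y X' Y' where "X = w 1 / w 0" and "Y = w 2 / w 0"
    and "X' = (d 1 - d 0 * X) / w 0" and "Y' = (d 2 - d 0 * Y) / w 0"
  have nz: "w 0 \<noteq> 0" using w0 by (simp add: w_def)
  have quad: "w 0 * w 3 = w 1 * w 2" using chart_P1P1[of p q] by (simp add: w_def P1P1_quadric)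
  have dquad: "w 0 * d 3 + d 0 * w 3 = d 1 * w 2 + w 1 * d 2"
    by (simp add: w_def d_def chart_def chart_deriv_def power2_eq_square algebra_simps)
  \<comment> \<open>This is the numerator of \<open>Y X' - i X Y'\<close> over the denominator
    \<open>w 0 ^ 2\<close>, with \<open>w 1 w 2 / w 0\<close> replaced by
    \<open>w 3\<close>.\<close>
  have num: "w 2 * d 1 - \<i> * w 1 * d 2 - (1 - \<i>) * d 0 * w 3 =
      - 4 * (1 - \<i>) * ((p^2 - q^2) * a + 2 * (p * q - 1) * b)"
    unfolding w_def d_def chart_def chart_deriv_def vec4_simps using i_times_i by algebra
  define u y where "u = segre 1 X 1 Y" and "y = vec4 0 X' Y' (X' * Y + X * Y')"
  have u1: "u \<in> P1P1" unfolding u_def by (rule P1P1I[OF refl]) auto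
  have wn: "\<forall>i>3. w i = 0" "\<forall>i>3. d i = 0" by (simp_all add: w_def d_def chart_def chart_deriv_def)
  have wu: "w = smul (w 0) u"
    unfolding u_def segre_vec4 smul_vec4 using nz quad wn
    by (subst eq_commute) (auto simp: vec4_eq_iff X_def Y_def field_simps)
  have d3: "d 3 = d 0 * (X * Y) + w 0 * (X' * Y + X * Y')"
  proof -
    have "w 0 * (w 0 * d 3) = w 0 * (d 1 * w 2 + w 1 * d 2) - d 0 * (w 1 * w 2)"
      using quad dquad by algebra
    then have "d 3 = (w 0 * (d 1 * w 2 + w 1 * d 2) - d 0 * (w 1 * w 2)) / (w 0 * w 0)"
      using nz by (simp add: field_simps)
    also have "\<dots> = d 0 * (X * Y) + w 0 * (X' * Y + X * Y')"
      using nz by (simp add: X_def Y_def X'_def Y'_def field_simps)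
    finally show ?thesis .
  qed
  have du: "d = smul (d 0) u + smul (w 0) y"
  proof
    fix i show "d i = (smul (d 0) u + smul (w 0) y) i"
      using vec4_cases[of i] d3 wn nz
      by (elim disjE) (auto simp: u_def y_def segre_vec4 X'_def Y'_def)
  qed
  have "foliation_on P1P1 E" using E by (simp add: is_E4_def)
  moreover have "P1P1 \<subseteq> proj 3" by (auto simp: P1P1_quadric)
  moreover have "smul (w 0) u \<in> P1P1" using wu chart_P1P1[of p q] by (simp add: w_def)
  ultimately have "smul (d 0) u + smul (w 0) y \<in> E (smul (w 0) u) \<longleftrightarrow> y \<in> E u"
    using u1 nz by (intro foliation_shift)
  then have "d \<in> E w \<longleftrightarrow> y \<in> E u" using wu du by simp
  also have "\<dots> \<longleftrightarrow> Y * X' - \<i> * X * Y' = 0"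
  proof -
    have "y = (\<lambda>i. 0)(1 := X', 2 := Y', 3 := X' * Y + X * Y')"
      by (auto simp: y_def vec4_def fun_eq_iff)
    then show ?thesis using E unfolding is_E4_def u_def by simp
  qed
  also have "Y * X' - \<i> * X * Y' = (w 2 * d 1 - \<i> * w 1 * d 2 - (1 - \<i>) * d 0 * (w 1 * w 2 / w 0)) / w 0 ^ 2"
    using nz by (simp add: X_def Y_def X'_def Y'_def field_simps power2_eq_square)
  also have "w 1 * w 2 / w 0 = w 3" using quad nz by (simp add: field_simps)
  also have "(w 2 * d 1 - \<i> * w 1 * d 2 - (1 - \<i>) * d 0 * w 3) / w 0 ^ 2 = 0 \<longleftrightarrow>
      (p^2 - q^2) * a + 2 * (p * q - 1) * b = 0"
  proof -
    have "1 - \<i> \<noteq> 0" by (simp add: complex_eq_iff)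
    then show ?thesis
      unfolding num divide_eq_0_iff mult_eq_0_iff using nz by simp
  qed
  finally show ?thesis by (simp add: w_def d_def)
qed

text \<open>The velocity of a curve in the cone over the plane lying over a curve in the chart;
  every vector is of this form as \<open>p \<noteq> 0\<close>.\<close>

lemma plane_velocity:
  assumes p: "p \<noteq> 0" and c: "c \<noteq> 0" and w: "\<And>i. i > 2 \<Longrightarrow> w i = 0"
  obtains a b \<mu> where "\<And>i. ((\<lambda>t. smul (c + t * \<mu>) (to_plane (chart (p + t * a) (q + t * b))) i)
      has_field_derivative w i) (at 0)"
    "w \<in> plane_field H4A H4B H4C (smul c (to_plane (chart p q))) \<longleftrightarrow>
      (p^2 - q^2) * a + 2 * (p * q - 1) * b = 0"
proof -
  define u y z where "u = p * q" and "y = 1 - u" and "z = 2 - 3 * u + (p^4 + u^2) / 2"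
  \<comment> \<open>The velocity equations are triangular: \<open>w 0\<close> gives the rate of
    scaling, \<open>w 1\<close> the rate \<open>du\<close> of \<open>u = p q\<close>,
    \<open>w 2\<close> then gives \<open>a\<close> since the derivative of \<open>s\<close> is
    \<open>4 p^3 a\<close>, and finally \<open>du = q a + p b\<close> gives
    \<open>b\<close>.\<close>
  define \<mu> where "\<mu> = w 0 / 512"
  define du where "du = - (w 1 / 512 - \<mu> * y) / c"
  define a where "a = ((w 2 / 512 - \<mu> * z) / c + 3 * du - u * du) / (2 * p^3)"
  define b where "b = (du - q * a) / p"
  have du: "q * a + p * b = du" using p by (simp add: b_def)
  define dz where "dz = - 3 * du + 2 * p^3 * a + u * du"
  have dz: "dz = (w 2 / 512 - \<mu> * z) / c" using p by (simp add: dz_def a_def)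
  have w0: "w 0 = 512 * \<mu>" by (simp add: \<mu>_def)
  have w1: "w 1 = 512 * (\<mu> * y - c * du)" using c by (simp add: du_def)
  have w2: "w 2 = 512 * (\<mu> * z + c * dz)" using c by (simp add: dz)
  have tp: "to_plane (chart p' q') = vec4 512 (512 * (1 - p' * q'))
      (512 * (2 - 3 * (p' * q') + (p' ^ 4 + (p' * q')^2) / 2)) 0" for p' q'
    by (simp add: to_plane_chart smul_vec4)
  show thesis
  proof (rule that[of \<mu> a b])
    fix i :: nat
    consider "i = 0" | "i = 1" | "i = 2" | "i > 2" by arith
    then show "((\<lambda>t. smul (c + t * \<mu>) (to_plane (chart (p + t * a) (q + t * b))) i)
      has_field_derivative w i) (at 0)"
    proof cases
      case 1
      then show ?thesis unfolding tp smul_apply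
        by (auto simp: w0 intro!: derivative_eq_intros)
    next
      case 2
      show ?thesis unfolding tp smul_apply 2 vec4_simps w1 du[symmetric] y_def u_def
        by (auto simp: algebra_simps intro!: derivative_eq_intros)
    next
      case 3
      show ?thesis unfolding tp smul_apply 3 vec4_simps w2 dz_def du[symmetric] z_def u_def
        by (auto intro!: derivative_eq_intros) algebra
    next
      case 4
      then have "i = 3 \<or> i > 3" by arith
      then show ?thesis using w[OF 4] by (auto simp: tp)
    qed
  next
    have hom: "H4A (k * x) (k * y) (k * z) = k^3 * H4A x y z" "H4B (k * x) (k * y) (k * z) = k^3 * H4B x y z"
      "H4C (k * x) (k * y) (k * z) = k^3 * H4C x y z" for k x y z
      unfolding H4A_def H4B_def H4C_def by algebra+
    have rad: "H4A 1 y z + y * H4B 1 y z + z * H4C 1 y z = 0"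
      unfolding H4A_def H4B_def H4C_def by algebra
    \<comment> \<open>At \<open>x = 1\<close> the form is \<open>H4B dy + H4C dz\<close> with
      \<open>dy = - du\<close>; the contribution of the scaling rate is removed by
      \<open>rad\<close>.\<close>
    have core: "2 * (- H4B 1 y z * du + H4C 1 y z * dz) = - 2 * p^5 * ((p^2 - q^2) * a + 2 * (p * q - 1) * b)"
    proof -
      have z2: "2 * z = 4 - 6 * u + p^4 + u^2" by (simp add: z_def)
      show ?thesis unfolding H4B_def H4C_def dz_def du[symmetric] y_def using z2 u_def by algebra
    qed
    have v: "smul c (to_plane (chart p q)) = vec4 (512 * c * 1) (512 * c * y) (512 * c * z) 0"
      unfolding tp smul_vec4 by (simp add: y_def z_def u_def vec4_eq_iff algebra_simps)
    have "on3 H4A (smul c (to_plane (chart p q))) * w 0 + on3 H4B (smul c (to_plane (chart p q))) * w 1 +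
        on3 H4C (smul c (to_plane (chart p q))) * w 2 =
        (512 * c)^3 * 512 * (\<mu> * (H4A 1 y z + y * H4B 1 y z + z * H4C 1 y z) +
          c * (- H4B 1 y z * du + H4C 1 y z * dz))"
      unfolding v on3_def vec4_simps hom w0 w1 w2 by algebra
    also have "\<dots> = (512 * c)^3 * 512 * c * (- (p^5)) * ((p^2 - q^2) * a + 2 * (p * q - 1) * b)"
      unfolding rad using core by algebra
    finally show "w \<in> plane_field H4A H4B H4C (smul c (to_plane (chart p q))) \<longleftrightarrow>
        (p^2 - q^2) * a + 2 * (p * q - 1) * b = 0"
      using w p c by (simp add: plane_field_def)
  qed
qed

text \<open>\<open>D\<close> and \<open>S\<close> measure how \<open>\<rho>\<close> and
  \<open>\<phi> \<circ> to_plane\<close> differ on the chart from the common tuple \<open>R\<close>.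
  This comparison underlies birationality, the pull-back of the foliation and the strict
  transform.\<close>

locale santos_plane = santos_model +
  fixes \<phi> \<psi> R D S p0 q0 m e
  assumes phi_forms: "\<And>i. form m (\<lambda>v. \<phi> v i)" and psi_forms: "\<And>i. form e (\<lambda>v. \<psi> v i)"
    and psi_plane: "\<And>v i. i > 2 \<Longrightarrow> \<psi> v i = 0"
    and psi_rho: "generic P1P1 (\<lambda>u. \<rho> u \<noteq> 0 \<and> to_plane u \<noteq> 0 \<and> (\<exists>c. c \<noteq> 0 \<and> \<psi> (\<rho> u) = smul c (to_plane u)))"
    and R: "\<And>i. bipoly (\<lambda>p q. R p q i)" and D: "bipoly D" and S: "bipoly S"
    and rho_chart: "\<And>p q. \<rho> (chart p q) = smul (D p q) (R p q)"
    and phi_chart: "\<And>p q. \<phi> (to_plane (chart p q)) = smul (S p q) (R p q)"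
    and base: "p0 - \<i> * q0 = 1 - \<i>" "S p0 q0 \<noteq> 0" "R p0 q0 \<noteq> 0"
    and R_support: "\<And>p q i. i > n \<Longrightarrow> R p q i = 0"
    and D_nonzero: "\<exists>p q. D p q \<noteq> 0"
begin

lemma genp_DSR: "genp (\<lambda>p q. D p q \<noteq> 0 \<and> S p q \<noteq> 0 \<and> R p q \<noteq> 0)"
proof (intro genp_conj)
  show "genp (\<lambda>p q. D p q \<noteq> 0)" using D_nonzero D genp_bipoly by blast
  show "genp (\<lambda>p q. S p q \<noteq> 0)" by (rule genp_bipoly[OF S base(2)])
  show "genp (\<lambda>p q. R p q \<noteq> 0)" by (rule genp_tuple[OF R base(3)])
qed

lemma phi_to_plane: "generic P1P1 (\<lambda>u. \<rho> u \<noteq> 0 \<and> (\<exists>a. a \<noteq> 0 \<and> \<phi> (to_plane u) = smul a (\<rho> u)))"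
proof (rule generic_P1P1I[OF genp_DSR])
  fix p q c :: complex assume *: "c \<noteq> 0" "D p q \<noteq> 0 \<and> S p q \<noteq> 0 \<and> R p q \<noteq> 0"
  define u where u: "u = smul c (chart p q)"
  have "\<phi> (to_plane u) = smul (c ^ (3 * m) * S p q) (R p q)"
    by (simp add: u tuple_smul[of 3 to_plane, OF form_to_plane] tuple_smul[of m \<phi>, OF phi_forms]
        phi_chart power_mult)
  moreover have r: "\<rho> u = smul (c ^ dr * D p q) (R p q)" by (simp add: u smuls rho_chart)
  ultimately have "\<phi> (to_plane u) = smul (c ^ (3 * m) * S p q / (c ^ dr * D p q)) (\<rho> u)"
    using * by simp
  moreover have "c ^ (3 * m) * S p q / (c ^ dr * D p q) \<noteq> 0" "\<rho> u \<noteq> 0" using * by (simp_all add: r)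
  ultimately show "\<rho> (smul c (chart p q)) \<noteq> 0 \<and> (\<exists>a. a \<noteq> 0 \<and>
      \<phi> (to_plane (smul c (chart p q))) = smul a (\<rho> (smul c (chart p q))))" unfolding u by blast
qed

lemma rat_map_phi: "rat_map (proj 2) M \<phi>"
proof (rule rat_map_generic[OF form_domain_plane M(3) phi_forms to_plane_chart_plane(1)])
  show "\<phi> (to_plane (chart p0 q0)) \<noteq> 0" using base by (simp add: phi_chart)
  show "generic (proj 2) (\<lambda>v. \<exists>a y. y \<in> M \<and> \<phi> v = smul a y)"
  proof (rule generic_planeI[OF genp_DSR])
    fix p q c assume *: "D p q \<noteq> 0 \<and> S p q \<noteq> 0 \<and> R p q \<noteq> 0"
    have "\<rho> (chart p q) \<in> M" by (rule rho_M[OF chart_P1P1]) (use * in \<open>simp add: rho_chart\<close>)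
    moreover have "\<phi> (smul c (to_plane (chart p q))) = smul (c ^ m * S p q / D p q) (\<rho> (chart p q))"
      using * by (simp add: tuple_smul[of m \<phi>, OF phi_forms] phi_chart rho_chart)
    ultimately show "\<exists>a y. y \<in> M \<and> \<phi> (smul c (to_plane (chart p q))) = smul a y" by blast
  qed
qed

lemma rat_map_psi: "rat_map M (proj 2) \<psi>"
  unfolding rat_map_def
proof (intro conjI ballI impI)
  show "\<exists>d. \<forall>i. form d (\<lambda>v. \<psi> v i)" using psi_forms by blast
  obtain u c where "u \<in> P1P1" "\<rho> u \<noteq> 0" "to_plane u \<noteq> 0" "c \<noteq> 0" "\<psi> (\<rho> u) = smul c (to_plane u)"
    using generic_ex[OF psi_rho] by blast
  then show "\<exists>v\<in>M. \<psi> v \<noteq> 0" using rho_M by (intro bexI[of _ "\<rho> u"]) simp_all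
  show "\<psi> v \<in> proj 2" if "\<psi> v \<noteq> 0" for v using that psi_plane by (simp add: proj_def)
qed

lemma psi_phi: "same_map (proj 2) (\<psi> \<circ> \<phi>) id"
proof -
  have g: "generic (proj 2) (\<lambda>v. \<exists>a. a \<noteq> 0 \<and> \<psi> (\<phi> v) = smul a v)"
  proof (rule generic_planeI[OF genp_conj[OF genp_DSR generic_genp[OF psi_rho]]])
    fix p q c :: complex
    assume "c \<noteq> 0" "(D p q \<noteq> 0 \<and> S p q \<noteq> 0 \<and> R p q \<noteq> 0) \<and> \<rho> (chart p q) \<noteq> 0 \<and>
      to_plane (chart p q) \<noteq> 0 \<and> (\<exists>c. c \<noteq> 0 \<and> \<psi> (\<rho> (chart p q)) = smul c (to_plane (chart p q)))"
    then obtain b where *: "c \<noteq> 0" "D p q \<noteq> 0" "S p q \<noteq> 0" "b \<noteq> 0"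
      "\<psi> (\<rho> (chart p q)) = smul b (to_plane (chart p q))" by blast
    define v where v: "v = smul c (to_plane (chart p q))"
    have "\<phi> v = smul (c ^ m * S p q / D p q) (\<rho> (chart p q))"
      using * by (simp add: v tuple_smul[of m \<phi>, OF phi_forms] phi_chart rho_chart)
    then have "\<psi> (\<phi> v) = smul ((c ^ m * S p q / D p q) ^ e * b / c) v"
      using * by (simp add: v tuple_smul[of e \<psi>, OF psi_forms])
    moreover have "(c ^ m * S p q / D p q) ^ e * b / c \<noteq> 0" using * by simp
    ultimately show "\<exists>a. a \<noteq> 0 \<and> \<psi> (\<phi> (smul c (to_plane (chart p q)))) =
        smul a (smul c (to_plane (chart p q)))" unfolding v by blast
  qed
  have "parallel ((\<psi> \<circ> \<phi>) v) (id v)" if "v \<in> proj 2" for v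
  proof (rule generic_parallel[OF form_domain_plane _ _ _ that])
    show "generic (proj 2) (\<lambda>v. parallel ((\<psi> \<circ> \<phi>) v) (id v))"
      using g by (rule generic_mono) (metis comp_apply id_apply parallel_refl smul_simps(2))
    show "form (m * e) (\<lambda>v. (\<psi> \<circ> \<phi>) v i)" for i
      unfolding comp_def by (rule form_compose[OF psi_forms phi_forms])
    show "form 1 (\<lambda>v. id v i)" for i by (simp only: id_apply form_coord)
  qed
  moreover obtain v a where "v \<in> proj 2" "a \<noteq> 0" "\<psi> (\<phi> v) = smul a v" using generic_ex[OF g] by blast
  moreover have "v \<noteq> 0" using \<open>v \<in> proj 2\<close> by (simp add: proj_def)
  ultimately show ?thesis unfolding same_map_parallel
    by (intro conjI ballI bexI[of _ v]) simp_all
qed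

text \<open>On the image of \<open>\<rho>\<close> both maps are explicit: \<open>\<psi>\<close>
  leads back to \<open>to_plane u\<close>, and \<open>\<phi>\<close> from there to
  \<open>\<rho> u\<close>. Dominance of \<open>\<rho>\<close> extends the identity to
  \<open>M\<close>.\<close>

lemma phi_psi: "same_map M (\<phi> \<circ> \<psi>) id"
proof -
  have g: "generic P1P1 (\<lambda>u. \<rho> u \<noteq> 0 \<and> (\<exists>a. a \<noteq> 0 \<and> \<phi> (\<psi> (\<rho> u)) = smul a (\<rho> u)))"
    using generic_conj[OF form_domain_P1P1 psi_rho phi_to_plane]
  proof (rule generic_mono)
    fix u assume *: "(\<rho> u \<noteq> 0 \<and> to_plane u \<noteq> 0 \<and> (\<exists>c. c \<noteq> 0 \<and> \<psi> (\<rho> u) = smul c (to_plane u))) \<and>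
      \<rho> u \<noteq> 0 \<and> (\<exists>a. a \<noteq> 0 \<and> \<phi> (to_plane u) = smul a (\<rho> u))"
    then obtain a c where ac: "a \<noteq> 0" "c \<noteq> 0" "\<psi> (\<rho> u) = smul c (to_plane u)" "\<phi> (to_plane u) = smul a (\<rho> u)"
      by blast
    then have "\<phi> (\<psi> (\<rho> u)) = smul (c ^ m * a) (\<rho> u)"
      by (simp add: tuple_smul[of m \<phi>, OF phi_forms])
    moreover have "c ^ m * a \<noteq> 0" using ac by simp
    ultimately show "\<rho> u \<noteq> 0 \<and> (\<exists>a. a \<noteq> 0 \<and> \<phi> (\<psi> (\<rho> u)) = smul a (\<rho> u))" using * by blast
  qed
  have f: "form (e * m + 1) (\<lambda>v. \<phi> (\<psi> v) i * v j - \<phi> (\<psi> v) j * v i)" for i j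
    by (intro form_diff form_mult form_coord form_compose[OF phi_forms psi_forms])
  have "\<phi> (\<psi> v) i * v j - \<phi> (\<psi> v) j * v i = 0" if v: "v \<in> M" for v i j
  proof (rule rho_dominant[OF f _ v])
    fix u assume u: "u \<in> P1P1"
    show "\<phi> (\<psi> (\<rho> u)) i * \<rho> u j - \<phi> (\<psi> (\<rho> u)) j * \<rho> u i = 0"
    proof (rule generic_vanish[OF form_domain_P1P1 _ form_compose[OF f forms(4)] u])
      show "generic P1P1 (\<lambda>u. \<phi> (\<psi> (\<rho> u)) i * \<rho> u j - \<phi> (\<psi> (\<rho> u)) j * \<rho> u i = 0)"
        using g by (rule generic_mono) auto
    qed
  qed
  then have "parallel ((\<phi> \<circ> \<psi>) v) (id v)" if "v \<in> M" for v using that by (simp add: parallel_def)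
  moreover obtain u a where u: "u \<in> P1P1" "\<rho> u \<noteq> 0" "a \<noteq> 0" "\<phi> (\<psi> (\<rho> u)) = smul a (\<rho> u)"
    using generic_ex[OF g] by blast
  ultimately show ?thesis unfolding same_map_parallel
    using rho_M[OF u(1,2)] by (intro conjI ballI bexI[of _ "\<rho> u"]) simp_all
qed

lemma birational_phi: "birational (proj 2) M \<phi>"
  unfolding birational_def using rat_map_phi rat_map_psi psi_phi phi_psi by blast

text \<open>On the chart \<open>\<phi> \<circ> to_plane\<close> is a scalar function times
  \<open>\<rho>\<close>, so the derivatives differ by a factor and a radial term, to which
  \<open>F\<close> is insensitive. Membership in \<open>F\<close> is thereby carried to
  \<open>E\<close>, where it becomes the same linear equation in \<open>a\<close> and
  \<open>b\<close> as membership in the plane field.\<close>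

lemma pulls_back_phi:
  assumes E: "is_E4 E" and F: "foliation_on M F" and pb: "pulls_back P1P1 \<rho> F E"
  shows "pulls_back (proj 2) \<phi> F (plane_field H4A H4B H4C)"
proof -
  have "generic P1P1 (\<lambda>u. \<rho> u \<noteq> 0 \<and>
      (\<forall>w\<in>tangent P1P1 u. w \<in> E u \<longleftrightarrow> (\<lambda>i. dird 1 (\<lambda>v. \<rho> v i) u w) \<in> F (\<rho> u)))"
    using pb unfolding pulls_back_def generic_def by blast
  note * = this
  have "genp (\<lambda>p q. chart p q 0 \<noteq> 0)"
    by (rule genp_bipoly[OF bipoly_chart, of 0 0]) (simp add: chart_def)
  note gen = genp_conj[OF generic_genp[OF *] genp_conj[OF genp_DSR this]]
  have "generic (proj 2) (\<lambda>v. \<phi> v \<noteq> 0 \<and> (\<forall>w\<in>tangent (proj 2) v.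
      w \<in> plane_field H4A H4B H4C v \<longleftrightarrow> (\<lambda>i. dird 1 (\<lambda>u. \<phi> u i) v w) \<in> F (\<phi> v)))"
    (is "generic _ ?P")
  proof (rule generic_planeI[OF gen])
    fix p q c :: complex
    define v where vc: "v = smul c (to_plane (chart p q))"
    assume v: "smul c (to_plane (chart p q)) \<in> proj 2" and c: "c \<noteq> 0" "p \<noteq> 0" and "(\<rho> (chart p q) \<noteq> 0 \<and>
      (\<forall>w\<in>tangent P1P1 (chart p q). w \<in> E (chart p q) \<longleftrightarrow>
        (\<lambda>i. dird 1 (\<lambda>v. \<rho> v i) (chart p q) w) \<in> F (\<rho> (chart p q)))) \<and>
      (D p q \<noteq> 0 \<and> S p q \<noteq> 0 \<and> R p q \<noteq> 0) \<and> chart p q 0 \<noteq> 0"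
    then have r0: "\<rho> (chart p q) \<noteq> 0"
      and EF: "\<And>w. w \<in> tangent P1P1 (chart p q) \<Longrightarrow> w \<in> E (chart p q) \<longleftrightarrow>
        (\<lambda>i. dird 1 (\<lambda>v. \<rho> v i) (chart p q) w) \<in> F (\<rho> (chart p q))"
      and nz: "D p q \<noteq> 0" "S p q \<noteq> 0" "chart p q 0 \<noteq> 0" by blast+
    define k where "k = c ^ m * S p q / D p q"
    have k: "k \<noteq> 0" using c nz by (simp add: k_def)
    have phi_v: "\<phi> v = smul k (\<rho> (chart p q))"
      using nz by (simp add: k_def vc tuple_smul[of m \<phi>, OF phi_forms] phi_chart rho_chart)
    then have phi0: "\<phi> v \<noteq> 0" using k r0 by simp
    then have phi_M: "\<phi> v \<in> M" using rat_map_phi v unfolding rat_map_def vc by blast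
    show "?P (smul c (to_plane (chart p q)))"
      unfolding vc[symmetric]
    proof (intro conjI ballI phi0)
      fix w assume "w \<in> tangent (proj 2) v"
      then have w: "\<And>i. i > 2 \<Longrightarrow> w i = 0" using tangent_support by blast
      obtain a b \<mu> where
        der: "\<And>i. ((\<lambda>t. smul (c + t * \<mu>) (to_plane (chart (p + t * a) (q + t * b))) i)
          has_field_derivative w i) (at 0)"
        and pf: "w \<in> plane_field H4A H4B H4C (smul c (to_plane (chart p q))) \<longleftrightarrow>
          (p^2 - q^2) * a + 2 * (p * q - 1) * b = 0"
        by (rule plane_velocity[where w = w and q = q, OF c(2,1) w]) (assumption, rule that)
      define \<omega> where "\<omega> = chart_deriv p q a b"
      obtain PS PD where PS: "\<And>t. S (p + t * a) (q + t * b) = poly PS t"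
        and PD: "\<And>t. D (p + t * a) (q + t * b) = poly PD t"
        using bipoly_on_line[OF S] bipoly_on_line[OF D] by metis
      \<comment> \<open>The radial coefficient, found by differentiating
        \<open>D \<phi> = (c + t \<mu>) ^ m S \<rho>\<close> along the curve at
        \<open>t = 0\<close>. With \<open>D\<close> kept on the left, no quotient has to be
        differentiated.\<close>
      define s where "s = (c ^ m * poly (pderiv PS) 0 + of_nat m * c ^ (m - 1) * \<mu> * S p q
        - k * poly (pderiv PD) 0) / D p q"
      have "dird 1 (\<lambda>u. \<phi> u i) v w = s * \<rho> (chart p q) i + k * dird 1 (\<lambda>u. \<rho> u i) (chart p q) \<omega>" for i
      proof -
        define \<gamma> where "\<gamma> t = smul (c + t * \<mu>) (to_plane (chart (p + t * a) (q + t * b)))" for t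
        have g0: "\<gamma> 0 = v" by (simp add: \<gamma>_def vc)
        have 1: "((\<lambda>t. \<phi> (\<gamma> t) i) has_field_derivative dird 1 (\<lambda>u. \<phi> u i) v w) (at 0)"
          using dird_chain[OF form_polyfun[OF phi_forms[of i]], of \<gamma> w 0] der unfolding g0 by (simp add: \<gamma>_def)
        have 2: "((\<lambda>t. \<rho> (chart (p + t * a) (q + t * b)) i) has_field_derivative
            dird 1 (\<lambda>u. \<rho> u i) (chart p q) \<omega>) (at 0)"
          using dird_chain[OF form_polyfun[OF forms(4)[of i]] chart_has_derivative[where p = p and a = a and q = q and b = b]]
          by (simp add: \<omega>_def)
        have 3: "poly PD t * \<phi> (\<gamma> t) i = (c + t * \<mu>) ^ m * poly PS t * \<rho> (chart (p + t * a) (q + t * b)) i" for t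
          by (simp add: \<gamma>_def tuple_smul[of m \<phi>, OF phi_forms] phi_chart rho_chart PS PD)
        have z: "poly PD 0 = D p q" "poly PS 0 = S p q" using PS[of 0] PD[of 0] by simp_all
        have L: "((\<lambda>t. poly PD t * \<phi> (\<gamma> t) i) has_field_derivative
            poly (pderiv PD) 0 * \<phi> v i + dird 1 (\<lambda>u. \<phi> u i) v w * D p q) (at 0)"
          using DERIV_mult[OF poly_DERIV[of PD 0] 1] by (simp add: g0 z mult.commute)
        have R: "((\<lambda>t. (c + t * \<mu>) ^ m * poly PS t * \<rho> (chart (p + t * a) (q + t * b)) i) has_field_derivative
            (c ^ m * poly (pderiv PS) 0 + of_nat m * c ^ (m - 1) * \<mu> * S p q) * \<rho> (chart p q) i +
            c ^ m * S p q * dird 1 (\<lambda>u. \<rho> u i) (chart p q) \<omega>) (at 0)"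
          by (auto simp: z algebra_simps intro!: derivative_eq_intros 2)
        have "poly (pderiv PD) 0 * \<phi> v i + dird 1 (\<lambda>u. \<phi> u i) v w * D p q =
            (c ^ m * poly (pderiv PS) 0 + of_nat m * c ^ (m - 1) * \<mu> * S p q) * \<rho> (chart p q) i +
            c ^ m * S p q * dird 1 (\<lambda>u. \<rho> u i) (chart p q) \<omega>"
          using L R unfolding 3 by (rule DERIV_unique)
        then have "dird 1 (\<lambda>u. \<phi> u i) v w = ((c ^ m * poly (pderiv PS) 0 + of_nat m * c ^ (m - 1) * \<mu> * S p q
            - k * poly (pderiv PD) 0) * \<rho> (chart p q) i +
            c ^ m * S p q * dird 1 (\<lambda>u. \<rho> u i) (chart p q) \<omega>) / D p q"
          using nz by (simp add: phi_v field_simps)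
        then show ?thesis by (simp add: s_def k_def add_divide_distrib)
      qed
      then have "(\<lambda>i. dird 1 (\<lambda>u. \<phi> u i) v w) =
          smul s (\<rho> (chart p q)) + smul k (\<lambda>i. dird 1 (\<lambda>u. \<rho> u i) (chart p q) \<omega>)" by (simp add: fun_eq_iff)
      moreover have "smul s (\<rho> (chart p q)) + smul k (\<lambda>i. dird 1 (\<lambda>u. \<rho> u i) (chart p q) \<omega>) \<in> F (smul k (\<rho> (chart p q)))
          \<longleftrightarrow> (\<lambda>i. dird 1 (\<lambda>u. \<rho> u i) (chart p q) \<omega>) \<in> F (\<rho> (chart p q))"
        using phi_M rho_M[OF chart_P1P1 r0] by (intro foliation_shift[OF F M(2)] k) (simp_all add: phi_v)
      ultimately have "(\<lambda>i. dird 1 (\<lambda>u. \<phi> u i) v w) \<in> F (\<phi> v) \<longleftrightarrow> \<omega> \<in> E (chart p q)"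
        using EF[OF chart_deriv_tangent, of a b] by (simp add: phi_v \<omega>_def)
      also have "\<dots> \<longleftrightarrow> (p^2 - q^2) * a + 2 * (p * q - 1) * b = 0"
        unfolding \<omega>_def by (rule E4_chart[OF E nz(3)])
      finally show "w \<in> plane_field H4A H4B H4C v \<longleftrightarrow> (\<lambda>i. dird 1 (\<lambda>u. \<phi> u i) v w) \<in> F (\<phi> v)"
        using pf by (simp add: vc)
    qed
  qed
  then show ?thesis unfolding pulls_back_def generic_def by blast
qed

end

section \<open>The link\<close>

text \<open>The member \<open>X = infinity\<close> of the cycle; the other three lines are its
  translates under \<open>T4\<close>.\<close>

definition line0 :: "complex \<Rightarrow> complex \<Rightarrow> vec" where
  "line0 s t = vec4 0 s 0 t"

lemma bipoly_line0: "bipoly (\<lambda>s t. line0 s t i)"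
  unfolding line0_def using vec4_cases[of i] bipoly_basic(1)[of 0] bipoly_basic(2,3) by auto

lemma line0_Delta4:
  assumes "s \<noteq> 0 \<or> t \<noteq> 0"
  shows "line0 s t \<in> P1P1" "line0 s t \<in> Delta4"
proof -
  have e: "line0 s t = segre 0 1 s t" by (simp add: line0_def segre_vec4)
  show "line0 s t \<in> P1P1" unfolding e by (rule P1P1I[OF refl]) (use assms in auto)
  show "line0 s t \<in> Delta4" unfolding e Delta4_def
    by (intro CollectI exI[of _ 0] exI[of _ 1] exI[of _ s] exI[of _ t]) (use assms in auto)
qed

lemma Delta4_cases:
  assumes "v \<in> Delta4"
  obtains s t where "s \<noteq> 0 \<or> t \<noteq> 0"
    "v \<in> {line0 s t, T4 (line0 s t), T4 (T4 (line0 s t)), T4 (T4 (T4 (line0 s t)))}"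
proof -
  obtain a0 a1 b0 b1 where v: "v = segre a0 a1 b0 b1" and nz: "(a0, a1) \<noteq> (0, 0)" "(b0, b1) \<noteq> (0, 0)"
    and z: "a0 = 0 \<or> a1 = 0 \<or> b0 = 0 \<or> b1 = 0"
    using assms unfolding Delta4_def by blast
  from z show thesis
  proof (elim disjE)
    assume "a0 = 0"
    then show thesis by (intro that[of "a1 * b0" "a1 * b1"]) (use nz in \<open>auto simp: v segre_vec4 line0_def\<close>)
  next
    assume "b1 = 0"
    then show thesis by (intro that[of "b0 * a0" "b0 * a1"]) (use nz in \<open>auto simp: v segre_vec4 line0_def T4_vec4 mult.commute\<close>)
  next
    assume "a1 = 0"
    then show thesis by (intro that[of "a0 * b1" "a0 * b0"]) (use nz in \<open>auto simp: v segre_vec4 line0_def T4_vec4 mult.commute\<close>)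
  next
    assume "b0 = 0"
    then show thesis by (intro that[of "b1 * a1" "b1 * a0"]) (use nz in \<open>auto simp: v segre_vec4 line0_def T4_vec4 mult.commute\<close>)
  qed
qed

text \<open>Entries 0 and 2 of \<open>chart\<close> are sums of two squares that share the factor
  \<open>p - i q - (1 - i)\<close>.\<close>

lemma chart_line0:
  assumes "p - \<i> * q = 1 - \<i>"
  shows "chart p q = line0 (chart p q 1) (chart p q 3)"
proof -
  have "(p - 1)^2 + (q - 1)^2 = 0" "(p + \<i>)^2 + (q - \<i>)^2 = 0"
    using assms i_times_i by algebra+
  then show ?thesis unfolding line0_def by (subst eq_commute) (simp add: vec4_eq_iff chart_def)
qed

text \<open>This parametrizes the nodal cubic; the node has the two parameters \<open>k = m\<close> and \<open>k = - m\<close>.\<close>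

lemma to_plane_line0:
  assumes "m = t - s" "k = s + t"
  shows "to_plane (line0 s t) = vec4 (m^3) (m * (m^2 - k^2) / 2) ((m^2 - k^2) * (m - \<i> * k) / 2) 0"
proof -
  have s: "s = (k - m) / 2" and t: "t = (k + m) / 2" using assms by (simp_all add: field_simps)
  have e: "evm (line0 s t) = m" "ev1 (line0 s t) = k" "evi (line0 s t) = (k + m) / 2 + \<i> * ((k - m) / 2)"
    "evmi (line0 s t) = (k + m) / 2 - \<i> * ((k - m) / 2)"
    by (simp_all add: evm_def ev1_def evi_def evmi_def line0_def s t field_simps)
  have "2 * (m^3 - m * (((k + m) / 2 + \<i> * ((k - m) / 2)) * ((k + m) / 2 - \<i> * ((k - m) / 2)))) =
      m * (m^2 - k^2)"
    by (simp add: field_simps power2_eq_square power3_eq_cube)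
  moreover have "2 * (2 * m^3 - 3 * (m * (((k + m) / 2 + \<i> * ((k - m) / 2)) * ((k + m) / 2 - \<i> * ((k - m) / 2))))
      + k * ((k + m) / 2 + \<i> * ((k - m) / 2))^2) = (m^2 - k^2) * (m - \<i> * k)"
    by (simp add: field_simps power2_eq_square power3_eq_cube)
  ultimately show ?thesis unfolding to_plane_def e vec4_eq_iff by (simp add: field_simps)
qed

lemma to_plane_line0_cubic:
  assumes "s \<noteq> 0 \<or> t \<noteq> 0"
  shows "to_plane (line0 s t) \<in> curve H4_cubic"
proof -
  define m k where "m = t - s" and "k = s + t"
  have mk: "m \<noteq> 0 \<or> k \<noteq> 0"
  proof (rule ccontr)
    assume "\<not> ?thesis"
    then have "2 * s = 0" "2 * t = 0" unfolding m_def k_def by (auto simp: algebra_simps)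
    then show False using assms by simp
  qed
  have "to_plane (line0 s t) \<in> proj 2"
    unfolding to_plane_line0[OF m_def k_def] vec4_proj2 using mk by (cases "m = 0") auto
  moreover have "H4_cubic (m^3) (m * (m^2 - k^2) / 2) ((m^2 - k^2) * (m - \<i> * k) / 2) = 0"
  proof -
    have "4 * H4_cubic (m^3) (m * (m^2 - k^2) / 2) ((m^2 - k^2) * (m - \<i> * k) / 2) = 0"
      unfolding H4_cubic_def by (simp add: field_simps) (use i_times_i in algebra)
    then show ?thesis by simp
  qed
  ultimately show ?thesis
    by (simp add: curve_def on3_def to_plane_line0[OF m_def k_def])
qed

text \<open>Projection from the node \<open>(1 : 0 : 0)\<close>: the slope \<open>r = z / y\<close>
  determines the point, and \<open>k = i (r - 1)\<close> solves \<open>1 - i k = r\<close> with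
  \<open>m = 1\<close>. The point on \<open>x = 0\<close> and the node itself are treated
  separately.\<close>

lemma cubic_parametrization:
  assumes "v \<in> curve H4_cubic"
  obtains s t c where "s \<noteq> 0 \<or> t \<noteq> 0" "c \<noteq> 0" "v = smul c (to_plane (line0 s t))"
proof -
  have v: "v \<noteq> 0" "\<And>i. i > 2 \<Longrightarrow> v i = 0" and
    eq: "2 * v 1 ^ 3 - 2 * v 0 * v 1 ^ 2 + 2 * v 0 * v 1 * v 2 - v 0 * v 2 ^ 2 = 0"
    using assms by (auto simp: curve_def on3_def H4_cubic_def proj_def)
  have ve: "vec4 (v 0) (v 1) (v 2) 0 = v" using v(2) by (simp add: vec4_eq_iff)
  note main = that
  have fin: thesis if mk: "m \<noteq> 0 \<or> k \<noteq> 0" and c: "c \<noteq> 0" and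
    vs: "v 0 = c * m^3" "v 1 = c * (m * (m^2 - k^2) / 2)" "v 2 = c * ((m^2 - k^2) * (m - \<i> * k) / 2)" for m k c
  proof (rule main[of "(k - m) / 2" "(k + m) / 2" c])
    show "(k - m) / 2 \<noteq> 0 \<or> (k + m) / 2 \<noteq> 0"
    proof (rule ccontr)
      assume "\<not> ?thesis"
      then have "k - m = 0" "k + m = 0" by auto
      then have "2 * k = 0" "2 * m = 0" by algebra+
      then show False using mk by simp
    qed
    have e: "m = (k + m) / 2 - (k - m) / 2" "k = (k - m) / 2 + (k + m) / 2" by (simp_all add: field_simps)
    show "v = smul c (to_plane (line0 ((k - m) / 2) ((k + m) / 2)))"
      unfolding to_plane_line0[OF e] smul_vec4 vs[symmetric] using ve by simp
  qed (rule c)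
  show thesis
  proof (cases "v 0 = 0")
    case True
    then have z: "v 1 = 0" "v (Suc 0) = 0" using eq by simp_all
    then have "v 2 \<noteq> 0" using True ve v(1) by auto
    moreover have "\<i> * (x * \<i>) = - x" for x using i_times_i by algebra
    \<comment> \<open>The parameters \<open>m = 0\<close>, \<open>k = 1\<close> give
      \<open>(0, 0, i / 2)\<close>, hence the scaling factor.\<close>
    ultimately show thesis
      by (intro fin[of 0 1 "v 2 / (\<i> / 2)"]) (simp_all add: True z)
  next
    case False
    show thesis
    proof (cases "v 1 = 0")
      case True
      then have z: "v 1 = 0" "v (Suc 0) = 0" "v 2 = 0" using eq False by simp_all
      then show thesis by (intro fin[of 1 1 "v 0"]) (simp_all add: False)
    next
      case v1: False
      define r where "r = v 2 / v 1"
      have v2: "v 2 = r * v 1" using v1 by (simp add: r_def)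
      have "v 1 ^ 2 * (2 * v 1) = v 1 ^ 2 * (v 0 * (2 - 2 * r + r^2))"
        using eq unfolding v2 by algebra
      then have h: "2 * v 1 = v 0 * (2 - 2 * r + r^2)" using v1 by simp
      define k where "k = \<i> * (r - 1)"
      have k2: "k^2 = - ((r - 1)^2)" unfolding k_def using i_times_i by algebra
      have ik: "1 - \<i> * k = r" unfolding k_def using i_times_i by algebra
      have h': "2 * v 1 = v 0 * (1 - k^2)" unfolding k2 using h by algebra
      show thesis
      proof (rule fin[of 1 k "v 0"])
        show v1': "v 1 = v 0 * (1 * (1\<^sup>2 - k\<^sup>2) / 2)" using h' by (simp add: field_simps)
        have "2 * (r * v 1) = v 0 * ((1 - k^2) * r)" using h' by algebra
        then have "r * v 1 = v 0 * ((1 - k^2) * r) / 2" by (simp add: field_simps)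
        then show "v 2 = v 0 * ((1\<^sup>2 - k\<^sup>2) * (1 - \<i> * k) / 2)" unfolding ik v2 by simp
      qed (use False in simp_all)
    qed
  qed
qed

lemma zclosure_cong:
  assumes "\<And>A. proj_closed A \<Longrightarrow> S \<subseteq> A \<longleftrightarrow> T \<subseteq> A"
  shows "zclosure S = zclosure T"
  unfolding zclosure_def using assms by (metis (no_types, lifting))

context santos_plane
begin

text \<open>Composition with \<open>T4\<close> turns representatives of \<open>\<rho>\<close> into
  representatives of \<open>\<rho>\<close>, by invariance. All lines of the cycle thus have the same
  image, and one line suffices.\<close>

lemma rgraph_T4:
  assumes "(T4 u, w) \<in> rgraph P1P1 M \<rho>" "u \<in> P1P1"
  shows "(u, w) \<in> rgraph P1P1 M \<rho>"
proof -
  obtain \<psi>' c where p: "rat_map P1P1 M \<psi>'" "same_map P1P1 \<rho> \<psi>'" "\<psi>' (T4 u) \<noteq> 0" "c \<noteq> 0" "w = smul c (\<psi>' (T4 u))"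
    using assms(1) unfolding rgraph_def by blast
  obtain d where d: "\<And>i. form d (\<lambda>v. \<psi>' v i)" using rat_mapE[OF p(1)] by blast
  have f: "form d (\<lambda>v. \<psi>' (T4 v) i)" for i using form_T4[OF d] .
  have r: "rat_map P1P1 M (\<lambda>v. \<psi>' (T4 v))"
    unfolding rat_map_def
  proof (intro conjI ballI impI)
    show "\<exists>d. \<forall>i. form d (\<lambda>v. \<psi>' (T4 v) i)" using f by blast
    show "\<exists>v\<in>P1P1. \<psi>' (T4 v) \<noteq> 0" using assms(2) p(3) by blast
    show "\<psi>' (T4 v) \<in> M" if "v \<in> P1P1" "\<psi>' (T4 v) \<noteq> 0" for v
      using p(1) T4_P1P1[OF that(1)] that(2) unfolding rat_map_def by blast
  qed
  have "parallel (\<rho> v) (\<psi>' (T4 v))" if "v \<in> P1P1" for v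
  proof (rule generic_parallel[OF form_domain_P1P1 _ forms(4) f that])
    show "generic P1P1 (\<lambda>v. parallel (\<rho> v) (\<psi>' (T4 v)))"
      using generic_T4[OF generic_rho]
    proof (rule generic_mono)
      fix v assume v: "v \<in> P1P1" "\<rho> (T4 v) \<noteq> 0"
      have "parallel (\<rho> (T4 v)) (\<psi>' (T4 v))" using p(2) T4_P1P1[OF v(1)] unfolding same_map_parallel by blast
      then show "parallel (\<rho> v) (\<psi>' (T4 v))" using parallel_trans parallel_sym rho_T4[OF v(1)] v(2) by blast
    qed
  qed
  then have "same_map P1P1 \<rho> (\<lambda>v. \<psi>' (T4 v))"
    unfolding same_map_parallel using generic_ex[OF generic_rho] assms(2) p(3) by blast
  then show ?thesis unfolding rgraph_def using r p(3-5) assms(2) by blast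
qed

text \<open>\<open>rgraph\<close> admits a different representative at every point, so the relation
  between \<open>\<phi> \<circ> to_plane\<close> and \<open>\<rho>\<close> is needed for arbitrary
  representatives of both.\<close>

lemma parallel_reps:
  assumes r: "rat_map P1P1 M \<rho>'" "same_map P1P1 \<rho> \<rho>'"
    and p: "rat_map (proj 2) M \<phi>'" "same_map (proj 2) \<phi> \<phi>'" and u: "u \<in> P1P1"
  shows "parallel (\<phi>' (to_plane u)) (\<rho>' u)"
proof -
  obtain d where d: "\<And>i. form d (\<lambda>v. \<rho>' v i)" using rat_mapE[OF r(1)] by blast
  obtain d' where d': "\<And>i. form d' (\<lambda>v. \<phi>' v i)" using rat_mapE[OF p(1)] by blast
  show ?thesis
  proof (rule generic_parallel[OF form_domain_P1P1 _ form_compose[OF d' form_to_plane] d u])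
    show "generic P1P1 (\<lambda>v. parallel (\<phi>' (to_plane v)) (\<rho>' v))"
      using generic_conj[OF form_domain_P1P1 phi_to_plane generic_to_plane]
    proof (rule generic_mono)
      fix v assume v: "v \<in> P1P1" and *: "(\<rho> v \<noteq> 0 \<and> (\<exists>a. a \<noteq> 0 \<and> \<phi> (to_plane v) = smul a (\<rho> v))) \<and>
        to_plane v \<noteq> 0 \<and> evm v \<noteq> 0"
      then obtain a where a: "a \<noteq> 0" "\<phi> (to_plane v) = smul a (\<rho> v)" by blast
      have "to_plane v \<in> proj 2" using * by (simp add: to_plane_def vec4_proj2)
      then have "parallel (\<phi>' (to_plane v)) (smul a (\<rho> v))"
        using p(2) a(2) parallel_sym unfolding same_map_parallel by metis
      moreover have "parallel (smul a (\<rho> v)) (\<rho>' v)"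
        using r(2) v parallel_smul[of "\<rho> v" "\<rho>' v" a 1] unfolding same_map_parallel by simp
      ultimately show "parallel (\<phi>' (to_plane v)) (\<rho>' v)"
        using parallel_trans a(1) * by (metis smul_eq_0_iff)
    qed
  qed
qed

text \<open>The given tuple may vanish along the whole line. The reduced tuple \<open>R\<close>,
  homogenized by \<open>evm\<close>, represents the same map and is nonzero at
  \<open>(p0, q0)\<close>, a point of that line.\<close>

lemma good_representative:
  obtains \<rho>' where "rat_map P1P1 M \<rho>'" "same_map P1P1 \<rho> \<rho>'" "genp (\<lambda>s t. \<rho>' (line0 s t) \<noteq> 0)"
proof -
  obtain k \<rho>' where f: "\<And>i. form k (\<lambda>v. \<rho>' v i)" and "\<And>w. evm w \<noteq> 0 \<Longrightarrow>
      \<rho>' w = smul (evm w ^ k) (R (evi w / evm w ^ 1) (evmi w / evm w ^ 1))"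
    using homogenize_tuple[where H = R, OF R R_support form_ev(2,3,4)] by blast
  then have c: "\<rho>' (chart p q) = smul (8 ^ k) (R p q)" for p q by (simp add: ev_chart)
  have gen: "generic P1P1 (\<lambda>u. \<rho> u \<noteq> 0 \<and> (\<exists>a. a \<noteq> 0 \<and> \<rho>' u = smul a (\<rho> u)))"
  proof (rule generic_P1P1I[OF genp_DSR])
    fix p q b :: complex assume *: "b \<noteq> 0" "D p q \<noteq> 0 \<and> S p q \<noteq> 0 \<and> R p q \<noteq> 0"
    define u where u: "u = smul b (chart p q)"
    have r: "\<rho> u = smul (b ^ dr * D p q) (R p q)" by (simp add: u smuls rho_chart)
    moreover have "\<rho>' u = smul (b ^ k * 8 ^ k) (R p q)" by (simp add: u tuple_smul[of k \<rho>', OF f] c)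
    ultimately have "\<rho>' u = smul (b ^ k * 8 ^ k / (b ^ dr * D p q)) (\<rho> u)" using * by simp
    moreover have "b ^ k * 8 ^ k / (b ^ dr * D p q) \<noteq> 0" using * by simp
    moreover have "\<rho> u \<noteq> 0" using r * by simp
    ultimately show "\<rho> (smul b (chart p q)) \<noteq> 0 \<and>
        (\<exists>a. a \<noteq> 0 \<and> \<rho>' (smul b (chart p q)) = smul a (\<rho> (smul b (chart p q))))" unfolding u by blast
  qed
  have nz: "\<rho>' (chart p0 q0) \<noteq> 0" using base by (simp add: c)
  have "rat_map P1P1 M \<rho>'"
  proof (rule rat_map_generic[OF form_domain_P1P1 M(3) f chart_P1P1 nz])
    show "generic P1P1 (\<lambda>v. \<exists>a y. y \<in> M \<and> \<rho>' v = smul a y)"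
      using gen by (rule generic_mono) (use rho_M in blast)
  qed
  moreover have "same_map P1P1 \<rho> \<rho>'"
    unfolding same_map_parallel
  proof (intro conjI ballI)
    show "\<exists>v\<in>P1P1. \<rho> v \<noteq> 0" by (rule generic_ex[OF generic_rho])
    show "\<exists>v\<in>P1P1. \<rho>' v \<noteq> 0" using nz chart_P1P1 by blast
    show "parallel (\<rho> v) (\<rho>' v)" if "v \<in> P1P1" for v
    proof (rule generic_parallel[OF form_domain_P1P1 _ forms(4) f that])
      show "generic P1P1 (\<lambda>v. parallel (\<rho> v) (\<rho>' v))"
        using gen by (rule generic_mono) (metis parallel_refl smul_simps(2))
    qed
  qed
  moreover have "genp (\<lambda>s t. \<rho>' (line0 s t) \<noteq> 0)"
  proof (rule genp_tuple)
    show "bipoly (\<lambda>s t. \<rho>' (line0 s t) i)" for i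
      by (rule bipoly_polyfun[OF form_polyfun[OF f] bipoly_line0])
    show "\<rho>' (line0 (chart p0 q0 1) (chart p0 q0 3)) \<noteq> 0"
      using nz chart_line0[OF base(1)] by simp
  qed
  ultimately show thesis by (rule that)
qed

text \<open>A closed set that contains the general values of a polynomial family contains its
  nonzero special values. The factor \<open>a\<close> may be zero, so the family may vanish at some
  general parameters.\<close>

lemma line0_closed:
  assumes A: "proj_closed A" and \<alpha>: "\<And>i. bipoly (\<lambda>s t. \<alpha> s t i)"
    and gen: "genp (\<lambda>s t. \<exists>a y. y \<in> A \<and> \<alpha> s t = smul a y)" and w: "w = smul c (\<alpha> s t)" "w \<noteq> 0"
  shows "w \<in> A"
proof -
  obtain C k where C: "\<And>f. f \<in> C \<Longrightarrow> \<exists>d. form d f" "\<And>v. v \<in> A \<longleftrightarrow> v \<noteq> 0 \<and> (\<forall>f\<in>C. f v = 0)"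
    using proj_closed_forms[OF A] by metis
  have "f w = 0" if f: "f \<in> C" for f
  proof -
    obtain d where d: "form d f" using C(1)[OF f] by blast
    have "genp (\<lambda>s t. f (\<alpha> s t) = 0)"
      using gen by (rule genp_mono) (use C(2) f in \<open>auto simp: form_smul[OF d]\<close>)
    from genp_vanish[where F = "\<lambda>s t. f (\<alpha> s t)", OF this bipoly_polyfun[OF form_polyfun[OF d] \<alpha>]]
    show ?thesis by (simp add: w(1) form_smul[OF d])
  qed
  then show ?thesis using C(2) w(2) by blast
qed

text \<open>Two closures agree if the same closed sets contain both generating sets. In each
  direction the representative belonging to a graph point is followed along the whole curve,
  compared at general parameters with a representative of the other map that does not vanish
  identically there, and specialized by closedness.\<close>

lemma strict_transform_cubic:
  "strict_transform (proj 2) M \<phi> (curve H4_cubic) = strict_transform P1P1 M \<rho> Delta4"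
  unfolding strict_transform_def
proof (rule zclosure_cong)
  fix A assume A: "proj_closed A"
  have st: "genp (\<lambda>s t. s \<noteq> 0)" by (rule genp_bipoly[OF bipoly_basic(2), of 1]) simp
  have phi_self: "same_map (proj 2) \<phi> \<phi>"
    using rat_map_phi unfolding same_map_def rat_map_def by auto
  show "rgraph (proj 2) M \<phi> `` curve H4_cubic \<subseteq> A \<longleftrightarrow> rgraph P1P1 M \<rho> `` Delta4 \<subseteq> A"
  proof (intro iffI subsetI)
    assume sub: "rgraph P1P1 M \<rho> `` Delta4 \<subseteq> A"
    obtain \<rho>' where r: "rat_map P1P1 M \<rho>'" "same_map P1P1 \<rho> \<rho>'" "genp (\<lambda>s t. \<rho>' (line0 s t) \<noteq> 0)"
      by (rule good_representative)
    fix w assume "w \<in> rgraph (proj 2) M \<phi> `` curve H4_cubic"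
    then obtain v \<phi>' c where v: "v \<in> curve H4_cubic" and p: "rat_map (proj 2) M \<phi>'" "same_map (proj 2) \<phi> \<phi>'"
      and w: "\<phi>' v \<noteq> 0" "c \<noteq> 0" "w = smul c (\<phi>' v)"
      unfolding rgraph_def by blast
    obtain s t b where v': "v = smul b (to_plane (line0 s t))" using cubic_parametrization[OF v] by blast
    obtain d where d: "\<And>i. form d (\<lambda>v. \<phi>' v i)" using rat_mapE[OF p(1)] by blast
    show "w \<in> A"
    proof (rule line0_closed[OF A, where \<alpha> = "\<lambda>s t. \<phi>' (to_plane (line0 s t))"])
      show "bipoly (\<lambda>s t. \<phi>' (to_plane (line0 s t)) i)" for i
        by (rule bipoly_polyfun[OF form_polyfun[OF form_compose[OF d form_to_plane]] bipoly_line0])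
      show "genp (\<lambda>s t. \<exists>a y. y \<in> A \<and> \<phi>' (to_plane (line0 s t)) = smul a y)"
        using genp_conj[OF st r(3)]
      proof (rule genp_mono)
        fix s t assume *: "s \<noteq> 0 \<and> \<rho>' (line0 s t) \<noteq> 0"
        then have l: "line0 s t \<in> P1P1" "line0 s t \<in> Delta4" using line0_Delta4 by auto
        have "(line0 s t, \<rho>' (line0 s t)) \<in> rgraph P1P1 M \<rho>"
          by (rule rgraphI[OF l(1) r(1,2)]) (use * in simp)
        moreover obtain a where "\<phi>' (to_plane (line0 s t)) = smul a (\<rho>' (line0 s t))"
          using parallelE[OF parallel_sym[OF parallel_reps[OF r(1,2) p l(1)]]] * by blast
        ultimately show "\<exists>a y. y \<in> A \<and> \<phi>' (to_plane (line0 s t)) = smul a y" using l(2) sub by blast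
      qed
      show "w = smul (c * b ^ d) (\<phi>' (to_plane (line0 s t)))"
        by (simp add: w(3) v' tuple_smul[of d \<phi>', OF d])
    qed (use w in simp)
  next
    assume sub: "rgraph (proj 2) M \<phi> `` curve H4_cubic \<subseteq> A"
    have gphi: "genp (\<lambda>s t. \<phi> (to_plane (line0 s t)) \<noteq> 0)"
    proof (rule genp_tuple)
      show "bipoly (\<lambda>s t. \<phi> (to_plane (line0 s t)) i)" for i
        by (rule bipoly_polyfun[OF form_polyfun[OF form_compose[OF phi_forms form_to_plane]] bipoly_line0])
      show "\<phi> (to_plane (line0 (chart p0 q0 1) (chart p0 q0 3))) \<noteq> 0"
        using base chart_line0[OF base(1)] phi_chart[of p0 q0] by simp
    qed
    fix w assume "w \<in> rgraph P1P1 M \<rho> `` Delta4"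
    then obtain v where v: "v \<in> Delta4" "(v, w) \<in> rgraph P1P1 M \<rho>" by blast
    obtain s t where st': "s \<noteq> 0 \<or> t \<noteq> 0"
      "v \<in> {line0 s t, T4 (line0 s t), T4 (T4 (line0 s t)), T4 (T4 (T4 (line0 s t)))}"
      using Delta4_cases[OF v(1)] by blast
    have "(line0 s t, w) \<in> rgraph P1P1 M \<rho>"
      using st'(2) v(2) rgraph_T4 line0_Delta4(1)[OF st'(1)] T4_P1P1 by blast
    then obtain \<rho>' c where r: "rat_map P1P1 M \<rho>'" "same_map P1P1 \<rho> \<rho>'"
      and w: "\<rho>' (line0 s t) \<noteq> 0" "c \<noteq> 0" "w = smul c (\<rho>' (line0 s t))"
      unfolding rgraph_def by blast
    obtain d where d: "\<And>i. form d (\<lambda>v. \<rho>' v i)" using rat_mapE[OF r(1)] by blast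
    show "w \<in> A"
    proof (rule line0_closed[where \<alpha> = "\<lambda>s t. \<rho>' (line0 s t)", OF A _ _ w(3)])
      show "bipoly (\<lambda>s t. \<rho>' (line0 s t) i)" for i
        by (rule bipoly_polyfun[OF form_polyfun[OF d] bipoly_line0])
      show "genp (\<lambda>s t. \<exists>a y. y \<in> A \<and> \<rho>' (line0 s t) = smul a y)"
        using genp_conj[OF st gphi]
      proof (rule genp_mono)
        fix s t assume *: "s \<noteq> 0 \<and> \<phi> (to_plane (line0 s t)) \<noteq> 0"
        then have l: "line0 s t \<in> P1P1" "to_plane (line0 s t) \<in> curve H4_cubic"
          using line0_Delta4 to_plane_line0_cubic by auto
        have "(to_plane (line0 s t), \<phi> (to_plane (line0 s t))) \<in> rgraph (proj 2) M \<phi>"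
          by (rule rgraphI[OF _ rat_map_phi phi_self]) (use * l(2) in \<open>simp_all add: curve_def\<close>)
        moreover obtain a where "\<rho>' (line0 s t) = smul a (\<phi> (to_plane (line0 s t)))"
          using parallelE[OF parallel_reps[OF r rat_map_phi phi_self l(1)]] * by blast
        ultimately show "\<exists>a y. y \<in> A \<and> \<rho>' (line0 s t) = smul a y" using l(2) sub by blast
      qed
    qed (use w in simp)
  qed
qed

end

lemma santos_F4_plane_model:
  assumes "santos_F4 M F L"
  shows "\<exists>\<phi>. birational (proj 2) M \<phi> \<and> pulls_back (proj 2) \<phi> F (plane_field H4A H4B H4C) \<and>
    strict_transform (proj 2) M \<phi> (curve H4_cubic) = L"
proof -
  obtain Q q \<pi> \<rho> E where quot: "cyclic_quotient P1P1 T4 Q q" and min: "minimal_desingularization Q M \<pi>"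
    and \<rho>: "rat_map P1P1 M \<rho>" "same_map P1P1 (\<pi> \<circ> \<rho>) q" and E: "is_E4 E" and F: "foliation_on M F"
    and pb: "pulls_back P1P1 \<rho> F E" and L: "L = strict_transform P1P1 M \<rho> Delta4"
    using assms unfolding santos_F4_def by blast
  have var: "proj_variety M" "proj_variety Q" and bir: "birational M Q \<pi>"
    using min quot unfolding minimal_desingularization_def desingularization_def smooth_surface_def
      cyclic_quotient_def by blast+
  obtain \<sigma> where \<sigma>: "rat_map Q M \<sigma>" "same_map M (\<sigma> \<circ> \<pi>) id" and \<pi>: "rat_map M Q \<pi>"
    using bir unfolding birational_def by blast
  have cl: "proj_closed M" using var(1) unfolding proj_variety_def by blast
  obtain n where n: "M \<subseteq> proj n" by (rule proj_closed_forms[OF cl]) (rule that)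
  have q: "rat_map P1P1 Q q" "same_map P1P1 (q \<circ> T4) q" "Q \<subseteq> Range (rgraph P1P1 Q q)"
    using quot unfolding cyclic_quotient_def morphism_def by blast+
  have univ: "\<exists>g. morphism Q Y g \<and> same_map P1P1 (g \<circ> q) f"
    if "proj_variety Y" "morphism P1P1 Y f" "same_map P1P1 (f \<circ> T4) f" for Y f
    using quot that unfolding cyclic_quotient_def by blast
  obtain dq where dq: "\<And>i. form dq (\<lambda>v. q v i)" using rat_mapE[OF q(1)] by blast
  obtain dp where dp: "\<And>i. form dp (\<lambda>v. \<pi> v i)" using rat_mapE[OF \<pi>] by blast
  obtain ds where ds: "\<And>i. form ds (\<lambda>v. \<sigma> v i)" using rat_mapE[OF \<sigma>(1)] by blast
  obtain dr where dr: "\<And>i. form dr (\<lambda>v. \<rho> v i)" using rat_mapE[OF \<rho>(1)] by blast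
  interpret santos_model M Q q \<pi> \<sigma> \<rho> dq dp ds dr n
    by unfold_locales (fact proj_variety_form_domain[OF var(1)] n cl proj_variety_form_domain[OF var(2)]
        dq dp ds dr q(1) \<pi> \<sigma>(1) \<rho>(1) q(2) q(3) univ \<sigma>(2) \<rho>(2))+
  obtain \<psi> e where \<psi>: "\<And>i. form e (\<lambda>v. \<psi> v i)" "\<And>v i. i > 2 \<Longrightarrow> \<psi> v i = 0"
    "generic P1P1 (\<lambda>u. \<rho> u \<noteq> 0 \<and> to_plane u \<noteq> 0 \<and> (\<exists>c. c \<noteq> 0 \<and> \<psi> (\<rho> u) = smul c (to_plane u)))"
    using plane_inverse by blast
  obtain \<phi> m R D S p0 q0 p1 q1 where \<phi>: "\<forall>i. form m (\<lambda>v. \<phi> v i)" "\<forall>i. bipoly (\<lambda>p q. R p q i)"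
    "\<forall>p q. \<rho> (chart p q) = smul (D p q) (R p q)"
    "\<forall>p q. \<phi> (to_plane (chart p q)) = smul (S p q) (R p q)"
    "bipoly D" "bipoly S" "p0 - \<i> * q0 = 1 - \<i>" "S p0 q0 \<noteq> 0" "R p0 q0 \<noteq> 0"
    "\<forall>p q. \<forall>i>n. R p q i = 0" "D p1 q1 \<noteq> 0"
    using plane_parametrization by (elim exE conjE) (rule that)
  interpret santos_plane M Q q \<pi> \<sigma> \<rho> dq dp ds dr n \<phi> \<psi> R D S p0 q0 m e
    using \<phi> \<psi> by unfold_locales blast+
  show ?thesis
    using birational_phi pulls_back_phi[OF E F pb] strict_transform_cubic L by blast
qed

section \<open>The plane curves\<close>

text \<open>Derivatives along a line are read off from the Taylor coefficients; concrete forms need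
  only be expanded once.\<close>

lemma dird_poly:
  assumes "\<And>t. f (v + smul t w) = poly P t"
  shows "dird k f v w = fact k * coeff P k"
proof -
  have "(deriv ^^ k) (poly P) = poly ((pderiv ^^ k) P)"
  proof (induction k)
    case (Suc k)
    have "deriv (poly p) = poly (pderiv p)" for p :: "complex poly"
      by (rule ext) (rule DERIV_imp_deriv[OF poly_DERIV])
    then show ?case using Suc by simp
  qed simp
  moreover have "(\<lambda>t. f (v + smul t w)) = poly P" using assms by auto
  ultimately have "dird k f v w = coeff ((pderiv ^^ k) P) 0"
    by (simp add: dird_def poly_0_coeff_0)
  also have "\<dots> = fact k * coeff P k"
    by (simp add: coeff_higher_pderiv pochhammer_fact)
  finally show ?thesis .
qed

lemma form_on3I:
  assumes "polyfun (on3 G)" "\<And>c x y z. G (c * x) (c * y) (c * z) = c ^ d * G x y z"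
  shows "form d (on3 G)"
  using assms by (simp add: form_def on3_def)

lemma polyfun_on3: "polyfun (on3 G) \<Longrightarrow> polyfun a \<Longrightarrow> polyfun b \<Longrightarrow> polyfun c \<Longrightarrow>
    polyfun (\<lambda>v. G (a v) (b v) (c v))"
  using polyfun_compose[of "on3 G" "\<lambda>v. vec4 (a v) (b v) (c v) 0"]
  by (simp add: on3_def polyfun_vec4 polyfun.const)

lemma form_H4: "form 3 (on3 H4A)" "form 3 (on3 H4B)" "form 3 (on3 H4C)" "form 3 (on3 H4_cubic)"
  "form 2 (on3 H4_conic)" "form 1 (on3 H4_line)"
proof -
  show "form 3 (on3 H4A)"
    by (rule form_on3I, unfold on3_def H4A_def, intro polyfun_rules, algebra)
  show "form 3 (on3 H4B)"
    by (rule form_on3I, unfold on3_def H4B_def, intro polyfun_rules, algebra)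
  show "form 3 (on3 H4C)"
    by (rule form_on3I, unfold on3_def H4C_def, intro polyfun_rules, algebra)
  show "form 3 (on3 H4_cubic)"
    by (rule form_on3I, unfold on3_def H4_cubic_def, intro polyfun_rules, algebra)
  show "form 2 (on3 H4_conic)"
    by (rule form_on3I, unfold on3_def H4_conic_def, intro polyfun_rules, algebra)
  show "form 1 (on3 H4_line)"
    by (rule form_on3I, unfold on3_def H4_line_def, intro polyfun_rules, simp)
qed

lemma dird_cubic:
  "dird 1 (on3 H4_cubic) v w = w 0 * (- 2 * v 1 ^ 2 + 2 * v 1 * v 2 - v 2 ^ 2) +
     w 1 * (6 * v 1 ^ 2 - 4 * v 0 * v 1 + 2 * v 0 * v 2) + w 2 * (2 * v 0 * v 1 - 2 * v 0 * v 2)" (is ?one)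
  "dird 2 (on3 H4_cubic) v w = 2 * (6 * v 1 * w 1 ^ 2 - 2 * (v 0 * w 1 ^ 2 + 2 * w 0 * v 1 * w 1) +
     2 * (w 0 * w 1 * v 2 + w 0 * v 1 * w 2 + v 0 * w 1 * w 2) - (v 0 * w 2 ^ 2 + 2 * w 0 * v 2 * w 2))" (is ?two)
proof -
  define P where "P = [: H4_cubic (v 0) (v 1) (v 2), w 0 * (- 2 * v 1 ^ 2 + 2 * v 1 * v 2 - v 2 ^ 2) +
     w 1 * (6 * v 1 ^ 2 - 4 * v 0 * v 1 + 2 * v 0 * v 2) + w 2 * (2 * v 0 * v 1 - 2 * v 0 * v 2),
     6 * v 1 * w 1 ^ 2 - 2 * (v 0 * w 1 ^ 2 + 2 * w 0 * v 1 * w 1) +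
     2 * (w 0 * w 1 * v 2 + w 0 * v 1 * w 2 + v 0 * w 1 * w 2) - (v 0 * w 2 ^ 2 + 2 * w 0 * v 2 * w 2),
     H4_cubic (w 0) (w 1) (w 2) :]"
  have P: "on3 H4_cubic (v + smul t w) = poly P t" for t
    unfolding on3_def H4_cubic_def P_def plus_fun_apply smul_apply poly_pCons poly_0 by algebra
  show ?one unfolding dird_poly[OF P] by (simp add: P_def)
  show ?two unfolding dird_poly[OF P] by (simp add: P_def numeral_2_eq_2)
qed

lemma dird_conic:
  "dird 1 (on3 H4_conic) v w = w 0 * (4 * v 1 - 2 * v 2 - 2 * v 0) + w 1 * (2 * v 1 + 4 * v 0) + w 2 * (- 2 * v 0)"
proof -
  define P where "P = [: H4_conic (v 0) (v 1) (v 2),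
     w 0 * (4 * v 1 - 2 * v 2 - 2 * v 0) + w 1 * (2 * v 1 + 4 * v 0) + w 2 * (- 2 * v 0),
     H4_conic (w 0) (w 1) (w 2) :]"
  have P: "on3 H4_conic (v + smul t w) = poly P t" for t
    unfolding on3_def H4_conic_def P_def plus_fun_apply smul_apply poly_pCons poly_0 by algebra
  show ?thesis unfolding dird_poly[OF P] by (simp add: P_def)
qed

lemma dird_line: "dird 1 (on3 H4_line) v w = w 0"
  using dird_coord[of 0 v w] by (simp add: on3_def[abs_def] H4_line_def)

lemma curve_D: "v \<in> curve G \<Longrightarrow> v \<noteq> 0 \<and> (\<forall>i>2. v i = 0) \<and> G (v 0) (v 1) (v 2) = 0"
  by (simp add: curve_def proj_def on3_def)

lemma vec4_curve: "vec4 x y z 0 \<in> curve G \<longleftrightarrow> (x, y, z) \<noteq> (0, 0, 0) \<and> G x y z = 0"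
  by (simp add: curve_def on3_def vec4_proj2)

lemma vec3_eta: "\<forall>i>2. v i = 0 \<Longrightarrow> vec4 (v 0) (v 1) (v 2) 0 = v"
  by (simp add: vec4_eq_iff)

lemma cubic_singular:
  assumes "sing_pt H4_cubic u"
  shows "u = smul (u 0) (vec4 1 0 0 0)"
proof -
  have u: "\<forall>i>2. u i = 0" and d: "\<And>w. dird 1 (on3 H4_cubic) u w = 0"
    using assms curve_D unfolding sing_pt_def by blast+
  have e0: "- 2 * u 1 ^ 2 + 2 * u 1 * u 2 - u 2 ^ 2 = 0"
    using d[of "vec4 1 0 0 0"] unfolding dird_cubic vec4_simps by simp
  have e1: "6 * u 1 ^ 2 - 4 * u 0 * u 1 + 2 * u 0 * u 2 = 0"
    using d[of "vec4 0 1 0 0"] unfolding dird_cubic vec4_simps by simp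
  have e2: "2 * u 0 * u 1 - 2 * u 0 * u 2 = 0"
    using d[of "vec4 0 0 1 0"] unfolding dird_cubic vec4_simps by simp
  have "2 * u 0 * (u 1 - u 2) = 0" using e2 by algebra
  then have "u 0 = 0 \<or> u 1 = u 2" by simp
  then have "u 1 = 0 \<and> u 2 = 0"
  proof
    assume "u 0 = 0"
    then have "u 1 = 0" using e1 by simp
    then show ?thesis using e0 by simp
  next
    assume *: "u 1 = u 2"
    have "u 2 ^ 2 = 0" using e0 unfolding * by algebra
    then show ?thesis using * by simp
  qed
  then show ?thesis using vec3_eta[OF u] by (simp add: smul_vec4)
qed

text \<open>Irreducible as the image of a line of the cycle under \<open>to_plane\<close>.\<close>

lemma proj_variety_cubic: "proj_variety (curve H4_cubic)"
proof (rule proj_varietyI)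
  show "proj_closed (curve H4_cubic)"
    unfolding proj_closed_def curve_def
    by (rule exI[of _ 2], rule exI[of _ "{on3 H4_cubic}"]) (use form_H4(4) in auto)
  show "curve H4_cubic \<noteq> {}" using to_plane_line0_cubic[of 1 0] by auto
  show "form_domain (curve H4_cubic)"
  proof (rule form_domainI)
    show "polyfun (\<lambda>v. to_plane (line0 (v 0) (v 1)) i)" for i
      by (rule polyfun_compose[OF form_polyfun[OF form_to_plane]])
        (simp add: line0_def, intro polyfun_vec4 polyfun_rules)
    show "polyfun (\<lambda>v. v 0)" by (rule polyfun.coord)
    show "vec4 1 0 0 0 0 \<noteq> 0" by simp
    show "to_plane (line0 (v 0) (v 1)) \<in> curve H4_cubic" if "v 0 \<noteq> 0" for v :: vec
      by (rule to_plane_line0_cubic) (use that in simp)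
    show "\<exists>c (v::vec). x = smul c (to_plane (line0 (v 0) (v 1)))" if "x \<in> curve H4_cubic" for x
    proof -
      obtain s t c where "x = smul c (to_plane (line0 s t))" using cubic_parametrization[OF \<open>x \<in> curve H4_cubic\<close>] by blast
      then have "x = smul c (to_plane (line0 (vec4 s t 0 0 0) (vec4 s t 0 0 1)))" by simp
      then show ?thesis by blast
    qed
  qed
qed

lemma node_cubic: "node H4_cubic (vec4 1 0 0 0)"
  unfolding node_def
proof
  show "sing_pt H4_cubic (vec4 1 0 0 0)"
    unfolding sing_pt_def vec4_curve dird_cubic by (simp add: H4_cubic_def)
  \<comment> \<open>At the node the second derivative is
    \<open>-2 (w 2 - (1 + i) w 1) (w 2 - (1 - i) w 1)\<close>; the two factors are the branch
    tangents.\<close>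
  define a b where "a = vec4 0 (2 * (1 + \<i>)) (- 2) 0" and "b = vec4 0 (- (1 - \<i>)) 1 0"
  have sum3: "(\<Sum>i\<le>2. f i) = f 0 + f 1 + f (2::nat)" for f :: "nat \<Rightarrow> complex"
    by (simp add: numeral_2_eq_2)
  have "r = 0 \<and> s = 0" if "\<forall>i\<le>2. r * a i + s * b i = 0" for r s
  proof -
    have "r * (2 * (1 + \<i>)) + s * (- (1 - \<i>)) = 0" "r * (- 2) + s * 1 = 0"
      using that[rule_format, of 1] that[rule_format, of 2] by (simp_all add: a_def b_def)
    then have "s = 2 * r" "\<i> * r * 4 = 0" by algebra+
    then show ?thesis by simp
  qed
  moreover have "dird 2 (on3 H4_cubic) (vec4 1 0 0 0) w = (\<Sum>i\<le>2. a i * w i) * (\<Sum>i\<le>2. b i * w i)" for w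
    unfolding dird_cubic sum3 a_def b_def vec4_simps using i_times_i by algebra
  ultimately show "\<exists>a b. (\<forall>r s. (\<forall>i\<le>2. r * a i + s * b i = 0) \<longrightarrow> r = 0 \<and> s = 0) \<and>
      (\<forall>w. dird 2 (on3 H4_cubic) (vec4 1 0 0 0) w = (\<Sum>i\<le>2. a i * w i) * (\<Sum>i\<le>2. b i * w i))"
    by blast
qed

lemma nodal_cubic_H4: "nodal_cubic H4_cubic"
  unfolding nodal_cubic_def using form_H4(4) proj_variety_cubic node_cubic cubic_singular by blast

lemma inflectional_line_H4: "inflectional_line H4_cubic H4_line"
  unfolding inflectional_line_def
proof (intro conjI bexI)
  show "form 1 (on3 H4_line)" by (rule form_H4)
  have "vec4 1 0 0 0 \<in> proj 2" "vec4 1 0 0 0 \<notin> curve H4_line"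
    by (simp_all add: vec4_proj2 vec4_curve H4_line_def)
  then show "curve H4_line \<noteq> proj 2" by blast
  have "vec4 0 1 0 0 \<in> curve H4_line" "vec4 0 1 0 0 \<notin> curve H4_cubic"
    by (simp_all add: vec4_curve H4_line_def H4_cubic_def)
  then show "\<not> curve H4_line \<subseteq> curve H4_cubic" by blast
  \<comment> \<open>The flex: restricted to \<open>x = 0\<close> the cubic is \<open>2 y^3\<close>,
    with triple zero at \<open>(0 : 0 : 1)\<close>.\<close>
  show "vec4 0 0 1 0 \<in> curve H4_line \<inter> curve H4_cubic"
    by (simp add: vec4_curve H4_line_def H4_cubic_def)
  have "dird 1 (on3 H4_cubic) (vec4 0 0 1 0) (vec4 1 0 0 0) \<noteq> 0" unfolding dird_cubic by simp
  then show "\<not> sing_pt H4_cubic (vec4 0 0 1 0)" unfolding sing_pt_def by blast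
  show "\<forall>w. on3 H4_line w = 0 \<longrightarrow> (\<forall>k<3. dird k (on3 H4_cubic) (vec4 0 0 1 0) w = 0)"
  proof (intro allI impI)
    fix w k assume w: "on3 H4_line w = 0" and k: "(k::nat) < 3"
    have "k = 0 \<or> k = 1 \<or> k = 2" using k by arith
    then show "dird k (on3 H4_cubic) (vec4 0 0 1 0) w = 0"
    proof (elim disjE)
      assume "k = 0"
      then show ?thesis by (simp add: dird_def on3_def H4_cubic_def)
    next
      assume "k = 1"
      then show ?thesis using w by (simp only: dird_cubic) (simp add: on3_def H4_line_def)
    next
      assume "k = 2"
      then show ?thesis using w by (simp only: dird_cubic) (simp add: on3_def H4_line_def)
    qed
  qed
qed

lemma smooth_conic_H4: "smooth_conic H4_conic"
  unfolding smooth_conic_def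
proof (intro conjI allI notI)
  show "form 2 (on3 H4_conic)" by (rule form_H4)
  fix v assume "sing_pt H4_conic v"
  then have v: "v \<noteq> 0" "\<forall>i>2. v i = 0" and d: "\<And>w. dird 1 (on3 H4_conic) v w = 0"
    using curve_D unfolding sing_pt_def by blast+
  have e: "v 0 = 0" using d[of "vec4 0 0 1 0"] unfolding dird_conic vec4_simps by simp
  have e1: "v 1 = 0" using d[of "vec4 0 1 0 0"] unfolding dird_conic vec4_simps e by simp
  have "v 2 = 0" using d[of "vec4 1 0 0 0"] unfolding dird_conic vec4_simps e e1 by simp
  then have "vec4 (v 0) (v 1) (v 2) 0 = 0" using e e1 by simp
  then show False using vec3_eta[OF v(2)] v(1) by metis
qed

section \<open>Tangency\<close>

lemma tangent_curve:
  assumes G: "form d (on3 G)" and w: "w \<in> tangent (curve G) v"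
  shows "dird 1 (on3 G) v w = 0" "i > 2 \<Longrightarrow> w i = 0"
proof -
  have "\<forall>u\<in>curve G. on3 G u = 0" by (simp add: curve_def)
  then show "dird 1 (on3 G) v w = 0" using w G unfolding tangent_def by blast
  show "w i = 0" if "i > 2"
    by (rule tangent_support[OF _ w that]) (auto simp: curve_def)
qed

text \<open>Where \<open>G = 0\<close>, the foliation form is proportional to the differential of \<open>G\<close>: each
  \<open>2 \<times> 2\<close> minor is a multiple of \<open>G\<close>.\<close>

lemma tangent_H4:
  "tangent_to (plane_field H4A H4B H4C) (curve H4_cubic)"
  "tangent_to (plane_field H4A H4B H4C) (curve H4_line)"
  "tangent_to (plane_field H4A H4B H4C) (curve H4_conic)"
proof -
  show "tangent_to (plane_field H4A H4B H4C) (curve H4_line)"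
    unfolding tangent_to_def
  proof (intro ballI impI subsetI)
    fix v w assume v: "v \<in> curve H4_line" and w: "w \<in> tangent (curve H4_line) v"
    have "v 0 = 0" "w 0 = 0" using curve_D[OF v] tangent_curve(1)[OF form_H4(6) w]
      by (simp_all add: H4_line_def dird_line[unfolded One_nat_def])
    then show "w \<in> plane_field H4A H4B H4C v"
      using tangent_curve(2)[OF form_H4(6) w] by (simp add: plane_field_def on3_def H4B_def H4C_def)
  qed
  show "tangent_to (plane_field H4A H4B H4C) (curve H4_conic)"
    unfolding tangent_to_def
  proof (intro ballI impI subsetI)
    fix v w assume v: "v \<in> curve H4_conic" and w: "w \<in> tangent (curve H4_conic) v"
    define x y z where "x = v 0" and "y = v 1" and "z = v 2"
    define g0 g1 g2 where "g0 = 4 * y - 2 * z - 2 * x" and "g1 = 2 * y + 4 * x" and "g2 = - 2 * x"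
    have G: "H4_conic x y z = 0" using curve_D[OF v] by (simp add: x_def y_def z_def)
    have dG: "w 0 * g0 + w 1 * g1 + w 2 * g2 = 0"
      using tangent_curve(1)[OF form_H4(5) w] unfolding dird_conic g0_def g1_def g2_def x_def y_def z_def .
    define om where "om = H4A x y z * w 0 + H4B x y z * w 1 + H4C x y z * w 2"
    have m: "H4A x y z * g1 - H4B x y z * g0 = H4_conic x y z * (4*x*y - 4*x*z - 8*y^2 + 2*y*z)"
      "H4A x y z * g2 - H4C x y z * g0 = H4_conic x y z * (2*x*z)"
      "H4B x y z * g2 - H4C x y z * g1 = H4_conic x y z * (- 4*x*y)"
      unfolding H4A_def H4B_def H4C_def H4_conic_def g0_def g1_def g2_def by algebra+
    have "g0 * om = 0" "g1 * om = 0" "g2 * om = 0"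
      unfolding om_def using m dG unfolding G by algebra+
    moreover have "g0 \<noteq> 0 \<or> g1 \<noteq> 0 \<or> g2 \<noteq> 0"
    proof (rule ccontr)
      assume *: "\<not> ?thesis"
      have "dird 1 (on3 H4_conic) v w = w 0 * g0 + w 1 * g1 + w 2 * g2" for w
        unfolding dird_conic g0_def g1_def g2_def x_def y_def z_def ..
      then have "\<forall>w. dird 1 (on3 H4_conic) v w = 0" using * by simp
      then show False using v smooth_conic_H4 unfolding smooth_conic_def sing_pt_def by blast
    qed
    ultimately have "om = 0" by auto
    then show "w \<in> plane_field H4A H4B H4C v"
      using tangent_curve(2)[OF form_H4(5) w] by (simp add: plane_field_def on3_def om_def x_def y_def z_def)
  qed
  show "tangent_to (plane_field H4A H4B H4C) (curve H4_cubic)"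
    unfolding tangent_to_def
  proof (intro ballI impI subsetI)
    fix v w assume v: "v \<in> curve H4_cubic" and w: "w \<in> tangent (curve H4_cubic) v"
    define x y z where "x = v 0" and "y = v 1" and "z = v 2"
    define g0 g1 g2 where "g0 = - 2 * y ^ 2 + 2 * y * z - z ^ 2" and "g1 = 6 * y ^ 2 - 4 * x * y + 2 * x * z"
      and "g2 = 2 * x * y - 2 * x * z"
    have G: "H4_cubic x y z = 0" using curve_D[OF v] by (simp add: x_def y_def z_def)
    have dG: "w 0 * g0 + w 1 * g1 + w 2 * g2 = 0"
      using tangent_curve(1)[OF form_H4(4) w] unfolding dird_cubic g0_def g1_def g2_def x_def y_def z_def .
    define om where "om = H4A x y z * w 0 + H4B x y z * w 1 + H4C x y z * w 2"
    have m: "H4A x y z * g1 - H4B x y z * g0 = H4_cubic x y z * (6*x*y - 4*x*z - 12*y^2 + 3*y*z)"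
      "H4A x y z * g2 - H4C x y z * g0 = H4_cubic x y z * (- 2*x*y + 3*x*z)"
      "H4B x y z * g2 - H4C x y z * g1 = H4_cubic x y z * (2*x^2 - 6*x*y)"
      unfolding H4A_def H4B_def H4C_def H4_cubic_def g0_def g1_def g2_def by algebra+
    have g: "g0 * om = 0" "g1 * om = 0" "g2 * om = 0"
      unfolding om_def using m dG unfolding G by algebra+
    have "om = 0"
    proof (cases "g0 \<noteq> 0 \<or> g1 \<noteq> 0 \<or> g2 \<noteq> 0")
      case False
      \<comment> \<open>The minors give no information at the node, but there all coefficients of
        the foliation form vanish as well.\<close>
      then have "sing_pt H4_cubic v"
        using v unfolding sing_pt_def dird_cubic g0_def g1_def g2_def x_def y_def z_def by simp
      from cubic_singular[OF this] have "v 1 = smul (v 0) (vec4 1 0 0 0) 1" "v 2 = smul (v 0) (vec4 1 0 0 0) 2"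
        by metis+
      then have "y = 0" "z = 0" by (simp_all add: y_def z_def)
      then show ?thesis by (simp add: om_def H4A_def H4B_def H4C_def)
    qed (use g in auto)
    then show "w \<in> plane_field H4A H4B H4C v"
      using tangent_curve(2)[OF form_H4(4) w] by (simp add: plane_field_def on3_def om_def x_def y_def z_def)
  qed
qed

section \<open>Absence of common factors\<close>

lemma nonvanishing_poly_constant:
  assumes "\<And>t. poly P t \<noteq> (0::complex)"
  shows "poly P s = poly P t"
  using fundamental_theorem_of_algebra[of P] assms unfolding constant_def by metis

lemma polyfun_cancel:
  assumes "polyfun f" "polyfun g" "\<And>v. g v * f v = 0" "g w \<noteq> 0"
  shows "f v = 0"
  using polyfun_mult_nonzero[OF assms(2,1,4), of v] assms(3) by auto

text \<open>If elimination of one variable from two coefficients gives a nonzero value, a common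
  factor has no zero on the corresponding coordinate line, and a polynomial without zeros is
  constant. Thus \<open>g\<close> depends neither on \<open>z\<close> nor on \<open>x\<close>; the
  same principle in \<open>y\<close> finishes.\<close>

lemma H4_common_factor:
  assumes pf: "polyfun (on3 g)"
    and A: "\<And>x y z. H4A x y z = g x y z * A' x y z" and B: "\<And>x y z. H4B x y z = g x y z * B' x y z"
    and C: "\<And>x y z. H4C x y z = g x y z * C' x y z"
  shows "\<exists>c. \<forall>x y z. g x y z = c"
proof -
  note pg = polyfun_on3[OF pf]
  have z_free: "g x y z = g x y 0" for x y z
  proof -
    \<comment> \<open>The result of eliminating \<open>z\<close> from \<open>H4B\<close> and
      \<open>H4C\<close>, both linear in \<open>z\<close>.\<close>
    define f where "f v = - 2 * v 0 * v 1 * (v 0 - v 1) * (v 0 - 3 * v 1)" for v :: vec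
    have f: "polyfun f" unfolding f_def by (intro polyfun_rules)
    have "polyfun (\<lambda>v. g (v 0) (v 1) (v 2) - g (v 0) (v 1) 0)" by (intro polyfun_diff pg polyfun.intros)
    moreover have "f v * (g (v 0) (v 1) (v 2) - g (v 0) (v 1) 0) = 0" for v
    proof (cases "f v = 0")
      case False
      have "g (v 0) (v 1) t \<noteq> 0" for t
      proof
        assume "g (v 0) (v 1) t = 0"
        then have *: "H4B (v 0) (v 1) t = 0" "H4C (v 0) (v 1) t = 0" by (simp_all add: B C)
        have "f v = v 0 * H4B (v 0) (v 1) t - 3 * v 1 * H4C (v 0) (v 1) t + 2 * v 0 * H4C (v 0) (v 1) t"
          unfolding f_def H4B_def H4C_def by algebra
        then show False using False * by simp
      qed
      moreover obtain P where "\<And>t. g (v 0) (v 1) t = poly P t"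
        using polyfun_on_line[OF pf, of "vec4 (v 0) (v 1) 0 0" "vec4 0 0 1 0"] by (auto simp: on3_def)
      ultimately show ?thesis using nonvanishing_poly_constant[of P] by simp
    qed simp
    moreover have "f (vec4 2 1 0 0) \<noteq> 0" by (simp add: f_def)
    ultimately show ?thesis using polyfun_cancel[OF _ f, where v = "vec4 x y z 0"] by fastforce
  qed
  have x_free: "g x y z = g 0 y z" for x y z
  proof -
    \<comment> \<open>The resultant in \<open>x\<close> of \<open>H4A = a x + b\<close> and
      \<open>H4C\<close>, obtained by inserting \<open>x = - b / a\<close> in
      \<open>a^2 H4C\<close>.\<close>
    define f where "f v = - (v 1 ^ 2 * v 2 - 4 * v 1 ^ 3) * (v 1 ^ 2 * (4 * v 1 ^ 2 - 8 * v 1 * v 2 + 3 * v 2 ^ 2))" for v :: vec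
    have f: "polyfun f" unfolding f_def by (intro polyfun_rules)
    have "polyfun (\<lambda>v. g (v 0) (v 1) (v 2) - g 0 (v 1) (v 2))" by (intro polyfun_diff pg polyfun.intros)
    moreover have "f v * (g (v 0) (v 1) (v 2) - g 0 (v 1) (v 2)) = 0" for v
    proof (cases "f v = 0")
      case False
      have "g t (v 1) (v 2) \<noteq> 0" for t
      proof
        assume "g t (v 1) (v 2) = 0"
        then have *: "H4A t (v 1) (v 2) = 0" "H4C t (v 1) (v 2) = 0" by (simp_all add: A C)
        define a b where "a = 2 * v 1 ^ 2 - 2 * v 1 * v 2 + v 2 ^ 2" and "b = v 1 ^ 2 * v 2 - 4 * v 1 ^ 3"
        have "f v = a^2 * H4C t (v 1) (v 2) -
            H4A t (v 1) (v 2) * (2 * v 1 ^ 2 * a - v 2 * H4A t (v 1) (v 2) + 2 * v 2 * b)"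
          unfolding f_def H4A_def H4C_def a_def b_def by algebra
        then show False using False * by simp
      qed
      moreover obtain P where "\<And>t. g t (v 1) (v 2) = poly P t"
        using polyfun_on_line[OF pf, of "vec4 0 (v 1) (v 2) 0" "vec4 1 0 0 0"] by (auto simp: on3_def)
      ultimately show ?thesis using nonvanishing_poly_constant[of P] by simp
    qed simp
    moreover have "f (vec4 0 1 0 0) \<noteq> 0" by (simp add: f_def)
    ultimately show ?thesis using polyfun_cancel[OF _ f, where v = "vec4 x y z 0"] by fastforce
  qed
  have free: "g x y z = g 0 y 0" for x y z using x_free[of x y z] z_free[of 0 y z] by simp
  \<comment> \<open>Since \<open>g\<close> sees only \<open>y\<close>, the other coordinates are
    free: \<open>H4A 1 0 1 = 1\<close> settles \<open>y = 0\<close>, and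
    \<open>H4C 1 y 0 = 2 y^2\<close> the other values.\<close>
  have "g 0 y 0 \<noteq> 0" for y
  proof (cases "y = 0")
    case True
    have "H4A 1 0 1 = g 0 0 0 * A' 1 0 1" unfolding A free[of 1 0 1] ..
    then show ?thesis using True by (auto simp: H4A_def)
  next
    case False
    have "H4C 1 y 0 = g 0 y 0 * C' 1 y 0" unfolding C free[of 1 y 0] ..
    then show ?thesis using False by (auto simp: H4C_def)
  qed
  moreover obtain P where "\<And>t. g 0 t 0 = poly P t"
    using polyfun_on_line[OF pf, of "vec4 0 0 0 0" "vec4 0 1 0 0"] by (auto simp: on3_def)
  ultimately have "g 0 y 0 = g 0 0 0" for y using nonvanishing_poly_constant[of P] by simp
  then show ?thesis using free by metis
qed

lemma plane_foliation_H4: "plane_foliation 2 H4A H4B H4C"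
  unfolding plane_foliation_def
proof (intro conjI allI impI)
  show "form (2 + 1) (on3 H4A)" "form (2 + 1) (on3 H4B)" "form (2 + 1) (on3 H4C)" using form_H4 by simp_all
  show "x * H4A x y z + y * H4B x y z + z * H4C x y z = 0" for x y z
    unfolding H4A_def H4B_def H4C_def by algebra
  fix g A' B' C' assume "polyfun (on3 g)" "\<forall>x y z. H4A x y z = g x y z * A' x y z \<and>
    H4B x y z = g x y z * B' x y z \<and> H4C x y z = g x y z * C' x y z"
  then show "\<exists>c. \<forall>x y z. g x y z = c" by (intro H4_common_factor) blast+
qed

section \<open>Uniqueness\<close>

lemma vector_space_smul: "vector_space smul"
  by unfold_locales (auto simp: fun_eq_iff algebra_simps)

lemma cdim_two:
  assumes V: "v \<in> V" "g \<in> V" "\<And>w. w \<in> V \<Longrightarrow> \<exists>a b. w = smul a v + smul b g"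
    and ind: "\<And>k. v \<noteq> smul k g" "g \<noteq> 0"
  shows "cdim V = 2"
proof -
  interpret vs: vector_space smul by (rule vector_space_smul)
  have "vs.independent {g}" using ind(2) by (simp add: vs.dependent_single)
  moreover have "v \<notin> vs.span {g}" unfolding vs.span_singleton using ind(1) by blast
  ultimately have "vs.independent {v, g}" using vs.independent_insertI by blast
  moreover have "V \<subseteq> vs.span {v, g}"
  proof
    fix w assume "w \<in> V"
    then obtain a b where "w = smul a v + smul b g" using V(3) by blast
    then show "w \<in> vs.span {v, g}" by (simp add: vs.span_add vs.span_scale vs.span_base)
  qed
  moreover have "card {v, g} = 2" using ind(1)[of 1] by simp
  ultimately show ?thesis unfolding cdim_def using V(1,2) by (intro vs.dim_unique[of "{v, g}"]) auto
qed

lemma tangent_radial: "v \<in> X \<Longrightarrow> v \<in> tangent X v"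
  unfolding tangent_def using dird_form_radial by simp

lemma tangent_param:
  assumes "\<And>s. \<gamma> s \<in> X" "\<And>i. ((\<lambda>s. \<gamma> s i) has_field_derivative \<gamma>' i) (at t)"
  shows "\<gamma>' \<in> tangent X (\<gamma> t)"
  unfolding tangent_def
proof (intro CollectI allI impI)
  fix d f assume f: "form d f" "\<forall>u\<in>X. f u = 0"
  have "((\<lambda>s. f (\<gamma> s)) has_field_derivative dird 1 f (\<gamma> t) \<gamma>') (at t)"
    by (rule dird_chain[OF form_polyfun[OF f(1)] assms(2)])
  moreover have "(\<lambda>s. f (\<gamma> s)) = (\<lambda>s. 0)" using f(2) assms(1) by blast
  ultimately show "dird 1 f (\<gamma> t) \<gamma>' = 0" using DERIV_const DERIV_unique by metis
qed

text \<open>\<open>tangent_to\<close> applies only where the tangent space of the cone has dimension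
  two. The point and the velocity are shown to be a basis: independent by \<open>ind\<close>,
  spanning by \<open>gen\<close>.\<close>

lemma tangency_along_param:
  assumes tan: "tangent_to (plane_field A B C) (curve G)" and G: "form d (on3 G)"
    and \<gamma>: "\<And>s. \<gamma> s \<in> curve G" "\<And>i. ((\<lambda>s. \<gamma> s i) has_field_derivative \<gamma>' i) (at t)"
    and ind: "\<And>k. \<gamma> t \<noteq> smul k \<gamma>'" "\<gamma>' \<noteq> 0"
    and gen: "\<And>w. \<forall>i>2. w i = 0 \<Longrightarrow> dird 1 (on3 G) (\<gamma> t) w = 0 \<Longrightarrow> \<exists>a b. w = smul a (\<gamma> t) + smul b \<gamma>'"
  shows "on3 A (\<gamma> t) * \<gamma>' 0 + on3 B (\<gamma> t) * \<gamma>' 1 + on3 C (\<gamma> t) * \<gamma>' 2 = 0"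
proof -
  have g: "\<gamma>' \<in> tangent (curve G) (\<gamma> t)" by (rule tangent_param[OF \<gamma>])
  have "cdim (tangent (curve G) (\<gamma> t)) = 2"
  proof (rule cdim_two[OF tangent_radial[OF \<gamma>(1)] g _ ind])
    show "\<exists>a b. w = smul a (\<gamma> t) + smul b \<gamma>'" if "w \<in> tangent (curve G) (\<gamma> t)" for w
      using tangent_curve[OF G that] by (intro gen) auto
  qed
  then have "\<gamma>' \<in> plane_field A B C (\<gamma> t)" using tan g \<gamma>(1) unfolding tangent_to_def by blast
  then show ?thesis by (simp add: plane_field_def)
qed

lemma line_tangency:
  assumes "tangent_to (plane_field A B C) (curve H4_line)"
  shows "B 0 y 1 = 0"
proof -
  have "on3 A (vec4 0 y 1 0) * vec4 0 1 0 0 0 + on3 B (vec4 0 y 1 0) * vec4 0 1 0 0 1 +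
      on3 C (vec4 0 y 1 0) * vec4 0 1 0 0 2 = 0"
  proof (rule tangency_along_param[OF assms form_H4(6), where \<gamma> = "\<lambda>s. vec4 0 s 1 0"])
    show "vec4 0 s 1 0 \<in> curve H4_line" for s by (simp add: vec4_curve H4_line_def)
    show "((\<lambda>s. vec4 0 s 1 0 i) has_field_derivative vec4 0 1 0 0 i) (at y)" for i
      using vec4_cases[of i] by (elim disjE) (auto intro!: derivative_eq_intros)
    show "vec4 0 y 1 0 \<noteq> smul k (vec4 0 1 0 0)" for k by (simp add: smul_vec4 vec4_eq_iff)
    show "\<exists>a b. w = smul a (vec4 0 y 1 0) + smul b (vec4 0 1 0 0)"
      if "\<forall>i>2. w i = 0" "dird 1 (on3 H4_line) (vec4 0 y 1 0) w = 0" for w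
    proof -
      have "w 0 = 0" using that(2) unfolding dird_line .
      then have "w i = (smul (w 2) (vec4 0 y 1 0) + smul (w 1 - w 2 * y) (vec4 0 1 0 0)) i" for i
        using vec4_cases[of i] that(1) by (elim disjE) auto
      then show ?thesis by blast
    qed
  qed simp
  then show ?thesis by (simp add: on3_def)
qed

text \<open>At \<open>x = 1\<close> the conic is the graph \<open>z = (y^2 + 4 y - 1) / 2\<close>
  with slope \<open>y + 2\<close>; \<open>A\<close> drops out because \<open>x\<close> is
  constant.\<close>

lemma conic_tangency:
  assumes "tangent_to (plane_field A B C) (curve H4_conic)"
  shows "B 1 y ((y^2 + 4 * y - 1) / 2) + C 1 y ((y^2 + 4 * y - 1) / 2) * (y + 2) = 0"
proof -
  define z where "z y = (y^2 + 4 * y - 1) / 2" for y :: complex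
  have z2: "2 * z y = y^2 + 4 * y - 1" for y by (simp add: z_def)
  have "on3 A (vec4 1 y (z y) 0) * vec4 0 1 (y + 2) 0 0 + on3 B (vec4 1 y (z y) 0) * vec4 0 1 (y + 2) 0 1 +
      on3 C (vec4 1 y (z y) 0) * vec4 0 1 (y + 2) 0 2 = 0"
  proof (rule tangency_along_param[OF assms form_H4(5), where \<gamma> = "\<lambda>s. vec4 1 s (z s) 0"])
    show "vec4 1 s (z s) 0 \<in> curve H4_conic" for s
      using z2[of s] by (simp add: vec4_curve H4_conic_def)
    show "((\<lambda>s. vec4 1 s (z s) 0 i) has_field_derivative vec4 0 1 (y + 2) 0 i) (at y)" for i
      using vec4_cases[of i]
      by (elim disjE) (auto simp: z_def field_simps intro!: derivative_eq_intros)
    show "vec4 1 y (z y) 0 \<noteq> smul k (vec4 0 1 (y + 2) 0)" for k by (simp add: smul_vec4 vec4_eq_iff)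
    show "\<exists>a b. w = smul a (vec4 1 y (z y) 0) + smul b (vec4 0 1 (y + 2) 0)"
      if "\<forall>i>2. w i = 0" "dird 1 (on3 H4_conic) (vec4 1 y (z y) 0) w = 0" for w
    proof -
      have "2 * w 2 = 2 * (w 0 * z y + (w 1 - w 0 * y) * (y + 2))"
        using that(2) z2[of y] unfolding dird_conic vec4_simps by algebra
      then have "w 2 = w 0 * z y + (w 1 - w 0 * y) * (y + 2)" by (simp only: mult_cancel_left) simp
      then have "w i = (smul (w 0) (vec4 1 y (z y) 0) + smul (w 1 - w 0 * y) (vec4 0 1 (y + 2) 0)) i" for i
        using vec4_cases[of i] that(1) by (elim disjE) auto
      then show ?thesis by blast
    qed
  qed simp
  then show ?thesis by (simp add: on3_def z_def)
qed

text \<open>The line \<open>z = r y\<close> through the node meets the cubic once more, where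
  \<open>2 y = 2 - 2 r + r^2\<close> at \<open>x = 1\<close>. For \<open>y = 0\<close> this point is
  the node, and for \<open>r = 1\<close> the derivative of \<open>y\<close> vanishes, so
  \<open>w 1\<close> no longer determines the coefficient of the velocity.\<close>

lemma cubic_tangency:
  fixes r :: complex
  assumes "tangent_to (plane_field A B C) (curve H4_cubic)"
    and r: "r \<noteq> 1" "1 - r + r^2 / 2 \<noteq> 0"
  shows "B 1 (1 - r + r^2 / 2) (r * (1 - r + r^2 / 2)) * (r - 1) +
    C 1 (1 - r + r^2 / 2) (r * (1 - r + r^2 / 2)) * (1 - 2 * r + 3 * r^2 / 2) = 0"
proof -
  define y where "y r = 1 - r + r^2 / 2" for r :: complex
  define z' where "z' = 1 - 2 * r + 3 * r^2 / 2"
  have y2: "2 * y r = 2 - 2 * r + r^2" for r by (simp add: y_def field_simps)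
  have z2: "2 * z' = 2 - 4 * r + 3 * r^2" by (simp add: z'_def)
  have y0: "y r \<noteq> 0" using r by (simp add: y_def)
  have "on3 A (vec4 1 (y r) (r * y r) 0) * vec4 0 (r - 1) z' 0 0 +
      on3 B (vec4 1 (y r) (r * y r) 0) * vec4 0 (r - 1) z' 0 1 +
      on3 C (vec4 1 (y r) (r * y r) 0) * vec4 0 (r - 1) z' 0 2 = 0"
  proof (rule tangency_along_param[OF assms(1) form_H4(4), where \<gamma> = "\<lambda>s. vec4 1 (y s) (s * y s) 0"])
    show "vec4 1 (y s) (s * y s) 0 \<in> curve H4_cubic" for s
    proof -
      have "H4_cubic 1 (y s) (s * y s) = y s ^ 2 * (2 * y s - (2 - 2 * s + s^2))"
        unfolding H4_cubic_def by algebra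
      then show ?thesis unfolding y2 by (simp add: vec4_curve)
    qed
    show "((\<lambda>s. vec4 1 (y s) (s * y s) 0 i) has_field_derivative vec4 0 (r - 1) z' 0 i) (at r)" for i
      using vec4_cases[of i]
      by (elim disjE) (auto simp: y_def z'_def field_simps power2_eq_square intro!: derivative_eq_intros)
    show "vec4 1 (y r) (r * y r) 0 \<noteq> smul k (vec4 0 (r - 1) z' 0)" for k by (simp add: smul_vec4 vec4_eq_iff)
    show "vec4 0 (r - 1) z' 0 \<noteq> 0" using r(1) by simp
    show "\<exists>a b. w = smul a (vec4 1 (y r) (r * y r) 0) + smul b (vec4 0 (r - 1) z' 0)"
      if "\<forall>i>2. w i = 0" "dird 1 (on3 H4_cubic) (vec4 1 (y r) (r * y r) 0) w = 0" for w
    proof -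
      define b where "b = (w 1 - w 0 * y r) / (r - 1)"
      have b: "w 1 = w 0 * y r + b * (r - 1)" using r(1) by (simp add: b_def)
      have "2 * y r * (r - 1) * (w 2 - (w 0 * (r * y r) + b * z')) = 0"
      proof -
        have "4 * (2 * y r * (r - 1) * (w 2 - (w 0 * (r * y r) + b * z'))) = 0"
          using that(2) y2[of r] z2 b unfolding dird_cubic vec4_simps by algebra
        then show ?thesis by simp
      qed
      then have "w 2 = w 0 * (r * y r) + b * z'" using r(1) y0 by simp
      then have "w i = (smul (w 0) (vec4 1 (y r) (r * y r) 0) + smul b (vec4 0 (r - 1) z' 0)) i" for i
        using vec4_cases[of i] that(1) b by (elim disjE) auto
      then show ?thesis by blast
    qed
  qed
  then show ?thesis by (simp add: on3_def y_def z'_def)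
qed

text \<open>Multiplication by a power of \<open>t\<close> turns \<open>Q (1 / t)\<close> into the
  reflected polynomial. One additional factor \<open>t\<close> on both sides makes the identity hold
  at \<open>t = 0\<close> too, hence between polynomials, and degrees can be compared.\<close>

lemma degree_le_reciprocal:
  fixes P Q :: "complex poly"
  assumes "\<And>t. t \<noteq> 0 \<Longrightarrow> poly P t = t ^ n * poly Q (1 / t)"
  shows "degree P \<le> n"
proof (cases "P = 0 \<or> Q = 0")
  case True
  then show ?thesis
  proof
    assume "Q = 0"
    then have "poly (monom 1 1 * P) t = 0" for t using assms[of t] by (cases "t = 0") (simp_all add: poly_monom)
    then have "monom 1 1 * P = 0" by (simp add: poly_all_0_iff_0[symmetric])
    then show ?thesis by simp
  qed simp
next
  case False
  have "poly (monom 1 (Suc (degree Q)) * P) t = poly (monom 1 (Suc n) * reflect_poly Q) t" for t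
  proof (cases "t = 0")
    case t: False
    have "poly (reflect_poly Q) t = t ^ degree Q * poly Q (inverse t)"
      using t by (rule poly_reflect_poly_nz)
    then show ?thesis using assms[OF t] by (simp add: poly_monom inverse_eq_divide)
  qed (simp add: poly_monom)
  then have "monom 1 (Suc (degree Q)) * P = monom 1 (Suc n) * reflect_poly Q"
    by (simp add: poly_eq_poly_eq_iff[symmetric] fun_eq_iff)
  then have "degree (monom 1 (Suc (degree Q)) * P) = degree (monom 1 (Suc n) * reflect_poly Q)" by simp
  then have "Suc (degree Q) + degree P = Suc n + degree (reflect_poly Q)"
    using False by (simp add: degree_mult_eq degree_monom_eq monom_eq_0_iff)
  then show ?thesis using degree_reflect_poly_le[of Q] by simp
qed

lemma quadratic_interpolation:
  fixes h :: "complex \<Rightarrow> complex"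
  assumes h: "\<And>t. h t = poly P t" and P: "degree P \<le> 2"
  shows "h t = h 0 + t * ((h 1 - h (- 1)) / 2) + t^2 * ((h 1 + h (- 1)) / 2 - h 0)"
proof -
  have "poly P t = coeff P 0 + coeff P 1 * t + coeff P 2 * t^2" for t
  proof -
    have "degree P = 0 \<or> degree P = 1 \<or> degree P = 2" using P by arith
    moreover have "poly P t = (\<Sum>i\<le>degree P. coeff P i * t ^ i)" by (rule poly_altdef)
    ultimately show ?thesis by (elim disjE) (simp_all add: coeff_eq_0 numeral_2_eq_2)
  qed
  then show ?thesis unfolding h by (simp add: field_simps)
qed

text \<open>Polynomial functions carry no degree, so the bound is imposed on every line. The two
  coordinate directions give nine coefficients \<open>c i j\<close>; the diagonals
  \<open>z = y\<close> and \<open>z = - y\<close> eliminate those with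
  \<open>i + j > 2\<close>.\<close>

lemma bipoly_quadratic:
  assumes deg: "\<And>a b c d P. \<forall>t. F (a + t * b) (c + t * d) = poly P t \<Longrightarrow> degree P \<le> 2" and F: "bipoly F"
  shows "\<exists>b0 b1 b2 b3 b4 b5. \<forall>y z. F y z = b0 + b1 * y + b2 * z + b3 * y^2 + b4 * (y * z) + b5 * z^2"
proof -
  have iy: "F y z = F 0 z + y * ((F 1 z - F (- 1) z) / 2) + y^2 * ((F 1 z + F (- 1) z) / 2 - F 0 z)" for y z
  proof -
    obtain P where "\<forall>t. F (0 + t * 1) (z + t * 0) = poly P t" using bipoly_on_line[OF F] by blast
    from quadratic_interpolation[of "\<lambda>t. F t z" P y] this deg[OF this] show ?thesis by simp
  qed
  have iz: "F y z = F y 0 + z * ((F y 1 - F y (- 1)) / 2) + z^2 * ((F y 1 + F y (- 1)) / 2 - F y 0)" for y z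
  proof -
    obtain P where "\<forall>t. F (y + t * 0) (0 + t * 1) = poly P t" using bipoly_on_line[OF F] by blast
    from quadratic_interpolation[of "\<lambda>t. F y t" P z] this deg[OF this] show ?thesis by simp
  qed
  define k where "k i j = (if i = 0 then F 0 j else if i = 1 then (F 1 j - F (- 1) j) / 2
    else (F 1 j + F (- 1) j) / 2 - F 0 j)" for i :: nat and j
  define c where "c i j = (if j = 0 then k i 0 else if j = 1 then (k i 1 - k i (- 1)) / 2
    else (k i 1 + k i (- 1)) / 2 - k i 0)" for i j :: nat
  have kz: "k i z = c i 0 + z * c i 1 + z^2 * c i 2" for i z
  proof -
    note e = iz[of 0 z] iz[of 1 z] iz[of "- 1" z]
    show ?thesis unfolding c_def k_def e by (simp add: field_simps)
  qed
  have "F y z = k 0 z + y * k 1 z + y^2 * k 2 z" for y z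
    unfolding k_def using iy[of y z] by simp
  then have Fc: "F y z = (c 0 0 + z * c 0 1 + z^2 * c 0 2) + y * (c 1 0 + z * c 1 1 + z^2 * c 1 2) +
      y^2 * (c 2 0 + z * c 2 1 + z^2 * c 2 2)" for y z unfolding kz .
  have high: "c 2 2 = 0 \<and> s * c 2 1 + s^2 * c 1 2 = 0" if s: "s = 1 \<or> s = - 1" for s
  proof -
    define P where "P = [:c 0 0, s * c 0 1 + c 1 0, s^2 * c 0 2 + s * c 1 1 + c 2 0, s^2 * c 1 2 + s * c 2 1, s^2 * c 2 2:]"
    have "\<forall>t. F (0 + t * 1) (0 + t * s) = poly P t"
      unfolding Fc P_def poly_pCons poly_0 by (intro allI) algebra
    then have "degree P \<le> 2" by (rule deg)
    then have "coeff P 3 = 0" "coeff P 4 = 0" by (simp_all add: coeff_eq_0)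
    then show ?thesis using s by (auto simp: P_def numeral_eq_Suc algebra_simps)
  qed
  have "c 2 2 = 0" "c 2 1 + c 1 2 = 0" "- c 2 1 + c 1 2 = 0" using high[of 1] high[of "- 1"] by simp_all
  then have "c 2 2 = 0" "2 * c 2 1 = 0" "2 * c 1 2 = 0" by algebra+
  then have "F y z = c 0 0 + c 1 0 * y + c 0 1 * z + c 2 0 * y^2 + c 1 1 * (y * z) + c 0 2 * z^2" for y z
    unfolding Fc by (simp add: algebra_simps)
  then show ?thesis by blast
qed

text \<open>A cubic form vanishing on \<open>x = 0\<close> has a quadratic cofactor. On a line,
  homogeneity gives \<open>t^3\<close> times a polynomial in \<open>1 / t\<close> that vanishes at
  zero, hence degree at most two.\<close>

lemma cubic_form_dehomogenized:
  assumes F: "form 3 (on3 F)" and F0: "\<And>y z. F 0 y z = 0"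
  shows "\<exists>b0 b1 b2 b3 b4 b5. \<forall>y z. F 1 y z = b0 + b1 * y + b2 * z + b3 * y^2 + b4 * (y * z) + b5 * z^2"
proof (rule bipoly_quadratic)
  have hom: "F (c * x) (c * y) (c * z) = c^3 * F x y z" for c x y z
    using form_smul[OF F, of c "vec4 x y z 0"] by (simp add: on3_def)
  show "bipoly (F 1)"
    unfolding bipoly_def by (intro polyfun_on3[OF form_polyfun[OF F]] polyfun.intros)
  fix a b c d P assume P: "\<forall>t. F 1 (a + t * b) (c + t * d) = poly P t"
  obtain Q where Q: "\<And>s. F s (b + s * a) (d + s * c) = poly Q s"
    using polyfun_on_line[OF form_polyfun[OF F], of "vec4 0 b d 0" "vec4 1 a c 0"] by (auto simp: on3_def)
  have "poly Q 0 = 0" using Q[of 0] F0 by simp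
  then obtain Q' where Q': "Q = [:0, 1:] * Q'" by (metis poly_eq_0_iff_dvd dvdE neg_0_equal_iff_equal)
  have "poly P t = t ^ 2 * poly Q' (1 / t)" if t: "t \<noteq> 0" for t
  proof -
    have "F 1 (a + t * b) (c + t * d) = F (t * (1 / t)) (t * (b + 1 / t * a)) (t * (d + 1 / t * c))"
      using t by (simp add: algebra_simps)
    also have "\<dots> = t^3 * (1 / t * poly Q' (1 / t))" unfolding hom Q by (simp add: Q')
    finally show ?thesis using P t by (simp add: power3_eq_cube power2_eq_square)
  qed
  then show "degree P \<le> 2" by (rule degree_le_reciprocal)
qed

section \<open>The linear system for the coefficients\<close>

lemma poly6_zero:
  assumes "\<And>t. E0 + E1 * t + E2 * t^2 + E3 * t^3 + E4 * t^4 + E5 * t^5 = (0::complex)"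
  shows "E0 = 0 \<and> E1 = 0 \<and> E2 = 0 \<and> E3 = 0 \<and> E4 = 0 \<and> E5 = 0"
proof -
  have "poly [:E0, E1, E2, E3, E4, E5:] t = 0" for t
    using assms[of t] by (simp add: algebra_simps power_numeral_reduce)
  then have "[:E0, E1, E2, E3, E4, E5:] = 0" by (meson poly_all_0_iff_0)
  then show ?thesis by simp
qed

lemma poly9_zero:
  assumes "\<And>t. E0 + E1 * t + E2 * t^2 + E3 * t^3 + E4 * t^4 + E5 * t^5 + E6 * t^6 + E7 * t^7 + E8 * t^8 = (0::complex)"
  shows "E0 = 0 \<and> E1 = 0 \<and> E2 = 0 \<and> E3 = 0 \<and> E4 = 0"
proof -
  have "poly [:E0, E1, E2, E3, E4, E5, E6, E7, E8:] t = 0" for t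
    using assms[of t] by (simp add: algebra_simps power_numeral_reduce)
  then have "[:E0, E1, E2, E3, E4, E5, E6, E7, E8:] = 0" by (meson poly_all_0_iff_0)
  then show ?thesis by simp
qed

text \<open>The two tangency conditions, expanded in the parameters of the conic and of the cubic, form
  a linear system of rank eleven for the twelve coefficients; its kernel is spanned by the
  coefficients of \<open>H4B\<close> and \<open>H4C\<close> in the chart \<open>x = 1\<close>.\<close>

lemma tangency_system:
  fixes b0 b1 b2 b3 b4 b5 c0 c1 c2 c3 c4 c5 :: complex
  assumes conic: "\<And>y. (let z = (y^2 + 4 * y - 1) / 2 in
      (b0 + b1 * y + b2 * z + b3 * y^2 + b4 * (y * z) + b5 * z^2) +
      (c0 + c1 * y + c2 * z + c3 * y^2 + c4 * (y * z) + c5 * z^2) * (y + 2)) = 0"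
    and cubic: "\<And>r. (let y = 1 - r + r^2 / 2; z = r * (1 - r + r^2 / 2) in
      (b0 + b1 * y + b2 * z + b3 * y^2 + b4 * (y * z) + b5 * z^2) * (r - 1) +
      (c0 + c1 * y + c2 * z + c3 * y^2 + c4 * (y * z) + c5 * z^2) * (1 - 2 * r + 3 * r^2 / 2)) = 0"
  shows "b0 = 0 \<and> b1 = 2 * c2 \<and> b2 = - 2 * c2 \<and> b3 = - 4 * c2 \<and> b4 = 3 * c2 \<and> b5 = 0 \<and>
    c0 = 0 \<and> c1 = 0 \<and> c3 = - 2 * c2 \<and> c4 = 0 \<and> c5 = 0"
proof -
  \<comment> \<open>The conic condition multiplied by 4, sorted by powers of
    \<open>y\<close>.\<close>
  have "(4 * b0 - 2 * b2 + b5 + 8 * c0 - 4 * c2 + 2 * c5)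
      + (4 * b1 + 8 * b2 - 2 * b4 - 8 * b5 + 4 * c0 + 8 * c1 + 14 * c2 - 4 * c4 - 15 * c5) * y
      + (2 * b2 + 4 * b3 + 8 * b4 + 14 * b5 + 4 * c1 + 12 * c2 + 8 * c3 + 14 * c4 + 20 * c5) * y^2
      + (2 * b4 + 8 * b5 + 2 * c2 + 4 * c3 + 12 * c4 + 30 * c5) * y^3
      + (b5 + 2 * c4 + 10 * c5) * y^4
      + (c5) * y^5 = 0" for y :: complex
  proof -
    define z where "z = (y^2 + 4 * y - 1) / 2"
    have "2 * z = y^2 + 4 * y - 1" by (simp add: z_def)
    with conic[of y, unfolded Let_def, folded z_def] show ?thesis by algebra
  qed
  from poly6_zero[OF this]
  have q: "4 * b0 - 2 * b2 + b5 + 8 * c0 - 4 * c2 + 2 * c5 = 0"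
    "4 * b1 + 8 * b2 - 2 * b4 - 8 * b5 + 4 * c0 + 8 * c1 + 14 * c2 - 4 * c4 - 15 * c5 = 0"
    "2 * b2 + 4 * b3 + 8 * b4 + 14 * b5 + 4 * c1 + 12 * c2 + 8 * c3 + 14 * c4 + 20 * c5 = 0"
    "2 * b4 + 8 * b5 + 2 * c2 + 4 * c3 + 12 * c4 + 30 * c5 = 0"
    "b5 + 2 * c4 + 10 * c5 = 0"
    "c5 = 0" by blast+
  \<comment> \<open>The cubic condition multiplied by 8. Its five lowest coefficients and the six of
    the conic form eleven equations, as many as the rank.\<close>
  have "(- 8 * b0 - 8 * b1 - 8 * b3 + 8 * c0 + 8 * c1 + 8 * c3)
      + (8 * b0 + 16 * b1 - 8 * b2 + 24 * b3 - 8 * b4 - 16 * c0 - 24 * c1 + 8 * c2 - 32 * c3 + 8 * c4) * r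
      + (- 12 * b1 + 16 * b2 - 32 * b3 + 24 * b4 - 8 * b5 + 12 * c0 + 32 * c1 - 24 * c2 + 60 * c3 - 32 * c4 + 8 * c5) * r^2
      + (4 * b1 - 12 * b2 + 24 * b3 - 32 * b4 + 24 * b5 - 20 * c1 + 32 * c2 - 64 * c3 + 60 * c4 - 32 * c5) * r^3
      + (4 * b2 - 10 * b3 + 24 * b4 - 32 * b5 + 6 * c1 - 20 * c2 + 42 * c3 - 64 * c4 + 60 * c5) * r^4
      + (2 * b3 - 10 * b4 + 24 * b5 + 6 * c2 - 16 * c3 + 42 * c4 - 64 * c5) * r^5
      + (2 * b4 - 10 * b5 + 3 * c3 - 16 * c4 + 42 * c5) * r^6
      + (2 * b5 + 3 * c4 - 16 * c5) * r^7
      + (3 * c5) * r^8 = 0" for r :: complex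
  proof -
    define y w where "y = 1 - r + r^2 / 2" and "w = 3 * r^2 / 2"
    have "2 * y = 2 - 2 * r + r^2" "2 * w = 3 * r^2" by (simp_all add: y_def w_def field_simps)
    with cubic[of r, unfolded Let_def, folded y_def w_def] show ?thesis by algebra
  qed
  from poly9_zero[OF this]
  have k: "- 8 * b0 - 8 * b1 - 8 * b3 + 8 * c0 + 8 * c1 + 8 * c3 = 0"
    "8 * b0 + 16 * b1 - 8 * b2 + 24 * b3 - 8 * b4 - 16 * c0 - 24 * c1 + 8 * c2 - 32 * c3 + 8 * c4 = 0"
    "- 12 * b1 + 16 * b2 - 32 * b3 + 24 * b4 - 8 * b5 + 12 * c0 + 32 * c1 - 24 * c2 + 60 * c3 - 32 * c4 + 8 * c5 = 0"
    "4 * b1 - 12 * b2 + 24 * b3 - 32 * b4 + 24 * b5 - 20 * c1 + 32 * c2 - 64 * c3 + 60 * c4 - 32 * c5 = 0"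
    "4 * b2 - 10 * b3 + 24 * b4 - 32 * b5 + 6 * c1 - 20 * c2 + 42 * c3 - 64 * c4 + 60 * c5 = 0" by blast+
  have "b0 = 0" "b1 = 2 * c2" "b2 = - 2 * c2" "b3 = - 4 * c2" "b4 = 3 * c2" "b5 = 0"
    "c0 = 0" "c1 = 0" "c3 = - 2 * c2" "c4 = 0" "c5 = 0"
    using q k by algebra+
  then show ?thesis by simp
qed

text \<open>Tangency to the line makes \<open>B\<close> divisible by \<open>x\<close>, and
  \<open>C\<close> as well because of the Euler relation; twelve coefficients remain at
  \<open>x = 1\<close>, which the conic and the cubic determine up to scale. The Euler relation then
  recovers \<open>A\<close>.\<close>

lemma H4_unique:
  assumes fol: "plane_foliation 2 A B C"
    and cubic: "tangent_to (plane_field A B C) (curve H4_cubic)"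
    and conic: "tangent_to (plane_field A B C) (curve H4_conic)"
    and line: "tangent_to (plane_field A B C) (curve H4_line)"
  shows "\<exists>c. c \<noteq> 0 \<and> (\<forall>x y z. A x y z = c * H4A x y z \<and> B x y z = c * H4B x y z \<and> C x y z = c * H4C x y z)"
proof -
  have f: "form 3 (on3 A)" "form 3 (on3 B)" "form 3 (on3 C)"
    and euler: "\<And>x y z. x * A x y z + y * B x y z + z * C x y z = 0"
    and gcd: "\<And>g A' B' C'. polyfun (on3 g) \<Longrightarrow> polyfun (on3 A') \<Longrightarrow> polyfun (on3 B') \<Longrightarrow> polyfun (on3 C') \<Longrightarrow>
      \<forall>x y z. A x y z = g x y z * A' x y z \<and> B x y z = g x y z * B' x y z \<and> C x y z = g x y z * C' x y z \<Longrightarrow>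
      \<exists>c. \<forall>x y z. g x y z = c"
    using fol unfolding plane_foliation_def by auto
  have hom: "F (c * x) (c * y) (c * z) = c^3 * F x y z" if "form 3 (on3 F)" for F c x y z
    using form_smul[OF that, of c "vec4 x y z 0"] by (simp add: on3_def)
  have z0: "genp (\<lambda>y z. z \<noteq> 0)" by (rule genp_bipoly[where p = 0 and q = 1, OF bipoly_basic(3)]) simp
  have B0: "B 0 y z = 0" for y z
  proof (rule genp_vanish[where F = "B 0"])
    show "bipoly (B 0)" unfolding bipoly_def by (intro polyfun_on3[OF form_polyfun[OF f(2)]] polyfun.intros)
    show "genp (\<lambda>y z. B 0 y z = 0)" using z0
    proof (rule genp_mono)
      fix y z :: complex assume "z \<noteq> 0"
      then have "B 0 y z = z^3 * B 0 (y / z) 1" using hom[OF f(2), of z 0 "y / z" 1] by simp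
      then show "B 0 y z = 0" using line_tangency[OF line] by simp
    qed
  qed
  have C0: "C 0 y z = 0" for y z
  proof (rule genp_vanish[where F = "C 0"])
    show "bipoly (C 0)" unfolding bipoly_def by (intro polyfun_on3[OF form_polyfun[OF f(3)]] polyfun.intros)
    show "genp (\<lambda>y z. C 0 y z = 0)" using z0
    proof (rule genp_mono)
      fix y z :: complex assume "z \<noteq> 0"
      then show "C 0 y z = 0" using euler[of 0 y z] B0 by simp
    qed
  qed
  obtain b0 b1 b2 b3 b4 b5 where
    b: "\<And>y z. B 1 y z = b0 + b1 * y + b2 * z + b3 * y^2 + b4 * (y * z) + b5 * z^2"
    using cubic_form_dehomogenized[OF f(2) B0] by blast
  obtain c0 c1 c2 c3 c4 c5 where
    c: "\<And>y z. C 1 y z = c0 + c1 * y + c2 * z + c3 * y^2 + c4 * (y * z) + c5 * z^2"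
    using cubic_form_dehomogenized[OF f(3) C0] by blast
  define E where "E r = B 1 (1 - r + r^2 / 2) (r * (1 - r + r^2 / 2)) * (r - 1) +
    C 1 (1 - r + r^2 / 2) (r * (1 - r + r^2 / 2)) * (1 - 2 * r + 3 * r^2 / 2)" for r
  \<comment> \<open>The parameters excluded in \<open>cubic_tangency\<close> are covered because
    \<open>E\<close> is a polynomial in \<open>r\<close>; the second variable is a dummy.\<close>
  have E0: "E r = 0" for r
  proof (rule genp_vanish[where F = "\<lambda>r x. E r" and q = 0])
    have "genp (\<lambda>r x. r - 1 \<noteq> 0)" by (rule genp_bipoly[where p = 0 and q = 0]) (intro bipoly_rules, simp)
    moreover have "genp (\<lambda>r x. 1 - r + r^2 / 2 \<noteq> 0)"
      by (rule genp_bipoly[where p = 0 and q = 0]) (intro bipoly_rules, simp)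
    ultimately have "genp (\<lambda>r x. r - 1 \<noteq> 0 \<and> 1 - r + r^2 / 2 \<noteq> 0)" by (rule genp_conj)
    then show "genp (\<lambda>r x. E r = 0)"
      by (rule genp_mono) (simp add: E_def cubic_tangency[OF cubic])
    show "bipoly (\<lambda>r x. E r)" unfolding E_def b c by (intro bipoly_rules)
  qed
  have sys: "b0 = 0 \<and> b1 = 2 * c2 \<and> b2 = - 2 * c2 \<and> b3 = - 4 * c2 \<and> b4 = 3 * c2 \<and> b5 = 0 \<and>
    c0 = 0 \<and> c1 = 0 \<and> c3 = - 2 * c2 \<and> c4 = 0 \<and> c5 = 0"
  proof (rule tangency_system)
    show "(let z = (y^2 + 4 * y - 1) / 2 in
      (b0 + b1 * y + b2 * z + b3 * y^2 + b4 * (y * z) + b5 * z^2) +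
      (c0 + c1 * y + c2 * z + c3 * y^2 + c4 * (y * z) + c5 * z^2) * (y + 2)) = 0" for y
      unfolding Let_def using conic_tangency[OF conic, of y] unfolding b c .
    show "(let y = 1 - r + r^2 / 2; z = r * (1 - r + r^2 / 2) in
      (b0 + b1 * y + b2 * z + b3 * y^2 + b4 * (y * z) + b5 * z^2) * (r - 1) +
      (c0 + c1 * y + c2 * z + c3 * y^2 + c4 * (y * z) + c5 * z^2) * (1 - 2 * r + 3 * r^2 / 2)) = 0" for r
      unfolding Let_def using E0[of r] unfolding E_def b c .
  qed
  \<comment> \<open>\<open>c2\<close> is the coefficient of \<open>z\<close> in
    \<open>C 1 y z\<close>, and that of \<open>H4C 1 y z = 2 y^2 - z\<close> is -1.\<close>
  define k where "k = - c2"
  have B1: "B 1 y z = k * H4B 1 y z" and C1: "C 1 y z = k * H4C 1 y z" for y z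
    unfolding b c H4B_def H4C_def k_def using sys by (simp_all add: algebra_simps)
  have scale: "F x y z = k * G x y z"
    if F: "form 3 (on3 F)" and G: "form 3 (on3 G)" and 0: "F 0 y z = 0" "G 0 y z = 0"
      and 1: "\<And>y z. F 1 y z = k * G 1 y z" for F G x y z
  proof (cases "x = 0")
    case False
    then show ?thesis
      using hom[OF F, of x 1 "y / x" "z / x"] hom[OF G, of x 1 "y / x" "z / x"] 1 by simp
  qed (simp add: 0)
  have Bk: "B x y z = k * H4B x y z" for x y z
    by (rule scale[OF f(2) form_H4(2) B0 _ B1]) (simp add: H4B_def)
  have Ck: "C x y z = k * H4C x y z" for x y z
    by (rule scale[OF f(3) form_H4(3) C0 _ C1]) (simp add: H4C_def)
  have Ak: "A x y z = k * H4A x y z" for x y z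
  proof -
    have "A (v 0) (v 1) (v 2) - k * H4A (v 0) (v 1) (v 2) = 0" for v :: vec
    proof (rule polyfun_cancel[where f = "\<lambda>v. A (v 0) (v 1) (v 2) - k * H4A (v 0) (v 1) (v 2)"
          and g = "\<lambda>v. v 0" and w = "vec4 1 0 0 0"])
      show "polyfun (\<lambda>v. A (v 0) (v 1) (v 2) - k * H4A (v 0) (v 1) (v 2))"
        by (intro polyfun_diff polyfun.intros polyfun_on3[OF form_polyfun[OF f(1)]]
            polyfun_on3[OF form_polyfun[OF form_H4(1)]])
      show "polyfun (\<lambda>v. v 0)" by (rule polyfun.coord)
      fix v :: vec
      have "v 0 * H4A (v 0) (v 1) (v 2) + v 1 * H4B (v 0) (v 1) (v 2) + v 2 * H4C (v 0) (v 1) (v 2) = 0"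
        unfolding H4A_def H4B_def H4C_def by algebra
      then show "v 0 * (A (v 0) (v 1) (v 2) - k * H4A (v 0) (v 1) (v 2)) = 0"
        using euler[of "v 0" "v 1" "v 2"] unfolding Bk Ck by algebra
    qed simp
    from this[of "vec4 x y z 0"] show ?thesis by simp
  qed
  have "k \<noteq> 0"
  proof
    assume "k = 0"
    \<comment> \<open>The zero form would have the nonconstant common factor
      \<open>x\<close>.\<close>
    have zero: "polyfun (on3 (\<lambda>x y z. 0))" and x: "polyfun (on3 (\<lambda>x y z. x))"
      unfolding on3_def by (rule polyfun.intros)+
    have "\<exists>c. \<forall>(x::complex) (y::complex) (z::complex). x = c"
      by (rule gcd[OF x zero zero zero]) (simp add: Ak Bk Ck \<open>k = 0\<close>)
    then obtain c :: complex where "\<And>x. x = c" by blast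
    from this[of 0] this[of 1] show False by simp
  qed
  then show ?thesis using Ak Bk Ck by blast
qed

theorem theorem2:
  shows "plane_foliation 2 H4A H4B H4C
    \<and> (\<forall>M F L. santos_F4 M F L \<longrightarrow>
         (\<exists>\<phi>. birational (proj 2) M \<phi> \<and> pulls_back (proj 2) \<phi> F (plane_field H4A H4B H4C)
            \<and> strict_transform (proj 2) M \<phi> (curve H4_cubic) = L))
    \<and> nodal_cubic H4_cubic \<and> inflectional_line H4_cubic H4_line \<and> smooth_conic H4_conic
    \<and> tangent_to (plane_field H4A H4B H4C) (curve H4_cubic)
    \<and> tangent_to (plane_field H4A H4B H4C) (curve H4_line)
    \<and> tangent_to (plane_field H4A H4B H4C) (curve H4_conic)
    \<and> (\<forall>A B C. plane_foliation 2 A B C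
         \<and> tangent_to (plane_field A B C) (curve H4_cubic)
         \<and> tangent_to (plane_field A B C) (curve H4_conic)
         \<and> tangent_to (plane_field A B C) (curve H4_line)
         \<longrightarrow> (\<exists>c. c \<noteq> 0 \<and> (\<forall>x y z. A x y z = c * H4A x y z \<and> B x y z = c * H4B x y z
              \<and> C x y z = c * H4C x y z)))"
  using plane_foliation_H4 santos_F4_plane_model nodal_cubic_H4 inflectional_line_H4
    smooth_conic_H4 tangent_H4 H4_unique by blast

end
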